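(* For every $\varepsilon>0$ there exist $\rho>0$ and $n_0$ such that every $3$-uniform hypergraph $H$ on $n\geq n_0$ vertices which is $(\rho,1/4+\varepsilon)$-dense in the (vertex, pair) sense and satisfies $\delta_1(H)\geq \varepsilon\binom{n}{2}$ contains a tight Hamilton cycle.
   Context: For a $3$-uniform hypergraph $H=(V,E)$, $\delta_1(H)$ denotes the minimum vertex degree, i.e. the minimum over $v\in V$ of the number of edges of $H$ containing $v$. Density: for $\rho,d\in(0,1]$, a $3$-uniform hypergraph $H=(V,E)$ on $n$ vertices is $(\rho,d)$-dense in the (vertex, pair) sense if for every set of vertices $X\subseteq V$ and every collection of ordered pairs $P\subseteq V\times V$ we have $$|\{(x,(y,z))\in X\times P\colon \{x,y,z\}\in E\}|\geq d|X||P|-\rho n^3.$$ A tight path is an ordered set of distinct vertices $(v_1,\dots,v_\ell)$ such that every three consecutive vertices form an edge. A tight path $v_1v_2\dots v_\ell$ together with the edges $v_{\ell-1}v_\ell v_1$ and $v_\ell v_1v_2$ forms a tight cycle. A tight Hamilton cycle is a tight cycle covering all vertices of the hypergraph. *)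

theory Defs
  imports Complex_Main
begin

definition uniform3_hypergraph :: "'a set \<Rightarrow> 'a set set \<Rightarrow> bool" where
  "uniform3_hypergraph V E \<longleftrightarrow> finite V \<and> (\<forall>e\<in>E. e \<subseteq> V \<and> card e = 3)"

definition vertex_degree :: "'a set set \<Rightarrow> 'a \<Rightarrow> nat" where
  "vertex_degree E v = card {e \<in> E. v \<in> e}"

(* Only meaningful for nonempty finite V, since Min {} is unspecified. *)
definition min_vertex_degree :: "'a set \<Rightarrow> 'a set set \<Rightarrow> nat" where
  "min_vertex_degree V E = Min (vertex_degree E ` V)"

(* P consists of ordered pairs, with y = z allowed.  The usual restriction of rho and d
   to (0,1] is deliberately not a conjunct here: as a conjunct it would make the predicate
   false, hence useless as a hypothesis, for parameters outside that range. *)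
definition vertex_pair_dense :: "real \<Rightarrow> real \<Rightarrow> 'a set \<Rightarrow> 'a set set \<Rightarrow> bool" where
  "vertex_pair_dense \<rho> d V E \<longleftrightarrow>
     (\<forall>X P. X \<subseteq> V \<longrightarrow> P \<subseteq> V \<times> V \<longrightarrow>
        real (card {(x, (y, z)). (x, (y, z)) \<in> X \<times> P \<and> {x, y, z} \<in> E})
          \<ge> d * real (card X) * real (card P) - \<rho> * real (card V) ^ 3)"

definition tight_path :: "'a set \<Rightarrow> 'a set set \<Rightarrow> 'a list \<Rightarrow> bool" where
  "tight_path V E vs \<longleftrightarrow> set vs \<subseteq> V \<and> distinct vs \<and>
     (\<forall>i. i + 2 < length vs \<longrightarrow> {vs ! i, vs ! (i + 1), vs ! (i + 2)} \<in> E)"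

(* The length bound only keeps the indices of the two closing edges in range. *)
definition tight_cycle :: "'a set \<Rightarrow> 'a set set \<Rightarrow> 'a list \<Rightarrow> bool" where
  "tight_cycle V E vs \<longleftrightarrow> tight_path V E vs \<and> length vs \<ge> 3 \<and>
     {vs ! (length vs - 2), vs ! (length vs - 1), vs ! 0} \<in> E \<and>
     {vs ! (length vs - 1), vs ! 0, vs ! 1} \<in> E"

definition tight_Hamilton_cycle :: "'a set \<Rightarrow> 'a set set \<Rightarrow> 'a list \<Rightarrow> bool" where
  "tight_Hamilton_cycle V E vs \<longleftrightarrow> tight_cycle V E vs \<and> set vs = V"

end

theory Submission
  imports Defs "HOL-Library.Multiset"
begin

text \<open>The proof uses the absorption method, without regularity or randomness.  Call a set of ordered
  pairs cyclically closed if going around an edge, from \<open>(y, z)\<close> to \<open>(z, x)\<close> to \<open>(x, y)\<close>, respects it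
  up to few exceptions.  The key fact is that at density \<open>1/4 + \<epsilon>\<close> such a set is nearly empty or
  nearly everything.  Otherwise the set and its complement are both dense inside a large class of
  vertices with almost equal in-degrees \<open>s n\<close> and out-degrees \<open>t n\<close>; passing repeatedly to the
  neighbourhoods of a vertex gives \<open>s t > 1/4\<close> for the set and \<open>(1 - s) (1 - t) > 1/4\<close> for its
  complement, which is impossible.  Applied to the pairs reachable by tight walks of length \<open>l\<close>, which
  stabilise modulo 3, this shows that almost all ordered pairs are connected by tight paths
  of bounded length, and by paths of two consecutive lengths.

  Any two vertices can be exchanged inside suitable tight paths via a common link with a third vertex.
  Together with two walks of consecutive lengths this yields absorbers for every vertex, and a greedy choice
  guided by an exponential potential yields a short absorbing path.  This path is extended at both ends
  as long as many vertices are left; the ends are then connected, and the remaining vertices are absorbed.\<close>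

section \<open>Tight walks and density\<close>

text \<open>The number 1/4 is the largest product of two nonnegative reals with sum at most 1. If a
  cyclically closed set contains (y, z), then for nearly every edge {x, y, z} the vertex y is an
  out-neighbour and z an in-neighbour of x. The pairs seen by x thus lie in a product of two
  neighbourhoods, and seeing more than a quarter of all pairs forces in-degree plus out-degree above
  n. The complement has complementary degrees, and both sums cannot exceed n. There is no lower
  bound on pair degrees: a pair may lie in no edge at all. Connections are therefore promised only
  between pairs with many continuations (\<open>good\<close>), and every construction keeps its two
  ends of this kind, read outwards. Density alone gives the connections; the minimum degree enters
  only through absorption, where it makes every link dense. Separate absorbers for each single
  vertex would not fit into a short path. Absorption is therefore split: a vertex takes the place of
  the centre u of a gadget that it fits, and u, fixed in advance, has its own absorber. Sets
  \<open>F\<close> of forbidden vertices do the work of random choices.\<close>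

fun tight_walk :: "'a set set \<Rightarrow> 'a list \<Rightarrow> bool" where
  "tight_walk E (x # y # z # zs) \<longleftrightarrow> {x, y, z} \<in> E \<and> tight_walk E (y # z # zs)"
| "tight_walk E _ \<longleftrightarrow> True"

lemma tight_walk_iff_nth:
  "tight_walk E xs \<longleftrightarrow> (\<forall>i. i + 2 < length xs \<longrightarrow> {xs ! i, xs ! (i + 1), xs ! (i + 2)} \<in> E)"
proof (induction E xs rule: tight_walk.induct)
  case (1 E x y z zs)
  have "(\<forall>i. i + 2 < length (x # y # z # zs) \<longrightarrow> {(x # y # z # zs) ! i, (x # y # z # zs) ! (i + 1), (x # y # z # zs) ! (i + 2)} \<in> E)
     \<longleftrightarrow> {x, y, z} \<in> E \<and> (\<forall>i. Suc i + 2 < length (x # y # z # zs) \<longrightarrow> {(x # y # z # zs) ! Suc i, (x # y # z # zs) ! (Suc i + 1), (x # y # z # zs) ! (Suc i + 2)} \<in> E)"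
    (is "(\<forall>i. ?P i) \<longleftrightarrow> ?Q \<and> (\<forall>i. ?P (Suc i))")
  proof -
    have "(\<forall>i. ?P i) \<longleftrightarrow> ?P 0 \<and> (\<forall>i. ?P (Suc i))"
      by (rule iffI, blast, rule allI, case_tac i, blast, blast)
    then show ?thesis by (simp add: numeral_2_eq_2)
  qed
  then show ?case using "1.IH" by simp
qed auto

text \<open>An edge sees only three consecutive vertices, so two consecutive vertices carry all that
  is needed to continue a walk. This is why ordered pairs are the states of every connection
  argument.\<close>

lemma tight_walk_append:
  "tight_walk E (xs @ a # b # ys) \<longleftrightarrow> tight_walk E (xs @ [a, b]) \<and> tight_walk E (a # b # ys)"
proof (induction xs rule: induct_list012)
  case (3 x y zs)
  then show ?case by (cases zs) auto
qed auto

lemma tight_walk_rev [simp]: "tight_walk E (rev xs) = tight_walk E xs"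
proof (induction E xs rule: tight_walk.induct)
  case (1 E x y z zs)
  have "tight_walk E (rev (x # y # z # zs)) = tight_walk E (rev zs @ z # y # [x])"
    by simp
  also have "\<dots> \<longleftrightarrow> tight_walk E (rev (y # z # zs)) \<and> {z, y, x} \<in> E"
    by (subst tight_walk_append) simp
  also have "{z, y, x} = {x, y, z}" by auto
  finally show ?case using "1.IH" by auto
qed auto

lemma tight_walk_exchange:
  assumes "tight_walk E (xs @ [a, b] @ M @ [c, d] @ ys)" "tight_walk E ([a, b] @ M' @ [c, d])"
  shows "tight_walk E (xs @ [a, b] @ M' @ [c, d] @ ys)"
proof -
  have 1: "tight_walk E (xs @ [a, b])" "tight_walk E (c # d # ys)"
    using assms(1) tight_walk_append[of E xs a b "M @ [c, d] @ ys"]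
      tight_walk_append[of E "a # b # M" c d ys] by auto
  have "tight_walk E ((a # b # M') @ c # d # ys)"
    using assms(2) 1 by (subst tight_walk_append) simp
  then show ?thesis
    using 1 tight_walk_append[of E xs a b "M' @ [c, d] @ ys"] by auto
qed

text \<open>Repeating the first two vertices turns the two closing edges into ordinary windows of a
  walk.\<close>

lemma tight_cycle_if_closed_walk:
  assumes "distinct vs" "set vs \<subseteq> V" "3 \<le> length vs" "tight_walk E (vs @ take 2 vs)"
  shows "tight_cycle V E vs"
proof -
  have *: "{(vs @ take 2 vs) ! i, (vs @ take 2 vs) ! (i + 1), (vs @ take 2 vs) ! (i + 2)} \<in> E"
    if "i < length vs" for i
    using assms(3,4) that by (simp add: tight_walk_iff_nth)
  obtain k where k: "length vs = Suc (Suc (Suc k))"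
    using assms(3) by (metis numeral_3_eq_3 less_eq_Suc_le le_Suc_ex add_Suc)
  have "tight_path V E vs"
    unfolding tight_path_def
  proof (intro conjI allI impI)
    fix i assume "i + 2 < length vs"
    then show "{vs ! i, vs ! (i + 1), vs ! (i + 2)} \<in> E"
      using *[of i] by (simp add: nth_append)
  qed (use assms in auto)
  moreover have "{vs ! (length vs - 2), vs ! (length vs - 1), vs ! 0} \<in> E"
    using *[of "length vs - 2"] k by (simp add: nth_append)
  moreover have "{vs ! (length vs - 1), vs ! 0, vs ! 1} \<in> E"
    using *[of "length vs - 1"] k by (simp add: nth_append)
  ultimately show ?thesis
    using assms(3) by (simp add: tight_cycle_def)
qed

section \<open>Double counting and the density condition\<close>

lemma card_relation_by_snd:
  assumes "finite X" "finite P"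
  shows "card {(x, p). x \<in> X \<and> p \<in> P \<and> Q x p} = (\<Sum>p\<in>P. card {x \<in> X. Q x p})"
proof -
  have "{(x, p). x \<in> X \<and> p \<in> P \<and> Q x p} = prod.swap ` (SIGMA p:P. {x \<in> X. Q x p})"
    by auto
  then show ?thesis
    using assms by (simp add: card_image)
qed

lemma card_relation_by_fst:
  assumes "finite X" "finite P"
  shows "card {(x, p). x \<in> X \<and> p \<in> P \<and> Q x p} = (\<Sum>x\<in>X. card {p \<in> P. Q x p})"
proof -
  have "{(x, p). x \<in> X \<and> p \<in> P \<and> Q x p} = (SIGMA x:X. {p \<in> P. Q x p})"
    by auto
  then show ?thesis
    using assms by simp
qed

lemma card_le_fibres:
  fixes c :: real
  assumes "finite B" "f ` A \<subseteq> B" "\<And>b. b \<in> B \<Longrightarrow> real (card {a \<in> A. f a = b}) \<le> c"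
    and "finite A"
  shows "real (card A) \<le> c * real (card B)"
proof -
  have "card A = (\<Sum>b\<in>B. card {a \<in> A. f a = b})"
    using sum.group[OF assms(4,1,2), of "\<lambda>_. 1::nat"] by simp
  then have "real (card A) = (\<Sum>b\<in>B. real (card {a \<in> A. f a = b}))" by simp
  also have "\<dots> \<le> (\<Sum>b\<in>B. c)" using assms by (intro sum_mono) auto
  finally show ?thesis by (simp add: mult.commute)
qed

lemma dense_sum:
  assumes "vertex_pair_dense \<rho> d V E" "finite V" "X \<subseteq> V" "P \<subseteq> V \<times> V"
  shows "d * real (card X) * real (card P) - \<rho> * real (card V) ^ 3
    \<le> real (card {(x, p). x \<in> X \<and> p \<in> P \<and> {x, fst p, snd p} \<in> E})"
proof -
  have "{(x, (y, z)). (x, (y, z)) \<in> X \<times> P \<and> {x, y, z} \<in> E}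
      = {(x, p). x \<in> X \<and> p \<in> P \<and> {x, fst p, snd p} \<in> E}"
    by auto
  then show ?thesis
    using assms(1)[unfolded vertex_pair_dense_def, rule_format, OF assms(3,4)] by simp
qed

text \<open>The error term is measured against the cube of the number of vertices, so passing to a
  fraction \<open>g\<close> of them costs \<open>g ^ 3\<close>. It serves for the vertices left
  uncovered by the path.\<close>

lemma dense_subset:
  assumes "vertex_pair_dense \<rho> d V E" "U \<subseteq> V" "0 < g" "g * real (card V) \<le> real (card U)"
    "\<rho> \<le> \<rho>' * g ^ 3" "0 \<le> \<rho>'"
  shows "vertex_pair_dense \<rho>' d U E"
  unfolding vertex_pair_dense_def
proof (intro allI impI)
  fix X P assume XP: "X \<subseteq> U" "P \<subseteq> U \<times> U"
  have "\<rho> * real (card V) ^ 3 \<le> \<rho>' * g ^ 3 * real (card V) ^ 3"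
    using assms by (intro mult_right_mono) auto
  also have "\<dots> = \<rho>' * (g * real (card V)) ^ 3" by (simp add: power_mult_distrib)
  also have "\<dots> \<le> \<rho>' * real (card U) ^ 3"
    using assms by (intro mult_left_mono power_mono) auto
  finally have "\<rho> * real (card V) ^ 3 \<le> \<rho>' * real (card U) ^ 3" .
  moreover have "d * real (card X) * real (card P) - \<rho> * real (card V) ^ 3
     \<le> real (card {(x, (y, z)). (x, (y, z)) \<in> X \<times> P \<and> {x, y, z} \<in> E})"
    by (rule assms(1)[unfolded vertex_pair_dense_def, rule_format]) (use assms(2) XP in auto)
  ultimately show "d * real (card X) * real (card P) - \<rho>' * real (card U) ^ 3
     \<le> real (card {(x, (y, z)). (x, (y, z)) \<in> X \<times> P \<and> {x, y, z} \<in> E})"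
    by linarith
qed

lemma dense_mono:
  assumes "vertex_pair_dense \<rho> d V E" "\<rho> \<le> \<rho>'" "d' \<le> d"
  shows "vertex_pair_dense \<rho>' d' V E"
  unfolding vertex_pair_dense_def
proof (intro allI impI)
  fix X P assume XP: "X \<subseteq> V" "P \<subseteq> V \<times> V"
  have "d' * real (card X) * real (card P) \<le> d * real (card X) * real (card P)"
    using assms by (intro mult_right_mono) auto
  moreover have "\<rho> * real (card V) ^ 3 \<le> \<rho>' * real (card V) ^ 3"
    using assms by (intro mult_right_mono) auto
  ultimately show "d' * real (card X) * real (card P) - \<rho>' * real (card V) ^ 3
     \<le> real (card {(x, (y, z)). (x, (y, z)) \<in> X \<times> P \<and> {x, y, z} \<in> E})"
    using assms(1)[unfolded vertex_pair_dense_def, rule_format, OF XP] by linarith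
qed

text \<open>Counts the continuations \<open>a b y z\<close>. Two steps are taken because the
  continuations then form a dense set of pairs free of \<open>a\<close> and \<open>b\<close>. These
  two need not lie in \<open>V\<close>: later \<open>V\<close> becomes the set of uncovered
  vertices, and the ends of the path lie outside.\<close>

definition good :: "real \<Rightarrow> 'a set \<Rightarrow> 'a set set \<Rightarrow> 'a \<Rightarrow> 'a \<Rightarrow> bool" where
  "good \<delta> V E a b \<longleftrightarrow>
     \<delta> * real (card V) ^ 2 \<le> real (card {(y, z) \<in> V \<times> V. {a, b, y} \<in> E \<and> {b, y, z} \<in> E})"

text \<open>Few pairs have degree below \<open>n / 8\<close>, as the average over a set of pairs is
  almost \<open>n / 4\<close>. If \<open>(a, b)\<close> has few continuations, at most
  \<open>n / 8\<close> of its third vertices \<open>y\<close> make \<open>(b, y)\<close> a pair of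
  higher degree, because each of them gives \<open>n / 8\<close> continuations and
  \<open>1/64 = (1/8)^2\<close>. Its other edges lead to the few pairs of low degree.\<close>

lemma few_not_good:
  assumes fin: "finite V" and dense: "vertex_pair_dense \<rho> d V E" and d: "1/4 \<le> d"
  shows "real (card {(a, b) \<in> V \<times> V. \<not> good (1/64) V E a b}) \<le> 72 * \<rho> * real (card V) ^ 2"
proof (cases "V = {}")
  case False
  define n where "n = real (card V)"
  have n: "n > 0" using False fin by (simp add: n_def card_gt_0_iff)
  have dense': "vertex_pair_dense \<rho> (1/4) V E" using dense d dense_mono by blast
  define cd where "cd = (\<lambda>p. card {x \<in> V. {x, fst p, snd p} \<in> E})"
  define Low where "Low = {p \<in> V \<times> V. real (cd p) < n / 8}"
  define P where "P = {(a, b) \<in> V \<times> V. \<not> good (1/64) V E a b}"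
  have Psub: "P \<subseteq> V \<times> V" "finite P" and Lsub: "Low \<subseteq> V \<times> V" "finite Low"
    using fin by (auto simp: P_def Low_def intro: finite_subset[of _ "V \<times> V"])
  have sm: "1/4 * n * real (card Q) - \<rho> * n ^ 3 \<le> (\<Sum>p\<in>Q. real (cd p))" if "Q \<subseteq> V \<times> V" "finite Q" for Q
  proof -
    have "card {(x, p). x \<in> V \<and> p \<in> Q \<and> {x, fst p, snd p} \<in> E} = (\<Sum>p\<in>Q. cd p)"
      unfolding cd_def by (rule card_relation_by_snd[OF fin that(2)])
    then show ?thesis
      using dense_sum[OF dense' fin order_refl that(1)] by (simp add: n_def)
  qed
  have "(\<Sum>p\<in>Low. real (cd p)) \<le> (\<Sum>p\<in>Low. n / 8)"
    by (intro sum_mono) (auto simp: Low_def)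
  then have "1/4 * n * real (card Low) - \<rho> * n ^ 3 \<le> n / 8 * real (card Low)"
    using sm[OF Lsub] by (simp add: mult.commute)
  then have "n * real (card Low) \<le> n * (8 * \<rho> * n ^ 2)"
    by (simp add: algebra_simps power2_eq_square power3_eq_cube)
  then have Low: "real (card Low) \<le> 8 * \<rho> * n ^ 2" using n by simp
  have deg: "real (cd p) \<le> n / 8 + real (card {y \<in> V. (snd p, y) \<in> Low})" if p: "p \<in> P" for p
  proof -
    obtain a b where ab: "p = (a, b)" "a \<in> V" "b \<in> V" "\<not> good (1/64) V E a b"
      using p by (auto simp: P_def)
    define Y where "Y = {y \<in> V. {y, a, b} \<in> E \<and> (b, y) \<notin> Low}"
    have finY: "finite Y" using fin by (simp add: Y_def)
    have "(SIGMA y:Y. {z \<in> V. {z, b, y} \<in> E}) \<subseteq> {(y, z) \<in> V \<times> V. {a, b, y} \<in> E \<and> {b, y, z} \<in> E}"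
      by (auto simp: Y_def insert_commute)
    then have "card (SIGMA y:Y. {z \<in> V. {z, b, y} \<in> E}) \<le> card {(y, z) \<in> V \<times> V. {a, b, y} \<in> E \<and> {b, y, z} \<in> E}"
      using fin by (intro card_mono finite_subset[OF _ finite_cartesian_product[OF fin fin]]) auto
    then have "(\<Sum>y\<in>Y. cd (b, y)) \<le> card {(y, z) \<in> V \<times> V. {a, b, y} \<in> E \<and> {b, y, z} \<in> E}"
      using fin finY by (simp add: cd_def)
    moreover have "real (card {(y, z) \<in> V \<times> V. {a, b, y} \<in> E \<and> {b, y, z} \<in> E}) < 1/64 * n ^ 2"
      using ab(4) by (simp add: good_def n_def)
    ultimately have 1: "real (\<Sum>y\<in>Y. cd (b, y)) < 1/64 * n ^ 2"
      by linarith
    have "(\<Sum>y\<in>Y. n / 8) \<le> (\<Sum>y\<in>Y. real (cd (b, y)))"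
      using ab by (intro sum_mono) (auto simp: Y_def Low_def)
    then have "real (card Y) * (n / 8) < 1/64 * n ^ 2"
      using 1 unfolding of_nat_sum sum_constant by (rule order.strict_trans1)
    then have "n * real (card Y) < n * (n / 8)" by (simp add: power2_eq_square algebra_simps)
    then have Yc: "real (card Y) \<le> n / 8" using n by simp
    have "{x \<in> V. {x, a, b} \<in> E} \<subseteq> Y \<union> {y \<in> V. (b, y) \<in> Low}"
      by (auto simp: Y_def)
    then have "cd p \<le> card Y + card {y \<in> V. (snd p, y) \<in> Low}"
      unfolding cd_def ab(1) using fin finY
      by (auto intro: order.trans[OF card_mono card_Un_le])
    then have "real (cd p) \<le> real (card Y) + real (card {y \<in> V. (snd p, y) \<in> Low})"
      by (metis of_nat_add of_nat_le_iff)
    then show ?thesis using Yc by linarith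
  qed
  have "(\<Sum>p\<in>P. real (card {y \<in> V. (snd p, y) \<in> Low})) \<le> (\<Sum>p\<in>V\<times>V. real (card {y \<in> V. (snd p, y) \<in> Low}))"
    using fin Psub by (intro sum_mono2) auto
  also have "\<dots> = (\<Sum>a\<in>V. \<Sum>b\<in>V. real (card {y \<in> V. (b, y) \<in> Low}))"
    by (simp only: sum.cartesian_product) (simp add: case_prod_beta)
  also have "\<dots> = n * real (\<Sum>b\<in>V. card {y \<in> V. (b, y) \<in> Low})"
    by (simp add: n_def)
  also have "(\<Sum>b\<in>V. card {y \<in> V. (b, y) \<in> Low}) = card (SIGMA b:V. {y \<in> V. (b, y) \<in> Low})"
    using fin by simp
  also have "(SIGMA b:V. {y \<in> V. (b, y) \<in> Low}) = Low"
    using Lsub by auto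
  finally have 2: "(\<Sum>p\<in>P. real (card {y \<in> V. (snd p, y) \<in> Low})) \<le> n * real (card Low)" .
  \<comment> \<open>The errors \<open>\<rho> n^3\<close> and \<open>8 \<rho> n^3\<close> stand
    against a gap of \<open>n / 4 - n / 8\<close> per pair, whence
    \<open>72 = 8 * (1 + 8)\<close>.\<close>
  have "1/4 * n * real (card P) - \<rho> * n ^ 3 \<le> (\<Sum>p\<in>P. real (cd p))"
    by (rule sm[OF Psub])
  also have "\<dots> \<le> (\<Sum>p\<in>P. n / 8 + real (card {y \<in> V. (snd p, y) \<in> Low}))"
    by (intro sum_mono deg)
  also have "\<dots> \<le> n / 8 * real (card P) + n * (8 * \<rho> * n ^ 2)"
    using order.trans[OF 2 mult_left_mono[OF Low, of n]] n by (simp add: sum.distrib mult.commute)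
  finally have "n * real (card P) \<le> n * (72 * \<rho> * n ^ 2)"
    by (simp add: algebra_simps power2_eq_square power3_eq_cube)
  then show ?thesis using n by (simp add: P_def n_def)
qed simp

section \<open>The density increment\<close>

text \<open>By the inequality of arithmetic and geometric means, \<open>a x * b x\<close> above
  \<open>(1 + \<beta>) * (s * t)\<close> forces \<open>a x / s + b x / t\<close> to be at least
  \<open>2 * (1 + \<beta> / 3)\<close>. If this held for all but a share \<open>\<beta> / 6\<close>
  of the vertices, the average of the sum would exceed 2.\<close>

lemma nearly_minimal_pair:
  fixes a b :: "'a \<Rightarrow> real"
  assumes fin: "finite V" and pos: "0 < s" "0 < t" "0 < \<beta>" "\<beta> \<le> 1"
    and B: "B \<subseteq> V" "real (card B) \<le> \<beta> / 6 * real (card V)" "V \<noteq> {}"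
    and nn: "\<And>x. x \<in> V \<Longrightarrow> 0 \<le> a x \<and> 0 \<le> b x"
    and sa: "(\<Sum>x\<in>V. a x) \<le> s * real (card V)" and sb: "(\<Sum>x\<in>V. b x) \<le> t * real (card V)"
  shows "\<exists>x\<in>V - B. a x * b x \<le> (1 + \<beta>) * (s * t)"
proof (rule ccontr)
  assume "\<not> ?thesis"
  then have c: "(1 + \<beta>) * (s * t) < a x * b x" if "x \<in> V - B" for x
    using that by (meson not_le)
  define n where "n = real (card V)"
  have n: "n > 0" using B(3) fin by (simp add: n_def card_gt_0_iff)
  have ge: "2 * (1 + \<beta> / 3) \<le> a x / s + b x / t" if x: "x \<in> V - B" for x
  proof -
    let ?u = "a x / s" and ?v = "b x / t"
    have uv: "0 \<le> ?u" "0 \<le> ?v" using nn[of x] x pos by auto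
    have "1 + \<beta> < ?u * ?v" using c[OF x] pos by (simp add: field_simps)
    moreover have "(1 + \<beta> / 3)\<^sup>2 \<le> 1 + \<beta>"
    proof -
      have "\<beta> * \<beta> \<le> \<beta> * 1" using pos by (intro mult_left_mono) auto
      moreover have "(1 + \<beta> / 3)\<^sup>2 = 1 + 2 * \<beta> / 3 + \<beta> * \<beta> / 9" by (simp add: power2_eq_square algebra_simps)
      ultimately show ?thesis using pos by linarith
    qed
    moreover have "(2 * (1 + \<beta> / 3))\<^sup>2 = 4 * (1 + \<beta> / 3)\<^sup>2" unfolding power_mult_distrib by simp
    moreover have amgm: "4 * (u * v) \<le> (u + v)\<^sup>2" for u v :: real
      using sum_squares_bound[of u v] by (simp add: power2_eq_square algebra_simps)
    ultimately have "(2 * (1 + \<beta> / 3))\<^sup>2 \<le> (?u + ?v)\<^sup>2"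
      using amgm[of ?u ?v] by linarith
    then show ?thesis by (rule power2_le_imp_le) (use uv in auto)
  qed
  have "real (card (V - B)) = n - real (card B)"
    using B(1) fin by (simp add: n_def card_Diff_subset finite_subset of_nat_diff card_mono)
  then have "(1 - \<beta> / 6) * n \<le> real (card (V - B))" using B(2) by (simp add: n_def algebra_simps)
  then have "2 * (1 + \<beta> / 3) * ((1 - \<beta> / 6) * n) \<le> 2 * (1 + \<beta> / 3) * real (card (V - B))"
    using pos by (intro mult_left_mono) auto
  also have "\<dots> = (\<Sum>x\<in>V - B. 2 * (1 + \<beta> / 3))" by simp
  also have "\<dots> \<le> (\<Sum>x\<in>V - B. a x / s + b x / t)" by (intro sum_mono ge)
  also have "\<dots> \<le> (\<Sum>x\<in>V. a x / s + b x / t)"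
    using fin nn pos by (intro sum_mono2) auto
  also have "\<dots> = (\<Sum>x\<in>V. a x) / s + (\<Sum>x\<in>V. b x) / t"
    by (simp add: sum.distrib sum_divide_distrib)
  also have "\<dots> \<le> n + n"
    using sa sb pos by (intro add_mono) (auto simp: n_def field_simps)
  finally have "(1 + \<beta> / 3) * (1 - \<beta> / 6) * n \<le> 1 * n" by (simp add: algebra_simps)
  then have "(1 + \<beta> / 3) * (1 - \<beta> / 6) \<le> 1" using n by simp
  moreover have "(1 + \<beta> / 3) * (1 - \<beta> / 6) = 1 + \<beta> / 6 * (1 - \<beta> / 3)" by (simp add: algebra_simps)
  moreover have "0 < \<beta> / 6 * (1 - \<beta> / 3)" using pos by simp
  ultimately show False by linarith
qed

text \<open>If \<open>s * t\<close> were not larger than \<open>1/4\<close>, each such step would raise the density of \<open>P\<close> in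
  \<open>Y \<times> Z\<close> by a constant factor, which cannot go on forever.\<close>

lemma increment_step:
  fixes A1 A2 P :: "('a \<times> 'a) set" and \<epsilon> s t :: real
  assumes fin: "finite V" and YZ: "Y \<subseteq> V" "Z \<subseteq> V" "P \<subseteq> Y \<times> Z"
    and eps: "0 < \<epsilon>" "\<epsilon> \<le> 1" and st: "0 < s" "0 < t" "0 < p"
    and dense: "\<And>X. X \<subseteq> V \<Longrightarrow> (1/4 + \<epsilon>) * real (card X) * real (card P) - \<eta> * real (card V) ^ 3
        \<le> real (card {(x, q). x \<in> X \<and> q \<in> P \<and> (x, fst q) \<in> A2 \<and> (snd q, x) \<in> A1})"
    and Pc: "p * real (card V) ^ 2 \<le> real (card P)" "V \<noteq> {}"
    and eta: "0 \<le> \<eta>" "\<eta> \<le> \<epsilon>\<^sup>2 * p / 96"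
    and deg: "\<And>y. y \<in> Y \<Longrightarrow> real (card {x \<in> V. (x, y) \<in> A2}) \<le> s * real (card V)"
      "\<And>z. z \<in> Z \<Longrightarrow> real (card {x \<in> V. (z, x) \<in> A1}) \<le> t * real (card V)"
  shows "\<exists>x. (1/4 + \<epsilon>/2) * real (card P)
        \<le> real (card {q \<in> P. (x, fst q) \<in> A2 \<and> (snd q, x) \<in> A1}) \<and>
      real (card {y \<in> Y. (x, y) \<in> A2}) * real (card {z \<in> Z. (z, x) \<in> A1})
        \<le> (1 + \<epsilon> / 8) * (s * t) * (real (card Y) * real (card Z))"
proof -
  define n where "n = real (card V)"
  have n: "n > 0" using Pc fin by (simp add: n_def card_gt_0_iff)
  have finYZ: "finite Y" "finite Z" "finite P" using YZ fin finite_subset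
    by (auto intro: finite_subset[of P "Y \<times> Z"] finite_subset)
  have Ppos: "0 < real (card P)" 
  proof -
    have "0 < p * n ^ 2" using st n by simp
    then show ?thesis using Pc(1) by (simp add: n_def)
  qed
  then have "P \<noteq> {}" by auto
  then have "Y \<noteq> {}" "Z \<noteq> {}" using YZ(3) by auto
  then have cYZ: "0 < real (card Y)" "0 < real (card Z)" using finYZ by (auto simp: card_gt_0_iff)
  define Px where "Px = (\<lambda>x. {q \<in> P. (x, fst q) \<in> A2 \<and> (snd q, x) \<in> A1})"
  \<comment> \<open>The vertices that see too few pairs of \<open>P\<close>. Density with
    \<open>X = B\<close> bounds their number by \<open>\<epsilon> / 48 * n\<close>, the allowance of
    \<open>nearly_minimal_pair\<close> for \<open>\<epsilon> / 8\<close>; this is the origin of 96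
    in the bound on \<open>\<eta>\<close>.\<close>
  define B where "B = {x \<in> V. real (card (Px x)) < (1/4 + \<epsilon>/2) * real (card P)}"
  have BV: "B \<subseteq> V" "finite B" using fin by (auto simp: B_def)
  have "(1/4 + \<epsilon>) * real (card B) * real (card P) - \<eta> * n ^ 3 \<le> real (\<Sum>x\<in>B. card (Px x))"
    using dense[OF BV(1)] card_relation_by_fst[OF BV(2) finYZ(3), of "\<lambda>x q. (x, fst q) \<in> A2 \<and> (snd q, x) \<in> A1"]
    by (simp add: Px_def n_def)
  also have "\<dots> \<le> (\<Sum>x\<in>B. (1/4 + \<epsilon>/2) * real (card P))"
    unfolding of_nat_sum by (intro sum_mono) (auto simp: B_def)
  finally have "\<epsilon> / 2 * (real (card B) * real (card P)) \<le> \<eta> * n ^ 3"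
    by (simp add: algebra_simps)
  moreover have "\<epsilon> / 2 * (real (card B) * (p * n ^ 2)) \<le> \<epsilon> / 2 * (real (card B) * real (card P))"
    using Pc eps by (intro mult_left_mono) (auto simp: n_def)
  moreover have "\<eta> * n ^ 3 \<le> (\<epsilon>\<^sup>2 * p / 96) * n ^ 3" using eta n by (intro mult_right_mono) auto
  ultimately have "\<epsilon> / 2 * (real (card B) * (p * n ^ 2)) \<le> (\<epsilon>\<^sup>2 * p / 96) * n ^ 3" by linarith
  then have "(\<epsilon> * p * n ^ 2 / 2) * real (card B) \<le> (\<epsilon> * p * n ^ 2 / 2) * (\<epsilon> / 8 / 6 * n)"
    by (simp add: power2_eq_square power3_eq_cube algebra_simps)
  then have Bc: "real (card B) \<le> \<epsilon> / 8 / 6 * n"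
    using eps st n by (subst (asm) mult_le_cancel_left_pos) auto
  \<comment> \<open>Relative degrees of \<open>x\<close> into \<open>Y\<close> and \<open>Z\<close>;
    exchanging the summations turns the degree bounds on \<open>Y\<close> and \<open>Z\<close> into
    bounds on averages over \<open>x\<close>.\<close>
  define a where "a = (\<lambda>x. real (card {y \<in> Y. (x, y) \<in> A2}) / real (card Y))"
  define b where "b = (\<lambda>x. real (card {z \<in> Z. (z, x) \<in> A1}) / real (card Z))"
  have "(\<Sum>x\<in>V. real (card {y \<in> Y. (x, y) \<in> A2})) = (\<Sum>y\<in>Y. real (card {x \<in> V. (x, y) \<in> A2}))"
    unfolding of_nat_sum[symmetric]
    by (simp only: card_relation_by_fst[OF fin finYZ(1), symmetric] card_relation_by_snd[OF fin finYZ(1), symmetric])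
  also have "\<dots> \<le> (\<Sum>y\<in>Y. s * n)" unfolding n_def by (intro sum_mono deg)
  finally have sa: "(\<Sum>x\<in>V. a x) \<le> s * real (card V)"
    using cYZ unfolding a_def by (simp add: sum_divide_distrib[symmetric] n_def field_simps)
  have "(\<Sum>x\<in>V. real (card {z \<in> Z. (z, x) \<in> A1})) = (\<Sum>z\<in>Z. real (card {x \<in> V. (z, x) \<in> A1}))"
    unfolding of_nat_sum[symmetric]
    by (simp only: card_relation_by_fst[OF fin finYZ(2), symmetric] card_relation_by_snd[OF fin finYZ(2), symmetric])
  also have "\<dots> \<le> (\<Sum>z\<in>Z. t * n)" unfolding n_def by (intro sum_mono deg)
  finally have sb: "(\<Sum>x\<in>V. b x) \<le> t * real (card V)"
    using cYZ unfolding b_def by (simp add: sum_divide_distrib[symmetric] n_def field_simps)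
  obtain x where x: "x \<in> V - B" "a x * b x \<le> (1 + \<epsilon> / 8) * (s * t)"
    using nearly_minimal_pair[OF fin st(1,2), of "\<epsilon> / 8" B a b] eps BV Bc Pc(2) sa sb
    by (auto simp: a_def b_def n_def)
  have "real (card {y \<in> Y. (x, y) \<in> A2}) * real (card {z \<in> Z. (z, x) \<in> A1})
      = a x * b x * (real (card Y) * real (card Z))"
    using cYZ by (simp add: a_def b_def)
  also have "\<dots> \<le> (1 + \<epsilon> / 8) * (s * t) * (real (card Y) * real (card Z))"
    using x(2) cYZ by (intro mult_right_mono) auto
  finally show ?thesis
    using x(1) by (intro exI[of _ x]) (auto simp: B_def Px_def not_less)
qed

text \<open>\<open>\<eta>\<close> can be fixed before the hypergraph because the number
  \<open>K\<close> of increments depends only on \<epsilon> and \<open>p\<close>. Only relations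
  occur, not edges, so the lemma serves a closed family and its complement alike.\<close>

lemma degree_product_ge:
  fixes \<epsilon> p :: real
  assumes eps: "0 < \<epsilon>" "\<epsilon> \<le> 1" and p: "0 < p"
  obtains \<eta> where "0 < \<eta>" and "\<And>(V::'a set) X A0 A1 A2 s t.
    finite V \<Longrightarrow> V \<noteq> {} \<Longrightarrow> X \<subseteq> V \<Longrightarrow> 0 < s \<Longrightarrow> 0 < t \<Longrightarrow>
    (\<And>X' P. X' \<subseteq> V \<Longrightarrow> P \<subseteq> A0 \<Longrightarrow> P \<subseteq> V \<times> V \<Longrightarrow>
      (1/4 + \<epsilon>) * real (card X') * real (card P) - \<eta> * real (card V) ^ 3
        \<le> real (card {(x, q). x \<in> X' \<and> q \<in> P \<and> (x, fst q) \<in> A2 \<and> (snd q, x) \<in> A1})) \<Longrightarrow>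
    p * real (card V) ^ 2 \<le> real (card (A0 \<inter> X \<times> X)) \<Longrightarrow>
    (\<And>y. y \<in> X \<Longrightarrow> real (card {x \<in> V. (x, y) \<in> A2}) \<le> s * real (card V)) \<Longrightarrow>
    (\<And>z. z \<in> X \<Longrightarrow> real (card {x \<in> V. (z, x) \<in> A1}) \<le> t * real (card V)) \<Longrightarrow>
    1/4 + \<epsilon>/4 \<le> s * t"
proof -
  \<comment> \<open>Growth of the density in one step: the pairs keep a share of at least
    \<open>1/4 + \<epsilon>/2\<close>, the product \<open>Y \<times> Z\<close> at most
    \<open>(1 + \<epsilon>/8) * (1/4 + \<epsilon>/4)\<close>.\<close>
  define \<kappa> where "\<kappa> = 1 + \<epsilon> / 4"
  have lam: "1 < \<kappa>" using eps by (simp add: \<kappa>_def)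
  \<comment> \<open>After \<open>K\<close> steps the density, at least \<open>p\<close> at the
    start, would exceed 1.\<close>
  obtain K where K: "1 / p < \<kappa> ^ K" using real_arch_pow[OF lam] by blast
  \<comment> \<open>No step shrinks \<open>P\<close> by more than a factor 4, so
    \<open>p / 4 ^ K\<close> bounds the density of every \<open>P\<close> that occurs.\<close>
  define \<eta> where "\<eta> = \<epsilon>\<^sup>2 * (p / 4 ^ K) / 96"
  have eta: "0 < \<eta>" using eps p by (simp add: \<eta>_def)
  show thesis
  proof (rule that[OF eta])
    fix V :: "'a set" and X A0 A1 A2 s t
    assume fin: "finite V" "V \<noteq> {}" and X: "X \<subseteq> V" and st: "0 < s" "0 < t"
      and dense: "\<And>X' P. X' \<subseteq> V \<Longrightarrow> P \<subseteq> A0 \<Longrightarrow> P \<subseteq> V \<times> V \<Longrightarrow>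
        (1/4 + \<epsilon>) * real (card X') * real (card P) - \<eta> * real (card V) ^ 3
        \<le> real (card {(x, q). x \<in> X' \<and> q \<in> P \<and> (x, fst q) \<in> A2 \<and> (snd q, x) \<in> A1})"
      and Ac: "p * real (card V) ^ 2 \<le> real (card (A0 \<inter> X \<times> X))"
      and deg: "\<And>y. y \<in> X \<Longrightarrow> real (card {x \<in> V. (x, y) \<in> A2}) \<le> s * real (card V)"
        "\<And>z. z \<in> X \<Longrightarrow> real (card {x \<in> V. (z, x) \<in> A1}) \<le> t * real (card V)"
    define n where "n = real (card V)"
    have n: "n > 0" using fin by (simp add: n_def card_gt_0_iff)
    show "1/4 + \<epsilon>/4 \<le> s * t"
    proof (rule ccontr)
      assume "\<not> 1/4 + \<epsilon>/4 \<le> s * t"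
      then have st4: "s * t \<le> 1/4 + \<epsilon>/4" by simp
      have step_num: "(1 + \<epsilon> / 8) * (s * t) * \<kappa> \<le> 1/4 + \<epsilon>/2"
      proof -
        have "(1 + \<epsilon> / 8) * (s * t) * \<kappa> \<le> (1 + \<epsilon> / 8) * (1/4 + \<epsilon>/4) * \<kappa>"
          using st4 eps lam by (intro mult_right_mono mult_left_mono) auto
        also have "\<dots> = 1/4 + \<epsilon>/2 - \<epsilon> / 32 * (5 - 13/4 * \<epsilon> - \<epsilon>\<^sup>2 / 4)"
          by (simp add: \<kappa>_def power2_eq_square field_simps)
        also have "\<dots> \<le> 1/4 + \<epsilon>/2"
        proof -
          have "0 \<le> 5 - 13/4 * \<epsilon> - \<epsilon>\<^sup>2 / 4"
            using eps power_le_one[of \<epsilon> 2] by simp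
          then have "0 \<le> \<epsilon> / 32 * (5 - 13/4 * \<epsilon> - \<epsilon>\<^sup>2 / 4)"
            using eps by (intro mult_nonneg_nonneg) auto
          then show ?thesis by simp
        qed
        finally show ?thesis .
      qed
      have ex: "\<exists>Y Z P. Y \<subseteq> X \<and> Z \<subseteq> X \<and> P \<subseteq> A0 \<inter> Y \<times> Z \<and> p / 4 ^ k * n ^ 2 \<le> real (card P) \<and>
          p * \<kappa> ^ k * (real (card Y) * real (card Z)) \<le> real (card P)" if "k \<le> K" for k
        using that
      proof (induction k)
        case 0
        have "real (card X) * real (card X) \<le> n * n"
          using X fin by (intro mult_mono) (auto simp: n_def card_mono)
        then have "p * (real (card X) * real (card X)) \<le> p * n ^ 2"
          using p by (simp add: power2_eq_square)
        then show ?case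
          using Ac by (intro exI[of _ X] exI[of _ X] exI[of _ "A0 \<inter> X \<times> X"]) (auto simp: n_def)
      next
        case (Suc k)
        then obtain Y Z P where IH: "Y \<subseteq> X" "Z \<subseteq> X" "P \<subseteq> A0 \<inter> Y \<times> Z" "p / 4 ^ k * n ^ 2 \<le> real (card P)"
          "p * \<kappa> ^ k * (real (card Y) * real (card Z)) \<le> real (card P)" by auto
        have "p / 4 ^ K \<le> p / 4 ^ k"
          using Suc.prems p by (intro divide_left_mono power_increasing) auto
        then have eta': "\<eta> \<le> \<epsilon>\<^sup>2 * (p / 4 ^ k) / 96"
          unfolding \<eta>_def using eps by (intro divide_right_mono mult_left_mono) auto
        have PV: "P \<subseteq> V \<times> V" "Y \<subseteq> V" "Z \<subseteq> V" "P \<subseteq> Y \<times> Z" using IH X by auto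
        then have finP: "finite P" "finite Y" "finite Z" using fin by (auto intro: finite_subset[of P "V \<times> V"] finite_subset)
        have PA: "P \<subseteq> A0" using IH(3) by blast
        have sdeg: "real (card {x \<in> V. (x, y) \<in> A2}) \<le> s * real (card V)" if "y \<in> Y" for y
          by (rule deg(1)) (use IH(1) that in blast)
        have tdeg: "real (card {x \<in> V. (z, x) \<in> A1}) \<le> t * real (card V)" if "z \<in> Z" for z
          by (rule deg(2)) (use IH(2) that in blast)
        have pk: "0 < p / 4 ^ k" using p by simp
        obtain x where x: "(1/4 + \<epsilon>/2) * real (card P)
            \<le> real (card {q \<in> P. (x, fst q) \<in> A2 \<and> (snd q, x) \<in> A1})"
          "real (card {y \<in> Y. (x, y) \<in> A2}) * real (card {z \<in> Z. (z, x) \<in> A1})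
            \<le> (1 + \<epsilon> / 8) * (s * t) * (real (card Y) * real (card Z))"
          using increment_step[OF fin(1) PV(2,3,4) eps st pk dense[OF _ PA PV(1)]
              IH(4)[unfolded n_def] fin(2) less_imp_le[OF eta] eta' sdeg tdeg] by blast
        define Y' Z' P' where "Y' = {y \<in> Y. (x, y) \<in> A2}" and "Z' = {z \<in> Z. (z, x) \<in> A1}"
          and "P' = {q \<in> P. (x, fst q) \<in> A2 \<and> (snd q, x) \<in> A1}"
        have sub: "Y' \<subseteq> X" "Z' \<subseteq> X" "P' \<subseteq> A0 \<inter> Y' \<times> Z'" using IH by (auto simp: Y'_def Z'_def P'_def)
        have "p / 4 ^ Suc k * n ^ 2 \<le> 1/4 * real (card P)" using IH(4) by simp
        also have "\<dots> \<le> (1/4 + \<epsilon>/2) * real (card P)" using eps by (intro mult_right_mono) auto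
        also have "\<dots> \<le> real (card P')" using x(1) by (simp add: P'_def)
        finally have c1: "p / 4 ^ Suc k * n ^ 2 \<le> real (card P')" .
        have "p * \<kappa> ^ Suc k * (real (card Y') * real (card Z'))
            \<le> p * \<kappa> ^ Suc k * ((1 + \<epsilon> / 8) * (s * t) * (real (card Y) * real (card Z)))"
          using x(2) p lam unfolding Y'_def Z'_def by (intro mult_left_mono) auto
        also have "\<dots> = ((1 + \<epsilon> / 8) * (s * t) * \<kappa>) * (p * \<kappa> ^ k * (real (card Y) * real (card Z)))"
          by simp
        also have "\<dots> \<le> (1/4 + \<epsilon>/2) * (p * \<kappa> ^ k * (real (card Y) * real (card Z)))"
          using step_num p lam by (intro mult_right_mono) auto
        also have "\<dots> \<le> (1/4 + \<epsilon>/2) * real (card P)"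
          using IH(5) eps by (intro mult_left_mono) auto
        also have "\<dots> \<le> real (card P')" using x(1) by (simp add: P'_def)
        finally show ?case using sub c1 by (intro exI[of _ Y'] exI[of _ Z'] exI[of _ P']) simp
      qed
      obtain Y Z P where F: "Y \<subseteq> X" "Z \<subseteq> X" "P \<subseteq> A0 \<inter> Y \<times> Z" "p / 4 ^ K * n ^ 2 \<le> real (card P)"
          "p * \<kappa> ^ K * (real (card Y) * real (card Z)) \<le> real (card P)"
        using ex[OF order_refl] by (elim exE conjE) (rule that)
      have finYZ: "finite Y" "finite Z" using F(1,2) X fin(1) by (auto intro: finite_subset)
      have "0 < p / 4 ^ K * n ^ 2" using p n by simp
      then have Ppos: "0 < real (card P)" using F(4) by linarith
      have "card P \<le> card (Y \<times> Z)" using F(3) finYZ by (intro card_mono) auto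
      then have le: "real (card P) \<le> real (card Y) * real (card Z)"
        using finYZ by (metis card_cartesian_product of_nat_le_iff of_nat_mult)
      then have "1 * (real (card Y) * real (card Z)) < p * \<kappa> ^ K * (real (card Y) * real (card Z))"
        using K p Ppos le by (intro mult_strict_right_mono) (auto simp: field_simps)
      then show False using F(5) le by simp
    qed
  qed
qed

section \<open>Cyclically closed sets of ordered pairs\<close>

definition triples :: "'a set \<Rightarrow> ('a \<Rightarrow> 'a \<Rightarrow> 'a \<Rightarrow> bool) \<Rightarrow> ('a \<times> 'a \<times> 'a) set" where
  "triples V R = {(x, q). x \<in> V \<and> q \<in> V \<times> V \<and> R x (fst q) (snd q)}"

lemma finite_triples [simp]: "finite V \<Longrightarrow> finite (triples V R)"
  by (rule finite_subset[of _ "V \<times> V \<times> V"]) (auto simp: triples_def)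

lemma card_triples_rotate: "card (triples V (\<lambda>x y z. R y z x)) = card (triples V R)"
proof -
  have "triples V R = (\<lambda>(x, y, z). (y, z, x)) ` triples V (\<lambda>x y z. R y z x)"
    by (force simp: triples_def)
  moreover have "inj (\<lambda>(x, y, z). (y, z, x))" by (auto simp: inj_def)
  ultimately show ?thesis by (metis card_image inj_on_subset subset_UNIV)
qed

text \<open>Up to \<open>\<eta> n\<^sup>3\<close> exceptions, going around an edge \<open>y z x\<close> moves an ordered pair from \<open>A0\<close> to
  \<open>A1\<close>, then to \<open>A2\<close> and back to \<open>A0\<close>, in both directions.\<close>

definition cyclically_closed ::
  "'a set \<Rightarrow> 'a set set \<Rightarrow> real \<Rightarrow> ('a \<times> 'a) set \<Rightarrow> ('a \<times> 'a) set \<Rightarrow> ('a \<times> 'a) set \<Rightarrow> bool" where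
  "cyclically_closed V E \<eta> A0 A1 A2 \<longleftrightarrow>
     real (card (triples V (\<lambda>x y z. {x, y, z} \<in> E \<and>
       \<not> (((y, z) \<in> A0 \<longleftrightarrow> (z, x) \<in> A1) \<and> ((y, z) \<in> A0 \<longleftrightarrow> (x, y) \<in> A2)))))
     \<le> \<eta> * real (card V) ^ 3"

text \<open>The exceptional triples are those whose three memberships do not all agree. This is
  symmetric, so rotating the relations amounts to rotating the triple, and any of the three may play
  the part of \<open>A0\<close>.\<close>

lemma cyclically_closed_rotate:
  assumes "cyclically_closed V E \<eta> A0 A1 A2"
  shows "cyclically_closed V E \<eta> A1 A2 A0"
proof -
  let ?R = "\<lambda>x y z. {x, y, z} \<in> E \<and> \<not> (((y, z) \<in> A1 \<longleftrightarrow> (z, x) \<in> A2) \<and> ((y, z) \<in> A1 \<longleftrightarrow> (x, y) \<in> A0))"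
  have "(\<lambda>x y z. ?R y z x) = (\<lambda>x y z. {x, y, z} \<in> E \<and>
       \<not> (((y, z) \<in> A0 \<longleftrightarrow> (z, x) \<in> A1) \<and> ((y, z) \<in> A0 \<longleftrightarrow> (x, y) \<in> A2)))"
    by (auto simp: fun_eq_iff insert_commute)
  then show ?thesis
    using assms card_triples_rotate[of V ?R] by (simp add: cyclically_closed_def)
qed

text \<open>Agreement of three memberships survives negating all of them. This symmetry is what
  plays the two degree products off against each other.\<close>

lemma cyclically_closed_complement:
  assumes "cyclically_closed V E \<eta> A0 A1 A2"
  shows "cyclically_closed V E \<eta> (V \<times> V - A0) (V \<times> V - A1) (V \<times> V - A2)"
proof -
  have "triples V (\<lambda>x y z. {x, y, z} \<in> E \<and> \<not> (((y, z) \<in> V \<times> V - A0 \<longleftrightarrow> (z, x) \<in> V \<times> V - A1)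
        \<and> ((y, z) \<in> V \<times> V - A0 \<longleftrightarrow> (x, y) \<in> V \<times> V - A2)))
     = triples V (\<lambda>x y z. {x, y, z} \<in> E \<and>
       \<not> (((y, z) \<in> A0 \<longleftrightarrow> (z, x) \<in> A1) \<and> ((y, z) \<in> A0 \<longleftrightarrow> (x, y) \<in> A2)))"
    by (auto simp: triples_def)
  then show ?thesis using assms by (simp add: cyclically_closed_def)
qed

lemma cyclically_closed_mono:
  assumes "cyclically_closed V E \<eta> A0 A1 A2" "\<eta> \<le> \<eta>'"
  shows "cyclically_closed V E \<eta>' A0 A1 A2"
  using assms mult_right_mono[OF assms(2), of "real (card V) ^ 3"]
  by (simp add: cyclically_closed_def)

text \<open>An edge over a pair of \<open>P\<close> has its other two pairs in \<open>A1\<close> and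
  \<open>A2\<close>, except for exceptional triples: one \<open>\<eta>\<close> pays for these, one
  for the density. The result is the hypothesis of \<open>degree_product_ge\<close>.\<close>

lemma cyclically_closed_count:
  assumes fin: "finite V" and dense: "vertex_pair_dense \<eta> d V E"
    and closed: "cyclically_closed V E \<eta> A0 A1 A2"
    and XP: "X \<subseteq> V" "P \<subseteq> A0" "P \<subseteq> V \<times> V"
  shows "d * real (card X) * real (card P) - 2 * \<eta> * real (card V) ^ 3
    \<le> real (card {(x, q). x \<in> X \<and> q \<in> P \<and> (x, fst q) \<in> A2 \<and> (snd q, x) \<in> A1})"
proof -
  let ?T = "{(x, q). x \<in> X \<and> q \<in> P \<and> (x, fst q) \<in> A2 \<and> (snd q, x) \<in> A1}"
  let ?B = "triples V (\<lambda>x y z. {x, y, z} \<in> E \<and>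
       \<not> (((y, z) \<in> A0 \<longleftrightarrow> (z, x) \<in> A1) \<and> ((y, z) \<in> A0 \<longleftrightarrow> (x, y) \<in> A2)))"
  let ?S = "{(x, q). x \<in> X \<and> q \<in> P \<and> {x, fst q, snd q} \<in> E}"
  have finT: "finite ?T"
    by (rule finite_subset[of _ "V \<times> V \<times> V"]) (use XP fin in auto)
  have "?S \<subseteq> ?T \<union> ?B"
    using XP by (auto simp: triples_def)
  then have "card ?S \<le> card (?T \<union> ?B)" using finT fin by (intro card_mono) auto
  then have "card ?S \<le> card ?T + card ?B" using card_Un_le[of ?T ?B] by linarith
  then have "real (card ?S) \<le> real (card ?T) + real (card ?B)" by linarith
  then show ?thesis
    using dense_sum[OF dense fin XP(1,3)] closed[unfolded cyclically_closed_def] by linarith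
qed

text \<open>Going from \<open>(y, z)\<close> to \<open>(z, x)\<close>, a pair is hit by at most
  \<open>n\<close> vertices \<open>y\<close>. The sets \<open>W\<close> and \<open>X\<close> control
  both coordinates of the new pair, so a sequence of steps can be steered into a prescribed
  set.\<close>

lemma cyclically_closed_step:
  assumes fin: "finite V" and dense: "vertex_pair_dense \<eta> d V E"
    and closed: "cyclically_closed V E \<eta> A0 A1 A2"
    and XP: "X \<subseteq> V" "P \<subseteq> A0" "P \<subseteq> V \<times> W" "W \<subseteq> V"
  shows "d * real (card X) * real (card P) - 2 * \<eta> * real (card V) ^ 3
    \<le> real (card V) * real (card (A1 \<inter> W \<times> X))"
proof -
  let ?T = "{(x, q). x \<in> X \<and> q \<in> P \<and> (x, fst q) \<in> A2 \<and> (snd q, x) \<in> A1}"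
  have PV: "P \<subseteq> V \<times> V" using XP by auto
  have finT: "finite ?T"
    by (rule finite_subset[of _ "V \<times> V \<times> V"]) (use XP PV fin in auto)
  have "real (card ?T) \<le> real (card V) * real (card (A1 \<inter> W \<times> X))"
  proof (rule card_le_fibres[where f = "\<lambda>(x, q). (snd q, x)"])
    show "finite (A1 \<inter> W \<times> X)"
      by (rule finite_subset[of _ "V \<times> V"]) (use XP fin in auto)
    show "(\<lambda>(x, q). (snd q, x)) ` ?T \<subseteq> A1 \<inter> W \<times> X" using XP by auto
    fix b
    have "card {a \<in> ?T. (\<lambda>(x, q). (snd q, x)) a = b} \<le> card V"
    proof (rule card_inj_on_le[where f = "\<lambda>(x, q). fst q"])
      show "inj_on (\<lambda>(x, q). fst q) {a \<in> ?T. (\<lambda>(x, q). (snd q, x)) a = b}"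
        by (auto simp: inj_on_def)
      show "(\<lambda>(x, q). fst q) ` {a \<in> ?T. (\<lambda>(x, q). (snd q, x)) a = b} \<subseteq> V" using PV by auto
    qed (fact fin)
    then show "real (card {a \<in> ?T. (\<lambda>(x, q). (snd q, x)) a = b}) \<le> real (card V)" by simp
  qed (fact finT)
  then show ?thesis
    using cyclically_closed_count[OF fin dense closed XP(1,2) PV] by linarith
qed

text \<open>With \<open>\<eta> \<le> \<chi> * a / 16\<close> the error takes half of the main term
  \<open>\<chi> * a / 4\<close>.\<close>

lemma cyclically_closed_step_density:
  assumes fin: "finite V" "V \<noteq> {}" and dense: "vertex_pair_dense \<eta> d V E" "1/4 \<le> d"
    and closed: "cyclically_closed V E \<eta> A0 A1 A2"
    and XP: "X \<subseteq> V" "P \<subseteq> A0" "P \<subseteq> V \<times> W" "W \<subseteq> V"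
    and c: "\<chi> * real (card V) \<le> real (card X)" "a * real (card V) ^ 2 \<le> real (card P)"
      "0 \<le> \<chi>" "0 \<le> a" "\<eta> \<le> \<chi> * a / 16"
  shows "\<chi> * a / 8 * real (card V) ^ 2 \<le> real (card (A1 \<inter> W \<times> X))"
proof -
  define n where "n = real (card V)"
  have n: "n > 0" using fin by (simp add: n_def card_gt_0_iff)
  have "(\<chi> * n) * (a * n ^ 2) \<le> real (card X) * real (card P)"
    using c n by (intro mult_mono) (auto simp: n_def)
  then have "1/4 * ((\<chi> * n) * (a * n ^ 2)) \<le> 1/4 * (real (card X) * real (card P))"
    by simp
  also have "\<dots> \<le> d * (real (card X) * real (card P))"
    using dense(2) by (intro mult_right_mono) auto
  finally have "1/4 * ((\<chi> * n) * (a * n ^ 2)) \<le> d * real (card X) * real (card P)" by simp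
  moreover have "2 * \<eta> * n ^ 3 \<le> 2 * (\<chi> * a / 16) * n ^ 3"
    using c n by (intro mult_right_mono) auto
  ultimately have "1/4 * ((\<chi> * n) * (a * n ^ 2)) - 2 * (\<chi> * a / 16) * n ^ 3 \<le> n * real (card (A1 \<inter> W \<times> X))"
    using cyclically_closed_step[OF fin(1) dense(1) closed XP] unfolding n_def by linarith
  moreover have "1/4 * ((\<chi> * n) * (a * n ^ 2)) - 2 * (\<chi> * a / 16) * n ^ 3 = n * (\<chi> * a / 8 * n ^ 2)"
    by (simp add: power2_eq_square power3_eq_cube)
  ultimately have "n * (\<chi> * a / 8 * n ^ 2) \<le> n * real (card (A1 \<inter> W \<times> X))" by linarith
  then show ?thesis using n by (simp only: mult_le_cancel_left_pos n_def)
qed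

text \<open>Three steps around an edge lead from \<open>A0\<close> back to \<open>A0\<close>. The
  last two new vertices are chosen in \<open>X\<close>, hence the factor \<open>\<chi>\<close>
  twice, and \<open>512 = 8 ^ 3\<close>.\<close>

lemma cyclically_closed_dense_inside:
  assumes fin: "finite V" "V \<noteq> {}" and dense: "vertex_pair_dense \<eta> d V E" "1/4 \<le> d"
    and closed: "cyclically_closed V E \<eta> A0 A1 A2" and A: "A0 \<subseteq> V \<times> V"
    and X: "X \<subseteq> V" "\<chi> * real (card V) \<le> real (card X)" "0 < \<chi>" "\<chi> \<le> 1"
    and \<delta>: "0 < \<delta>" "\<delta> * real (card V) ^ 2 \<le> real (card A0)" and \<eta>: "\<eta> \<le> \<chi>\<^sup>2 * \<delta> / 1024"
  shows "\<chi>\<^sup>2 * \<delta> / 512 * real (card V) ^ 2 \<le> real (card (A0 \<inter> X \<times> X))"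
proof -
  have chi: "\<chi>\<^sup>2 \<le> \<chi>" "\<chi>\<^sup>2 \<le> 1" using X by (simp_all add: power2_eq_square mult_le_one)
  have "\<chi>\<^sup>2 * \<delta> \<le> 1 * \<delta>" "\<chi>\<^sup>2 * \<delta> \<le> \<chi> * \<delta>" "0 \<le> \<chi>\<^sup>2 * \<delta>" using chi \<delta> by (auto intro!: mult_right_mono)
  then have e: "\<eta> \<le> 1 * \<delta> / 16" "\<eta> \<le> \<chi> * (1 * \<delta> / 8) / 16" "\<eta> \<le> \<chi> * (\<chi> * (1 * \<delta> / 8) / 8) / 16"
    using \<eta> by (auto simp: power2_eq_square)
  have A1: "1 * \<delta> / 8 * real (card V) ^ 2 \<le> real (card (A1 \<inter> V \<times> V))"
    by (rule cyclically_closed_step_density[OF fin dense closed order_refl order_refl A order_refl])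
      (use \<delta> e in auto)
  have A2: "\<chi> * (1 * \<delta> / 8) / 8 * real (card V) ^ 2 \<le> real (card (A2 \<inter> V \<times> X))"
    by (rule cyclically_closed_step_density[OF fin dense cyclically_closed_rotate[OF closed] X(1) _ _ order_refl X(2) A1])
      (use X \<delta> e in auto)
  have "\<chi> * (\<chi> * (1 * \<delta> / 8) / 8) / 8 * real (card V) ^ 2 \<le> real (card (A0 \<inter> X \<times> X))"
    by (rule cyclically_closed_step_density[OF fin dense cyclically_closed_rotate[OF cyclically_closed_rotate[OF closed]]
        X(1) _ _ X(1) X(2) A2]) (use X \<delta> e in auto)
  then show ?thesis by (simp add: power2_eq_square)
qed

text \<open>Each product forces its sum above 1, but the sums \<open>a + b\<close> and
  \<open>(1 - a) + (1 - b)\<close> add up to 2. The error \<open>e\<close> changes a product by at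
  most \<open>3 * e < \<epsilon>/4\<close>.\<close>

lemma no_four_large_products:
  fixes a b e :: real
  assumes "0 \<le> a" "a \<le> 1" "0 \<le> b" "b \<le> 1" "0 < e" "e \<le> 1" "12 * e < \<epsilon>"
    and "1/4 + \<epsilon>/4 \<le> (a + e) * (b + e)" "1/4 + \<epsilon>/4 \<le> (1 - a + e) * (1 - b + e)"
  shows False
proof -
  have *: "1 < u + v" if uv: "0 \<le> u" "u \<le> 1" "0 \<le> v" "v \<le> 1" "1/4 + \<epsilon>/4 \<le> (u + e) * (v + e)" for u v :: real
  proof (rule ccontr)
    assume "\<not> 1 < u + v"
    then have "(u + v) * (u + v) \<le> 1 * 1" using uv by (intro mult_mono) auto
    then have "4 * (u * v) \<le> 1"
      using sum_squares_bound[of u v] by (simp add: power2_eq_square algebra_simps)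
    moreover have "(u + e) * (v + e) \<le> u * v + 3 * e"
    proof -
      have "e * u \<le> e * 1" "e * v \<le> e * 1" "e * e \<le> e * 1"
        using uv assms by (auto intro!: mult_left_mono)
      then show ?thesis by (simp add: algebra_simps)
    qed
    ultimately show False using uv(5) assms(7) by linarith
  qed
  from *[of a b] *[of "1 - a" "1 - b"] assms show False by auto
qed

text \<open>In-degrees are taken in \<open>A2\<close> and out-degrees in \<open>A1\<close>: these
  are the relations into which an edge carries a pair of \<open>A0\<close>. Equal degrees are
  obtained by rounding and the pigeonhole principle.\<close>

lemma cyclically_closed_dichotomy:
  fixes \<epsilon> \<delta> \<tau> :: real
  assumes eps: "0 < \<epsilon>" "\<epsilon> \<le> 1" and \<delta>: "0 < \<delta>" and \<tau>: "0 < \<tau>"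
  obtains \<eta> where "0 < \<eta>" and "\<And>(V::'a set) E A0 A1 A2.
    finite V \<Longrightarrow> V \<noteq> {} \<Longrightarrow> vertex_pair_dense \<eta> (1/4 + \<epsilon>) V E \<Longrightarrow> cyclically_closed V E \<eta> A0 A1 A2 \<Longrightarrow>
    A0 \<subseteq> V \<times> V \<Longrightarrow> \<delta> * real (card V) ^ 2 \<le> real (card A0) \<Longrightarrow>
    (1 - \<tau>) * real (card V) ^ 2 \<le> real (card A0)"
proof -
  define \<mu> where "\<mu> = min \<delta> \<tau>"
  \<comment> \<open>\<open>1 / N\<close> is the width of a degree class, and
    \<open>12 / N < \<epsilon>\<close> is the demand of
    \<open>no_four_large_products\<close>.\<close>
  obtain N0 :: nat where N0: "12 / \<epsilon> < real N0" using reals_Archimedean2 by blast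
  define N where "N = Suc N0"
  have N: "12 / \<epsilon> < real N" "0 < real N" using N0 by (auto simp: N_def)
  \<comment> \<open>Half of the average share of the \<open>(N + 1)^2\<close> classes, so that the
    pigeonhole argument ends in a strict contradiction.\<close>
  define \<chi> where "\<chi> = 1 / (2 * real ((N + 1) ^ 2))"
  have chi: "0 < \<chi>" "\<chi> \<le> 1" 
  proof -
    have "1 \<le> (N + 1) ^ 2" by simp
    moreover define r where "r = real ((N + 1) ^ 2)"
    ultimately have "1 \<le> r" by (metis of_nat_1 of_nat_le_iff)
    then show "0 < \<chi>" "\<chi> \<le> 1" unfolding \<chi>_def r_def[symmetric] by simp_all
  qed
  define p where "p = \<chi>\<^sup>2 * \<mu> / 512"
  have mu: "0 < \<mu>" using \<delta> \<tau> by (simp add: \<mu>_def)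
  have p: "0 < p" using chi mu by (simp add: p_def)
  show thesis
  proof (rule degree_product_ge[OF eps p, where 'a = 'a], goal_cases)
    case (1 \<eta>0)
    note \<eta>0 = 1(1) and prod = 1(2)
    \<comment> \<open>\<open>cyclically_closed_count\<close> doubles \<open>\<eta>\<close>, hence
      the half; the second bound makes \<open>A0\<close> and its complement dense inside the
      class.\<close>
    define \<eta> where "\<eta> = min (\<eta>0 / 2) (\<chi>\<^sup>2 * \<mu> / 1024)"
    have eta: "0 < \<eta>" using \<eta>0 chi mu by (simp add: \<eta>_def)
    show thesis
    proof (rule that[OF eta])
      fix V :: "'a set" and E A0 A1 A2
      assume fin: "finite V" "V \<noteq> {}" and dense: "vertex_pair_dense \<eta> (1/4 + \<epsilon>) V E"
        and closed: "cyclically_closed V E \<eta> A0 A1 A2"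
        and A: "A0 \<subseteq> V \<times> V" and A0c: "\<delta> * real (card V) ^ 2 \<le> real (card A0)"
      define n where "n = real (card V)"
      have n: "n > 0" using fin by (simp add: n_def card_gt_0_iff)
      show "(1 - \<tau>) * real (card V) ^ 2 \<le> real (card A0)"
      proof (rule ccontr)
        assume "\<not> ?thesis"
        then have lt: "real (card A0) < (1 - \<tau>) * n ^ 2" by (simp add: n_def)
        define B0 B1 B2 where "B0 = V \<times> V - A0" and "B1 = V \<times> V - A1" and "B2 = V \<times> V - A2"
        have closedB: "cyclically_closed V E \<eta> B0 B1 B2"
          unfolding B0_def B1_def B2_def by (rule cyclically_closed_complement[OF closed])
        have "real (card B0) = n ^ 2 - real (card A0)"
          unfolding B0_def using A fin card_mono[OF _ A]
          by (simp add: card_Diff_subset finite_subset[OF A] of_nat_diff n_def power2_eq_square)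
        then have "\<tau> * n ^ 2 \<le> real (card B0)" using lt by (simp add: algebra_simps)
        moreover have "\<mu> * n ^ 2 \<le> \<tau> * n ^ 2" "\<mu> * n ^ 2 \<le> \<delta> * n ^ 2"
          by (auto simp: \<mu>_def intro!: mult_right_mono)
        ultimately have cA: "\<mu> * n ^ 2 \<le> real (card A0)" and cB: "\<mu> * n ^ 2 \<le> real (card B0)"
          using A0c by (auto simp: n_def)
        define s where "s = (\<lambda>y. real (card {x \<in> V. (x, y) \<in> A2}) / n)"
        define t where "t = (\<lambda>z. real (card {x \<in> V. (z, x) \<in> A1}) / n)"
        have st01: "0 \<le> s y" "s y \<le> 1" "0 \<le> t y" "t y \<le> 1" for y
          using n fin by (auto simp: s_def t_def n_def divide_le_eq_1 intro!: card_mono)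
        define f where "f = (\<lambda>y. (nat \<lfloor>real N * s y\<rfloor>, nat \<lfloor>real N * t y\<rfloor>))"
        have fl: "nat \<lfloor>real N * u\<rfloor> \<le> N" "real (nat \<lfloor>real N * u\<rfloor>) / real N \<le> u"
            "u \<le> (real (nat \<lfloor>real N * u\<rfloor>) + 1) / real N" if "0 \<le> u" "u \<le> 1" for u
        proof -
          have nn: "0 \<le> real N * u" and le: "real N * u \<le> real N * 1"
            using that N(2) by (auto intro!: mult_left_mono)
          have r: "real (nat \<lfloor>real N * u\<rfloor>) = of_int \<lfloor>real N * u\<rfloor>" using nn by simp
          have "real (nat \<lfloor>real N * u\<rfloor>) \<le> real N * u" "real N * u \<le> real (nat \<lfloor>real N * u\<rfloor>) + 1"
            unfolding r by linarith+
          then have "real (nat \<lfloor>real N * u\<rfloor>) \<le> real N" using le by linarith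
          then show "nat \<lfloor>real N * u\<rfloor> \<le> N" unfolding of_nat_le_iff .
          show "real (nat \<lfloor>real N * u\<rfloor>) / real N \<le> u"
            "u \<le> (real (nat \<lfloor>real N * u\<rfloor>) + 1) / real N"
            using \<open>real (nat \<lfloor>real N * u\<rfloor>) \<le> real N * u\<close> \<open>real N * u \<le> real (nat \<lfloor>real N * u\<rfloor>) + 1\<close> N(2)
            by (simp_all add: pos_divide_le_eq pos_le_divide_eq mult.commute del: of_nat_nat)
        qed
        have frange: "f ` V \<subseteq> {0..N} \<times> {0..N}" using fl(1) st01 by (auto simp: f_def)
        have "\<exists>b\<in>{0..N} \<times> {0..N}. \<chi> * n < real (card {y \<in> V. f y = b})"
        proof (rule ccontr)
          assume "\<not> ?thesis"
          then have "real (card V) \<le> \<chi> * n * real (card ({0..N} \<times> {0..N}))"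
            using fin(1) frange by (intro card_le_fibres[where f = f]) (auto simp: not_less)
          also have "\<dots> = n / 2"
            unfolding \<chi>_def card_cartesian_product
            by (simp add: power2_eq_square field_simps del: of_nat_Suc)
          finally show False using n by (simp add: n_def)
        qed
        then obtain i j where ij: "i \<le> N" "j \<le> N" "\<chi> * n < real (card {y \<in> V. f y = (i, j)})"
          by auto
        define X where "X = {y \<in> V. f y = (i, j)}"
        have X: "X \<subseteq> V" "\<chi> * real (card V) \<le> real (card X)" using ij by (auto simp: X_def n_def)
        have sX: "real i / N \<le> s y" "s y \<le> (real i + 1) / N" "real j / N \<le> t y" "t y \<le> (real j + 1) / N"
          if "y \<in> X" for y
          using that fl(2,3)[OF st01(1,2)[of y]] fl(2,3)[OF st01(3,4)[of y]] by (auto simp: X_def f_def)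
        have eta': "\<eta> \<le> \<chi>\<^sup>2 * \<mu> / 1024" "2 * \<eta> \<le> \<eta>0" by (auto simp: \<eta>_def)
        have e14: "1/4 \<le> 1/4 + \<epsilon>" using eps by simp
        have count: "(1/4 + \<epsilon>) * real (card X') * real (card P) - \<eta>0 * real (card V) ^ 3
            \<le> real (card {(x, q). x \<in> X' \<and> q \<in> P \<and> (x, fst q) \<in> C2 \<and> (snd q, x) \<in> C1})"
          if "cyclically_closed V E \<eta> C0 C1 C2" "X' \<subseteq> V" "P \<subseteq> C0" "P \<subseteq> V \<times> V" for C0 C1 C2 X' P
          using cyclically_closed_count[OF fin(1) dense that]
            mult_right_mono[OF eta'(2), of "real (card V) ^ 3"] by simp
        define e where "e = 1 / real N"
        have e: "0 < e" "e \<le> 1" "12 * e < \<epsilon>" using N eps by (auto simp: e_def N_def field_simps)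
        define a b where "a = real i / N" and "b = real j / N"
        have ab: "0 \<le> a" "a \<le> 1" "0 \<le> b" "b \<le> 1" using ij N(2) by (auto simp: a_def b_def)
        \<comment> \<open>Adding \<open>e\<close> covers the width of the class and keeps both
          degree bounds positive, even for \<open>a = 0\<close> or \<open>b = 0\<close>.\<close>
        have PA: "1/4 + \<epsilon>/4 \<le> (a + e) * (b + e)"
        proof (rule prod[OF fin X(1), of _ _ A0 A2 A1])
          show "0 < a + e" "0 < b + e" using ab e by auto
          show "p * real (card V) ^ 2 \<le> real (card (A0 \<inter> X \<times> X))"
            unfolding p_def
            by (rule cyclically_closed_dense_inside[OF fin dense e14 closed A X chi mu _ eta'(1)])
              (use cA in \<open>simp add: n_def\<close>)
          show "real (card {x \<in> V. (x, y) \<in> A2}) \<le> (a + e) * real (card V)" if "y \<in> X" for y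
            using sX(2)[OF that] n unfolding s_def a_def e_def n_def[symmetric] add_divide_distrib[symmetric]
            by (simp add: pos_divide_le_eq)
          show "real (card {x \<in> V. (z, x) \<in> A1}) \<le> (b + e) * real (card V)" if "z \<in> X" for z
            using sX(4)[OF that] n unfolding t_def b_def e_def n_def[symmetric] add_divide_distrib[symmetric]
            by (simp add: pos_divide_le_eq)
        qed (rule count[OF closed])
        have compl: "real (card {x \<in> V. \<not> Q x}) = n - real (card {x \<in> V. Q x})" for Q
        proof -
          have "{x \<in> V. \<not> Q x} = V - {x \<in> V. Q x}" by auto
          then show ?thesis using fin
            by (simp add: card_Diff_subset of_nat_diff card_mono n_def)
        qed
        have PB: "1/4 + \<epsilon>/4 \<le> (1 - a + e) * (1 - b + e)"
        proof (rule prod[OF fin X(1), of _ _ B0 B2 B1])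
          show "0 < 1 - a + e" "0 < 1 - b + e" using ab e by auto
          show "p * real (card V) ^ 2 \<le> real (card (B0 \<inter> X \<times> X))"
            unfolding p_def
            by (rule cyclically_closed_dense_inside[OF fin dense e14 closedB _ X chi mu _ eta'(1)])
              (use cB in \<open>auto simp: n_def B0_def\<close>)
          show "real (card {x \<in> V. (x, y) \<in> B2}) \<le> (1 - a + e) * real (card V)" if y: "y \<in> X" for y
          proof -
            have "{x \<in> V. (x, y) \<in> B2} = {x \<in> V. \<not> (x, y) \<in> A2}" using y X by (auto simp: B2_def)
            then have "real (card {x \<in> V. (x, y) \<in> B2}) = n - s y * n"
              using compl[of "\<lambda>x. (x, y) \<in> A2"] n by (simp add: s_def)
            also have "\<dots> \<le> n - a * n" using mult_right_mono[OF sX(1)[OF y], of n] n by (simp add: a_def)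
            also have "\<dots> \<le> (1 - a + e) * n" using e n by (simp add: algebra_simps)
            finally show ?thesis by (simp add: n_def)
          qed
          show "real (card {x \<in> V. (z, x) \<in> B1}) \<le> (1 - b + e) * real (card V)" if y: "z \<in> X" for z
          proof -
            have "{x \<in> V. (z, x) \<in> B1} = {x \<in> V. \<not> (z, x) \<in> A1}" using y X by (auto simp: B1_def)
            then have "real (card {x \<in> V. (z, x) \<in> B1}) = n - t z * n"
              using compl[of "\<lambda>x. (z, x) \<in> A1"] n by (simp add: t_def)
            also have "\<dots> \<le> n - b * n" using mult_right_mono[OF sX(3)[OF y], of n] n by (simp add: b_def)
            also have "\<dots> \<le> (1 - b + e) * n" using e n by (simp add: algebra_simps)
            finally show ?thesis by (simp add: n_def)
          qed
        qed (rule count[OF closedB])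
        show False by (rule no_four_large_products[OF ab e PA PB])
      qed
    qed
  qed
qed

section \<open>Reachable ordered pairs\<close>

text \<open>Ends of walks that start in \<open>T\<close>, in a robust sense: the threshold lets a
  walk avoid prescribed vertices, at the price of at most \<open>\<theta> n^3\<close> lost triples
  per step.\<close>

fun reach :: "real \<Rightarrow> 'a set \<Rightarrow> 'a set set \<Rightarrow> ('a \<times> 'a) set \<Rightarrow> nat \<Rightarrow> ('a \<times> 'a) set" where
  "reach \<theta> V E T 0 = T"
| "reach \<theta> V E T (Suc i) = {(c, d) \<in> V \<times> V.
     \<theta> * real (card V) \<le> real (card {x \<in> V. (x, c) \<in> reach \<theta> V E T i \<and> {x, c, d} \<in> E})}"

lemma reach_subset: "T \<subseteq> V \<times> V \<Longrightarrow> reach \<theta> V E T i \<subseteq> V \<times> V"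
  by (cases i) auto

lemma card_reach_loss:
  assumes fin: "finite V" and "0 \<le> \<theta>"
  shows "real (card (triples V (\<lambda>x y z. {x, y, z} \<in> E \<and> (x, y) \<in> reach \<theta> V E T i \<and> (y, z) \<notin> reach \<theta> V E T (Suc i))))
     \<le> \<theta> * real (card V) ^ 3"
proof -
  let ?Q = "\<lambda>x q. {x, fst q, snd q} \<in> E \<and> (x, fst q) \<in> reach \<theta> V E T i \<and> q \<notin> reach \<theta> V E T (Suc i)"
  have "triples V (\<lambda>x y z. {x, y, z} \<in> E \<and> (x, y) \<in> reach \<theta> V E T i \<and> (y, z) \<notin> reach \<theta> V E T (Suc i))
      = {(x, q). x \<in> V \<and> q \<in> V \<times> V \<and> ?Q x q}"
    by (auto simp: triples_def)
  then have "real (card (triples V (\<lambda>x y z. {x, y, z} \<in> E \<and> (x, y) \<in> reach \<theta> V E T i \<and> (y, z) \<notin> reach \<theta> V E T (Suc i))))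
      = (\<Sum>q\<in>V \<times> V. real (card {x \<in> V. ?Q x q}))"
    using card_relation_by_snd[OF fin, of "V \<times> V" ?Q] fin by simp
  also have "\<dots> \<le> (\<Sum>q\<in>V \<times> V. \<theta> * real (card V))"
  proof (rule sum_mono)
    fix q assume q: "q \<in> V \<times> V"
    show "real (card {x \<in> V. ?Q x q}) \<le> \<theta> * real (card V)"
    proof (cases "q \<in> reach \<theta> V E T (Suc i)")
      case True
      then show ?thesis using assms by simp
    next
      case False
      then have lt: "real (card {x \<in> V. (x, fst q) \<in> reach \<theta> V E T i \<and> {x, fst q, snd q} \<in> E}) < \<theta> * real (card V)"
        using q by (auto simp: not_le)
      have "card {x \<in> V. ?Q x q} \<le> card {x \<in> V. (x, fst q) \<in> reach \<theta> V E T i \<and> {x, fst q, snd q} \<in> E}"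
        using fin by (intro card_mono) auto
      then show ?thesis using lt by linarith
    qed
  qed
  also have "\<dots> = \<theta> * real (card V) ^ 3" by (simp add: power3_eq_cube card_cartesian_product)
  finally show ?thesis .
qed

text \<open>Walking three times around an edge returns to the same ordered pair.\<close>

lemma card_reach_diff_add3:
  assumes fin: "finite V" "V \<noteq> {}" and dense: "vertex_pair_dense \<rho> d V E" "1/4 \<le> d"
    and T: "T \<subseteq> V \<times> V" and \<theta>: "0 \<le> \<theta>"
  shows "real (card (reach \<theta> V E T i - reach \<theta> V E T (i + 3))) \<le> 4 * (\<rho> + 3 * \<theta>) * real (card V) ^ 2"
proof -
  define n where "n = real (card V)"
  have n: "n > 0" using fin by (simp add: n_def card_gt_0_iff)
  let ?r = "reach \<theta> V E T"
  define Q where "Q = ?r i - ?r (i + 3)"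
  have Q: "Q \<subseteq> V \<times> V" using reach_subset[OF T] by (auto simp: Q_def)
  define R where "R = (\<lambda>j x y z. {x, y, z} \<in> E \<and> (x, y) \<in> ?r j \<and> (y, z) \<notin> ?r (Suc j))"
  have loss: "real (card (triples V (R j))) \<le> \<theta> * n ^ 3" for j
    unfolding R_def n_def by (rule card_reach_loss[OF fin(1) \<theta>])
  let ?S = "{(x, q). x \<in> V \<and> q \<in> Q \<and> {x, fst q, snd q} \<in> E}"
  \<comment> \<open>A pair that is gone after three steps is lost at one of them; the three kinds of
    triples are rotations of those counted by \<open>card_reach_loss\<close>.\<close>
  have sub: "?S \<subseteq> triples V (\<lambda>x y z. R i y z x) \<union> triples V (\<lambda>x y z. R (i + 1) z x y) \<union> triples V (R (i + 2))"
  proof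
    fix w assume "w \<in> ?S"
    then obtain x y z where w: "w = (x, (y, z))" "x \<in> V" "(y, z) \<in> Q" "{x, y, z} \<in> E" by auto
    then have "y \<in> V" "z \<in> V" "(y, z) \<in> ?r i" "(y, z) \<notin> ?r (Suc (i + 2))"
      using Q by (auto simp: Q_def numeral_3_eq_3 numeral_2_eq_2 simp del: reach.simps)
    moreover have "{y, z, x} = {x, y, z}" "{z, x, y} = {x, y, z}" by auto
    ultimately show "w \<in> triples V (\<lambda>x y z. R i y z x) \<union> triples V (\<lambda>x y z. R (i + 1) z x y) \<union> triples V (R (i + 2))"
      using w by (auto simp: triples_def R_def simp del: reach.simps)
  qed
  have rot: "card (triples V (\<lambda>x y z. R i y z x)) = card (triples V (R i))"
    "card (triples V (\<lambda>x y z. R (i + 1) z x y)) = card (triples V (R (i + 1)))"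
    using card_triples_rotate[of V "R i"] card_triples_rotate[of V "\<lambda>x y z. R (i + 1) y z x"]
      card_triples_rotate[of V "R (i + 1)"] by auto
  have "card ?S \<le> card (triples V (\<lambda>x y z. R i y z x) \<union> triples V (\<lambda>x y z. R (i + 1) z x y) \<union> triples V (R (i + 2)))"
    using sub fin by (intro card_mono) auto
  also have "\<dots> \<le> card (triples V (R i)) + card (triples V (R (i + 1))) + card (triples V (R (i + 2)))"
    unfolding rot[symmetric] by (meson add_le_mono1 card_Un_le order_trans)
  finally have "real (card ?S) \<le> 3 * \<theta> * n ^ 3"
    using loss[of i] loss[of "i + 1"] loss[of "i + 2"] by linarith
  moreover have "d * real (card V) * real (card Q) - \<rho> * n ^ 3 \<le> real (card ?S)"
    using dense_sum[OF dense(1) fin(1) order_refl Q] by (simp add: n_def)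
  moreover have "1/4 * (n * real (card Q)) \<le> d * (n * real (card Q))"
    using dense(2) n by (intro mult_right_mono) auto
  ultimately have "n * real (card Q) \<le> n * (4 * (\<rho> + 3 * \<theta>) * n ^ 2)"
    by (simp add: n_def algebra_simps power2_eq_square power3_eq_cube)
  then show ?thesis using n by (simp add: Q_def n_def)
qed

text \<open>The sizes of \<open>reach (3 * j)\<close> drop by at most \<open>e\<close> per round and
  never exceed \<open>n^2\<close>, so one of the first \<open>J\<close> rounds gains at most
  \<open>n^2 / J\<close>. In that round membership passes on at each of the three steps, up to few
  triples, and the last set is nearly contained in the first. Implications that close up to a cycle
  are equivalences.\<close>

lemma reach_stabilises:
  assumes fin: "finite V" "V \<noteq> {}" and dense: "vertex_pair_dense \<rho> d V E" "1/4 \<le> d"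
    and T: "T \<subseteq> V \<times> V" and \<theta>: "0 \<le> \<theta>" "0 \<le> \<rho>" and J: "0 < J"
  shows "\<exists>j<J. cyclically_closed V E (1 / real J + 15 * \<theta> + 4 * \<rho>)
       (reach \<theta> V E T (3 * j)) (reach \<theta> V E T (3 * j + 1)) (reach \<theta> V E T (3 * j + 2))
     \<and> real (card T) - 4 * real J * (\<rho> + 3 * \<theta>) * real (card V) ^ 2 \<le> real (card (reach \<theta> V E T (3 * j)))"
proof -
  define n where "n = real (card V)"
  have n: "n > 0" using fin by (simp add: n_def card_gt_0_iff)
  let ?r = "reach \<theta> V E T"
  define c where "c = (\<lambda>j. real (card (?r (3 * j))))"
  define e where "e = 4 * (\<rho> + 3 * \<theta>) * n ^ 2"
  have e: "0 \<le> e" using \<theta> by (simp add: e_def)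
  have finr: "finite (?r i)" for i
    by (rule finite_subset[OF reach_subset[OF T]]) (use fin in simp)
  have diff: "real (card (?r i - ?r (i + 3))) \<le> e" for i
    unfolding e_def n_def by (rule card_reach_diff_add3[OF fin dense T \<theta>(1)])
  have split: "real (card (?r (i + 3) - ?r i)) + real (card (?r i)) = real (card (?r (i + 3))) + real (card (?r i - ?r (i + 3)))" for i
  proof -
    have "card (?r (i + 3) - ?r i) + card (?r i) = card (?r (i + 3) \<union> ?r i)"
      using finr by (subst card_Un_disjoint[symmetric]) (auto simp del: reach.simps)
    moreover have "card (?r i - ?r (i + 3)) + card (?r (i + 3)) = card (?r (i + 3) \<union> ?r i)"
      using finr by (subst card_Un_disjoint[symmetric]) (auto simp: Un_commute simp del: reach.simps)
    ultimately show ?thesis by linarith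
  qed
  have step: "c j - e \<le> c (Suc j)" for j
  proof -
    have 3: "3 * Suc j = 3 * j + 3" by simp
    show ?thesis
      using split[of "3 * j"] diff[of "3 * j"] of_nat_0_le_iff[of "card (?r (3 * j + 3) - ?r (3 * j))", where 'a = real]
      unfolding c_def 3 by linarith
  qed
  have low: "c 0 - real j * e \<le> c j" for j
  proof (induction j)
    case (Suc j)
    then show ?case using step[of j] by (simp add: algebra_simps)
  qed simp
  have "\<exists>j<J. c (Suc j) \<le> c j + n ^ 2 / real J"
  proof (rule ccontr)
    assume "\<not> ?thesis"
    then have gt: "c j + n ^ 2 / real J < c (Suc j)" if "j < J" for j using that by (auto simp: not_le)
    have "c 0 + real j * (n ^ 2 / real J) \<le> c j \<and> (0 < j \<longrightarrow> c 0 + real j * (n ^ 2 / real J) < c j)"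
      if "j \<le> J" for j
      using that
    proof (induction j)
      case (Suc j)
      then show ?case using gt[of j] by (simp add: algebra_simps add_divide_distrib)
    qed simp
    from this[of J] have "c 0 + n ^ 2 < c J" using J by simp
    moreover have "0 \<le> c 0" by (simp add: c_def)
    moreover have "card (?r (3 * J)) \<le> card (V \<times> V)"
      using reach_subset[OF T] fin by (intro card_mono) auto
    then have "c J \<le> n ^ 2"
      by (simp add: c_def n_def power2_eq_square card_cartesian_product flip: of_nat_mult)
    ultimately show False by linarith
  qed
  then obtain j where j: "j < J" "c (Suc j) \<le> c j + n ^ 2 / real J" by blast
  have Sj: "3 * Suc j = 3 * j + 3" by simp
  have gain: "real (card (?r (3 * j + 3) - ?r (3 * j))) \<le> n ^ 2 / real J + e"
    using split[of "3 * j"] diff[of "3 * j"] j(2) unfolding c_def Sj by linarith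
  define R where "R = (\<lambda>j x y z. {x, y, z} \<in> E \<and> (x, y) \<in> ?r j \<and> (y, z) \<notin> ?r (Suc j))"
  have loss: "real (card (triples V (R j))) \<le> \<theta> * n ^ 3" for j
    unfolding R_def n_def by (rule card_reach_loss[OF fin(1) \<theta>(1)])
  have rot: "card (triples V (\<lambda>x y z. R i y z x)) = card (triples V (R i))"
    "card (triples V (\<lambda>x y z. R i z x y)) = card (triples V (R i))" for i
    using card_triples_rotate[of V "R i"] card_triples_rotate[of V "\<lambda>x y z. R i y z x"] by auto
  let ?B = "triples V (\<lambda>x y z. {x, y, z} \<in> E \<and>
       \<not> (((y, z) \<in> ?r (3 * j) \<longleftrightarrow> (z, x) \<in> ?r (3 * j + 1)) \<and> ((y, z) \<in> ?r (3 * j) \<longleftrightarrow> (x, y) \<in> ?r (3 * j + 2))))"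
  \<comment> \<open>Triples whose pair \<open>(y, z)\<close> is new after three steps. All other
    violations of the closure are losses at one of the steps.\<close>
  let ?G = "V \<times> (?r (3 * j + 3) - ?r (3 * j))"
  have sub: "?B \<subseteq> triples V (\<lambda>x y z. R (3 * j) y z x) \<union> triples V (\<lambda>x y z. R (3 * j + 1) z x y) \<union> triples V (R (3 * j + 2)) \<union> ?G"
  proof
    fix w assume "w \<in> ?B"
    then obtain x y z where w: "w = (x, (y, z))" "x \<in> V" "y \<in> V" "z \<in> V" "{x, y, z} \<in> E"
      "\<not> (((y, z) \<in> ?r (3 * j) \<longleftrightarrow> (z, x) \<in> ?r (3 * j + 1)) \<and> ((y, z) \<in> ?r (3 * j) \<longleftrightarrow> (x, y) \<in> ?r (3 * j + 2)))"
      unfolding triples_def by (auto simp del: reach.simps)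
    have i: "Suc (3 * j) = 3 * j + 1" "Suc (3 * j + 1) = 3 * j + 2" "Suc (3 * j + 2) = 3 * j + 3" by auto
    have "{y, z, x} = {x, y, z}" "{z, x, y} = {x, y, z}" by auto
    then have ee: "{y, z, x} \<in> E" "{z, x, y} \<in> E" using w(5) by simp_all
    show "w \<in> triples V (\<lambda>x y z. R (3 * j) y z x) \<union> triples V (\<lambda>x y z. R (3 * j + 1) z x y) \<union> triples V (R (3 * j + 2)) \<union> ?G"
      using w(2-) ee unfolding w(1) triples_def R_def i by (auto simp del: reach.simps)
  qed
  have finG: "finite ?G" using fin finr by (auto simp del: reach.simps)
  have "card ?B \<le> card (triples V (\<lambda>x y z. R (3 * j) y z x) \<union> triples V (\<lambda>x y z. R (3 * j + 1) z x y) \<union> triples V (R (3 * j + 2)) \<union> ?G)"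
    using sub fin finG by (intro card_mono finite_UnI finite_triples)
  also have "\<dots> \<le> card (triples V (R (3 * j))) + card (triples V (R (3 * j + 1))) + card (triples V (R (3 * j + 2))) + card ?G"
    unfolding rot(1)[symmetric, of "3 * j"] rot(2)[symmetric, of "3 * j + 1"]
    by (meson add_le_mono1 card_Un_le order_trans)
  finally have "real (card ?B) \<le> real (card (triples V (R (3 * j)))) + real (card (triples V (R (3 * j + 1))))
      + real (card (triples V (R (3 * j + 2)))) + real (card ?G)" by linarith
  moreover have "real (card ?G) = n * real (card (?r (3 * j + 3) - ?r (3 * j)))"
    by (simp add: card_cartesian_product n_def del: reach.simps)
  moreover have "n * real (card (?r (3 * j + 3) - ?r (3 * j))) \<le> n * (n ^ 2 / real J + e)"
    using gain n by (intro mult_left_mono) auto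
  ultimately have "real (card ?B) \<le> 3 * (\<theta> * n ^ 3) + n * (n ^ 2 / real J + e)"
    using loss[of "3 * j"] loss[of "3 * j + 1"] loss[of "3 * j + 2"] by linarith
  \<comment> \<open>The losses contribute \<open>3 * \<theta>\<close>, the new pairs
    \<open>1 / J + 4 * \<rho> + 12 * \<theta>\<close>.\<close>
  also have "\<dots> = (1 / real J + 15 * \<theta> + 4 * \<rho>) * n ^ 3"
    by (simp add: e_def power2_eq_square power3_eq_cube algebra_simps)
  finally have cl: "cyclically_closed V E (1 / real J + 15 * \<theta> + 4 * \<rho>)
       (?r (3 * j)) (?r (3 * j + 1)) (?r (3 * j + 2))"
    unfolding cyclically_closed_def n_def .
  have "real j * e \<le> real J * e" using j e by (intro mult_right_mono) auto
  then have "real (card T) - real J * e \<le> real (card (?r (3 * j)))"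
    using low[of j] by (simp add: c_def)
  then have "real (card T) - 4 * real J * (\<rho> + 3 * \<theta>) * real (card V) ^ 2 \<le> real (card (?r (3 * j)))"
    by (simp add: e_def n_def mult.assoc mult.left_commute)
  then show ?thesis using cl j(1) by blast
qed

text \<open>The dichotomy is applied to two neighbouring members of the closed family: one step
  around the edges carries density from \<open>reach (3 * j)\<close> to
  \<open>reach (3 * j + 1)\<close>. This is the source of the two consecutive lengths.\<close>

lemma reach_nearly_everything:
  fixes \<epsilon> \<delta> \<tau> :: real
  assumes eps: "0 < \<epsilon>" "\<epsilon> \<le> 1" and \<delta>: "0 < \<delta>" and \<tau>: "0 < \<tau>"
  obtains \<rho> \<theta> M where "0 < \<rho>" and "0 < \<theta>" and "\<And>(V::'a set) E T.
    finite V \<Longrightarrow> V \<noteq> {} \<Longrightarrow> vertex_pair_dense \<rho> (1/4 + \<epsilon>) V E \<Longrightarrow>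
    T \<subseteq> V \<times> V \<Longrightarrow> \<delta> * real (card V) ^ 2 \<le> real (card T) \<Longrightarrow>
    \<exists>l\<le>M. (1 - \<tau>) * real (card V) ^ 2 \<le> real (card (reach \<theta> V E T l)) \<and>
       (1 - \<tau>) * real (card V) ^ 2 \<le> real (card (reach \<theta> V E T (Suc l)))"
proof -
  \<comment> \<open>\<open>\<delta> / 16\<close> is what one step leaves of the
    \<open>\<delta> / 2\<close> that survives in \<open>reach (3 * j)\<close>.\<close>
  obtain \<eta>0 where \<eta>0: "\<eta>0 > 0" and dich: "\<And>(V::'a set) E A0 A1 A2.
    finite V \<Longrightarrow> V \<noteq> {} \<Longrightarrow> vertex_pair_dense \<eta>0 (1/4 + \<epsilon>) V E \<Longrightarrow> cyclically_closed V E \<eta>0 A0 A1 A2 \<Longrightarrow>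
    A0 \<subseteq> V \<times> V \<Longrightarrow> (\<delta> / 16) * real (card V) ^ 2 \<le> real (card A0) \<Longrightarrow>
    (1 - \<tau>) * real (card V) ^ 2 \<le> real (card A0)"
    by (rule cyclically_closed_dichotomy[OF eps _ \<tau>, of "\<delta> / 16", where 'a = 'a]) (use \<delta> in auto)
  define \<eta> where "\<eta> = min \<eta>0 (\<delta> / 32)"
  have eta: "0 < \<eta>" "\<eta> \<le> \<eta>0" "\<eta> \<le> \<delta> / 32" using \<eta>0 \<delta> by (auto simp: \<eta>_def)
  obtain J :: nat where J: "4 / \<eta> < real J" using reals_Archimedean2 by blast
  then have J0: "0 < J" using eta(1) by (metis divide_pos_pos of_nat_0_less_iff order_less_trans zero_less_numeral)
  \<comment> \<open>The first bound keeps the closure error below \<open>\<eta>\<close>, the second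
    keeps the loss over \<open>J\<close> rounds below \<open>\<delta> / 2\<close>; likewise for
    \<open>\<rho>\<close>.\<close>
  define \<theta> where "\<theta> = min (\<eta> / 60) (\<delta> / (100 * real J))"
  define \<rho> where "\<rho> = min (\<eta> / 16) (\<delta> / (100 * real J))"
  have th: "0 < \<theta>" "\<theta> \<le> \<eta> / 60" "\<theta> \<le> \<delta> / (100 * real J)" and rh: "0 < \<rho>" "\<rho> \<le> \<eta> / 16" "\<rho> \<le> \<delta> / (100 * real J)"
    using eta \<delta> J0 by (auto simp: \<theta>_def \<rho>_def)
  have J1: "1 / real J \<le> \<eta> / 4" using J J0 eta by (simp add: field_simps)
  have sum1: "1 / real J + 15 * \<theta> + 4 * \<rho> \<le> \<eta>" using J1 th rh by linarith
  have "real J * \<theta> \<le> \<delta> / 100" "real J * \<rho> \<le> \<delta> / 100" using th(3) rh(3) J0 by (auto simp: field_simps)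
  then have sum2: "4 * real J * (\<rho> + 3 * \<theta>) \<le> \<delta> / 2" using \<delta> by (simp add: algebra_simps)
  show thesis
  proof (rule that[OF rh(1) th(1)])
    fix V :: "'a set" and E T
    assume fin: "finite V" "V \<noteq> {}" and dense: "vertex_pair_dense \<rho> (1/4 + \<epsilon>) V E"
      and T: "T \<subseteq> V \<times> V" and Tc: "\<delta> * real (card V) ^ 2 \<le> real (card T)"
    let ?r = "reach \<theta> V E T"
    have d4: "1/4 \<le> 1/4 + \<epsilon>" using eps by simp
    obtain j where j: "j < J" "cyclically_closed V E (1 / real J + 15 * \<theta> + 4 * \<rho>) (?r (3 * j)) (?r (3 * j + 1)) (?r (3 * j + 2))"
      "real (card T) - 4 * real J * (\<rho> + 3 * \<theta>) * real (card V) ^ 2 \<le> real (card (?r (3 * j)))"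
      using reach_stabilises[OF fin dense d4 T less_imp_le[OF th(1)] less_imp_le[OF rh(1)] J0] by blast
    have cl: "cyclically_closed V E \<eta> (?r (3 * j)) (?r (3 * j + 1)) (?r (3 * j + 2))"
      by (rule cyclically_closed_mono[OF j(2) sum1])
    have de: "vertex_pair_dense \<eta> (1/4 + \<epsilon>) V E" "vertex_pair_dense \<eta>0 (1/4 + \<epsilon>) V E"
      using dense_mono[OF dense _ order_refl] rh(2) eta by auto
    have "4 * real J * (\<rho> + 3 * \<theta>) * real (card V) ^ 2 \<le> \<delta> / 2 * real (card V) ^ 2"
      using sum2 by (intro mult_right_mono) auto
    then have c0: "\<delta> / 2 * real (card V) ^ 2 \<le> real (card (?r (3 * j)))"
      using Tc j(3) by simp
    have "1 * (\<delta> / 2) / 8 * real (card V) ^ 2 \<le> real (card (?r (3 * j + 1) \<inter> V \<times> V))"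
      by (rule cyclically_closed_step_density[OF fin de(1) d4 cl order_refl order_refl reach_subset[OF T] order_refl _ c0])
        (use \<delta> eta in auto)
    moreover have "?r (3 * j + 1) \<inter> V \<times> V = ?r (3 * j + 1)" using reach_subset[OF T] by (rule Int_absorb2)
    ultimately have c1: "\<delta> / 16 * real (card V) ^ 2 \<le> real (card (?r (3 * j + 1)))" by simp
    have "\<delta> / 16 * real (card V) ^ 2 \<le> \<delta> / 2 * real (card V) ^ 2" using \<delta> by (intro mult_right_mono) auto
    then have c0': "\<delta> / 16 * real (card V) ^ 2 \<le> real (card (?r (3 * j)))" using c0 by linarith
    have "(1 - \<tau>) * real (card V) ^ 2 \<le> real (card (?r (3 * j)))"
      by (rule dich[OF fin de(2) cyclically_closed_mono[OF cl eta(2)] reach_subset[OF T] c0'])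
    moreover have "(1 - \<tau>) * real (card V) ^ 2 \<le> real (card (?r (3 * j + 1)))"
      by (rule dich[OF fin de(2) cyclically_closed_rotate[OF cyclically_closed_mono[OF cl eta(2)]] reach_subset[OF T] c1])
    moreover have "3 * j \<le> 3 * J" using j(1) by simp
    ultimately show "\<exists>l\<le>3 * J. (1 - \<tau>) * real (card V) ^ 2 \<le> real (card (?r l)) \<and>
       (1 - \<tau>) * real (card V) ^ 2 \<le> real (card (?r (Suc l)))"
      by (metis Suc_eq_plus1)
  qed
qed

text \<open>The backward greedy construction: each pair of \<open>reach (Suc i)\<close> has so many predecessors that
  one of them avoids \<open>F\<close> and the vertices chosen so far.\<close>

lemma reach_imp_tight_walk:
  assumes T: "T \<subseteq> V \<times> V"
    and "(c, d) \<in> reach \<theta> V E T l" "c \<noteq> d" "c \<notin> F" "d \<notin> F" "finite F"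
    and "real (card F + l + 2) \<le> \<theta> * real (card V)"
  shows "\<exists>ys y z rest. length ys = l \<and> ys @ [c, d] = y # z # rest \<and> (y, z) \<in> T \<and>
    tight_walk E (ys @ [c, d]) \<and> distinct (ys @ [c, d]) \<and> set (ys @ [c, d]) \<subseteq> V - F"
  using assms(2-)
proof (induction l arbitrary: c d F)
  case 0
  then show ?case using T by (intro exI[of _ "[]"]) auto
next
  case (Suc l)
  let ?X = "{x \<in> V. (x, c) \<in> reach \<theta> V E T l \<and> {x, c, d} \<in> E}"
  have cd: "c \<in> V" "d \<in> V" "\<theta> * real (card V) \<le> real (card ?X)" using Suc.prems(1) by auto
  have "card (insert c (insert d F)) \<le> card F + 2"
    using Suc.prems(5) by (simp add: card_insert_if)
  then have "real (card (insert c (insert d F))) < real (card ?X)"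
    using Suc.prems(6) cd(3) by linarith
  then have "\<not> ?X \<subseteq> insert c (insert d F)"
    using Suc.prems(5) by (meson card_mono finite_insert not_le of_nat_less_iff)
  then obtain x where x: "x \<in> V" "(x, c) \<in> reach \<theta> V E T l" "{x, c, d} \<in> E" "x \<noteq> c" "x \<noteq> d" "x \<notin> F" by auto
  have "real (card (insert d F) + l + 2) \<le> \<theta> * real (card V)"
    using Suc.prems(5,6) by (simp add: card_insert_if)
  then have "\<exists>ys y z rest. length ys = l \<and> ys @ [x, c] = y # z # rest \<and> (y, z) \<in> T \<and>
    tight_walk E (ys @ [x, c]) \<and> distinct (ys @ [x, c]) \<and> set (ys @ [x, c]) \<subseteq> V - insert d F"
    by (intro Suc.IH[OF x(2)]) (use x Suc.prems in auto)
  then obtain ys y z rest where ys: "length ys = l" "ys @ [x, c] = y # z # rest" "(y, z) \<in> T"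
    "tight_walk E (ys @ [x, c])" "distinct (ys @ [x, c])" "set (ys @ [x, c]) \<subseteq> V - insert d F"
    by blast
  have "tight_walk E (ys @ x # c # [d])" using ys(4) x(3) by (subst tight_walk_append) simp
  moreover have "distinct (ys @ [x, c, d])" "set (ys @ [x, c, d]) \<subseteq> V - F"
    using ys(5,6) cd Suc.prems(2-4) x by auto
  moreover have "(ys @ [x]) @ [c, d] = y # z # (rest @ [d])"
    using arg_cong[OF ys(2), of "\<lambda>l. l @ [d]"] by simp
  ultimately show ?case
    using ys(1,3) by (intro exI[of _ "ys @ [x]"] exI[of _ y] exI[of _ z] exI[of _ "rest @ [d]"]) simp
qed

section \<open>Connecting ordered pairs\<close>

lemma card_Int_ge:
  assumes "finite U" "A \<subseteq> U" "B \<subseteq> U"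
  shows "real (card A) + real (card B) - real (card U) \<le> real (card (A \<inter> B))"
proof -
  have "card A + card B = card (A \<union> B) + card (A \<inter> B)"
    using assms by (intro card_Un_Int) (auto intro: finite_subset)
  moreover have "card (A \<union> B) \<le> card U" using assms by (intro card_mono) auto
  ultimately show ?thesis by linarith
qed

lemma card_pairs_touching:
  assumes fin: "finite V" "finite F"
  shows "real (card {(y, z) \<in> V \<times> V. y \<in> F \<or> z \<in> F}) \<le> 2 * real (card F) * real (card V)"
proof -
  have "{(y, z) \<in> V \<times> V. y \<in> F \<or> z \<in> F} \<subseteq> F \<times> V \<union> V \<times> F" by auto
  then have "card {(y, z) \<in> V \<times> V. y \<in> F \<or> z \<in> F} \<le> card (F \<times> V \<union> V \<times> F)"
    using fin by (intro card_mono) auto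
  also have "\<dots> \<le> card (F \<times> V) + card (V \<times> F)" by (rule card_Un_le)
  also have "\<dots> = 2 * (card F * card V)" by (simp add: card_cartesian_product)
  finally have "real (card {(y, z) \<in> V \<times> V. y \<in> F \<or> z \<in> F}) \<le> real (2 * (card F * card V))"
    by (simp only: of_nat_le_iff)
  then show ?thesis by simp
qed

lemma pair_avoiding:
  assumes fin: "finite V" "finite F" and S: "S \<subseteq> V \<times> V"
    and c: "(2 * real (card F) + 1) * real (card V) < real (card S)"
  obtains y z where "(y, z) \<in> S" "y \<noteq> z" "y \<notin> F" "z \<notin> F"
proof -
  let ?B = "{(y, z) \<in> V \<times> V. y \<in> F \<or> z \<in> F} \<union> (\<lambda>y. (y, y)) ` V"
  have "card ?B \<le> card {(y, z) \<in> V \<times> V. y \<in> F \<or> z \<in> F} + card V"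
    using card_Un_le[of "{(y, z) \<in> V \<times> V. y \<in> F \<or> z \<in> F}" "(\<lambda>y. (y, y)) ` V"]
      card_image_le[OF fin(1), of "\<lambda>y. (y, y)"] by linarith
  then have "real (card ?B) \<le> (2 * real (card F) + 1) * real (card V)"
    using card_pairs_touching[OF fin] by (simp add: algebra_simps)
  then have "card ?B < card S" using c by linarith
  moreover have "finite ?B"
    by (rule finite_subset[of _ "V \<times> V"]) (use fin in auto)
  ultimately have "\<not> S \<subseteq> ?B" using card_mono[of ?B S] by linarith
  then obtain q where q: "q \<in> S" "q \<notin> ?B" by blast
  moreover obtain y z where "q = (y, z)" by (cases q)
  ultimately show thesis using S by (intro that[of y z]) auto
qed

lemma card_good_ge:
  assumes "finite V" "vertex_pair_dense \<rho> d V E" "1/4 \<le> d"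
  shows "(1 - 72 * \<rho>) * real (card V) ^ 2 \<le> real (card {(a, b) \<in> V \<times> V. good (1/64) V E a b})"
proof -
  let ?G = "{(a, b) \<in> V \<times> V. good (1/64) V E a b}" and ?B = "{(a, b) \<in> V \<times> V. \<not> good (1/64) V E a b}"
  have fin: "finite ?G" "finite ?B" using assms(1) by (auto intro: finite_subset[of _ "V \<times> V"])
  have "?G \<union> ?B = V \<times> V" "?G \<inter> ?B = {}" by auto
  then have "card (V \<times> V) = card ?G + card ?B" using card_Un_disjoint[OF fin] by metis
  then have "real (card V * card V) = real (card ?G + card ?B)" by (simp only: card_cartesian_product)
  then have "real (card V) ^ 2 = real (card ?G) + real (card ?B)" by (simp add: power2_eq_square)
  then show ?thesis using few_not_good[OF assms] by (simp add: algebra_simps)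
qed

lemma card_pairs_swap:
  "card {(a, b) \<in> V \<times> V. P b a} = card {(a, b) \<in> V \<times> V. P a b}"
proof -
  have "{(a, b) \<in> V \<times> V. P b a} = prod.swap ` {(a, b) \<in> V \<times> V. P a b}" by auto
  then show ?thesis by (simp add: card_image)
qed

text \<open>7/10 is what three sets of 9/10 of all pairs have in common.\<close>

lemma dense_pair_avoiding:
  assumes fin: "finite V" "finite F" and S: "S \<subseteq> V \<times> V" "7/10 * real (card V) ^ 2 \<le> real (card S)"
    and n: "50 \<le> real (card V)" and F: "real (card F) \<le> 1/20 * real (card V) + 2"
  obtains y z where "(y, z) \<in> S" "y \<noteq> z" "y \<notin> F" "z \<notin> F"
proof -
  have "2 * real (card F) + 1 \<le> 2/10 * real (card V)" using F n by simp
  then have "(2 * real (card F) + 1) * real (card V) \<le> 2/10 * real (card V) * real (card V)"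
    by (rule mult_right_mono) simp
  also have "\<dots> < 7/10 * real (card V) ^ 2" using n by (simp add: power2_eq_square)
  also have "\<dots> \<le> real (card S)" by (rule S(2))
  finally show thesis using pair_avoiding[OF fin S(1)] that by metis
qed

lemma card_Int_dense_pairs:
  assumes "finite V" "A \<subseteq> V \<times> V" "B \<subseteq> V \<times> V"
    and "x * real (card V) ^ 2 \<le> real (card A)" "y * real (card V) ^ 2 \<le> real (card B)" "z \<le> x + y - 1"
  shows "z * real (card V) ^ 2 \<le> real (card (A \<inter> B))"
proof -
  have "real (card (V \<times> V)) = real (card V) ^ 2" by (simp add: card_cartesian_product power2_eq_square)
  then have "(x + y - 1) * real (card V) ^ 2 \<le> real (card (A \<inter> B))"
    using card_Int_ge[of "V \<times> V" A B] assms(1-5) by (simp add: algebra_simps)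
  moreover have "z * real (card V) ^ 2 \<le> (x + y - 1) * real (card V) ^ 2"
    using assms(6) by (intro mult_right_mono) auto
  ultimately show ?thesis by linarith
qed

definition starts :: "'a set \<Rightarrow> 'a set set \<Rightarrow> 'a \<Rightarrow> 'a \<Rightarrow> ('a \<times> 'a) set" where
  "starts V E a b = {(y, z) \<in> V \<times> V. {a, b, y} \<in> E \<and> {b, y, z} \<in> E}"

lemma starts_subset: "starts V E a b \<subseteq> V \<times> V"
  by (auto simp: starts_def)

lemma reach_starts_imp_tight_walk:
  assumes "(c, d) \<in> reach \<theta> V E (starts V E a b) l" "c \<noteq> d" "c \<notin> F" "d \<notin> F" "finite F"
    and "real (card F + l + 2) \<le> \<theta> * real (card V)"
  shows "\<exists>ys. length ys = l \<and> tight_walk E ([a, b] @ ys @ [c, d]) \<and> distinct (ys @ [c, d]) \<and>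
    set (ys @ [c, d]) \<subseteq> V - F"
proof -
  obtain ys y z rest where ys: "length ys = l" "ys @ [c, d] = y # z # rest" "(y, z) \<in> starts V E a b"
    "tight_walk E (ys @ [c, d])" "distinct (ys @ [c, d])" "set (ys @ [c, d]) \<subseteq> V - F"
    using reach_imp_tight_walk[OF starts_subset assms] by (elim exE conjE) (rule that)
  have "tight_walk E ([a, b] @ ys @ [c, d])" using ys(2-4) by (simp add: starts_def)
  then show ?thesis using ys(1,5,6) by (intro exI conjI)
qed

text \<open>The slack between \<open>\<theta>\<close> and \<open>\<theta>0\<close> is the room for the vertices of the walk itself.\<close>

lemma slack:
  fixes \<theta>0 c :: real
  assumes "0 < \<theta>0"
  obtains \<theta> n0 where "0 < \<theta>" "\<theta> \<le> 1/20" "\<And>n. real n0 \<le> n \<Longrightarrow> 50 \<le> n \<and> \<theta> * n + c \<le> \<theta>0 * n"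
proof -
  define \<theta> where "\<theta> = min (\<theta>0 / 2) (1/20)"
  have \<theta>: "0 < \<theta>" "\<theta> \<le> \<theta>0 / 2" "\<theta> \<le> 1/20" using assms by (auto simp: \<theta>_def)
  obtain n1 :: nat where n1: "2 * c / \<theta>0 < real n1" using reals_Archimedean2 by blast
  show thesis
  proof (rule that[OF \<theta>(1,3)])
    fix n assume n: "real (n1 + 50) \<le> n"
    have "2 * c / \<theta>0 \<le> n" using n1 n by simp
    then have "c \<le> \<theta>0 / 2 * n" using assms by (simp add: pos_divide_le_eq algebra_simps)
    moreover have "\<theta> * n \<le> \<theta>0 / 2 * n" using \<theta> n by (intro mult_right_mono) auto
    moreover have "\<theta>0 * n = \<theta>0 / 2 * n + \<theta>0 / 2 * n" by simp
    ultimately show "50 \<le> n \<and> \<theta> * n + c \<le> \<theta>0 * n" using n by linarith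
  qed
qed

text \<open>The target is good when read backwards. Walks from \<open>(a, b)\<close> and from
  \<open>(d, c)\<close> each reach 9/10 of all ordered pairs, so some pair is reached by the former
  and its reverse by the latter.\<close>

lemma connecting:
  fixes \<epsilon> \<delta> :: real
  assumes eps: "0 < \<epsilon>" "\<epsilon> \<le> 1" and \<delta>: "0 < \<delta>"
  obtains \<rho> \<theta> M n0 where "0 < \<rho>" and "0 < \<theta>" and "\<And>(V::'a set) E F a b c d.
    finite V \<Longrightarrow> n0 \<le> card V \<Longrightarrow> vertex_pair_dense \<rho> (1/4 + \<epsilon>) V E \<Longrightarrow>
    good \<delta> V E a b \<Longrightarrow> good \<delta> V E d c \<Longrightarrow> finite F \<Longrightarrow> real (card F) \<le> \<theta> * real (card V) \<Longrightarrow>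
    \<exists>m. tight_walk E ([a, b] @ m @ [c, d]) \<and> distinct m \<and> set m \<subseteq> V - F \<and> length m \<le> M"
proof -
  show thesis
  proof (rule reach_nearly_everything[OF eps \<delta>, of "1/10", where 'a = 'a], simp, goal_cases)
    case (1 \<rho> \<theta>0 M0)
    note \<rho> = 1(1) and \<theta>0 = 1(2) and reach = 1(3)
    obtain \<theta> n0 where \<theta>: "0 < \<theta>" "\<theta> \<le> 1/20"
      and room: "\<And>n. real n0 \<le> n \<Longrightarrow> 50 \<le> n \<and> \<theta> * n + real (2 * M0 + 3) \<le> \<theta>0 * n"
      using slack[OF \<theta>0] by metis
    show thesis
    proof (rule that[OF \<rho> \<theta>(1)])
      fix V F :: "'a set" and E a b c d
      assume fin: "finite V" and n0: "n0 \<le> card V" and dense: "vertex_pair_dense \<rho> (1/4 + \<epsilon>) V E"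
        and good: "good \<delta> V E a b" "good \<delta> V E d c" and F: "finite F" "real (card F) \<le> \<theta> * real (card V)"
      define n where "n = real (card V)"
      have n: "50 \<le> n" and room: "\<theta> * n + real (2 * M0 + 3) \<le> \<theta>0 * n"
        using room[of n] n0 by (auto simp: n_def)
      then have Vne: "V \<noteq> {}" by (auto simp: n_def)
      let ?r1 = "reach \<theta>0 V E (starts V E a b)" and ?r2 = "reach \<theta>0 V E (starts V E d c)"
      have Tc: "\<delta> * real (card V) ^ 2 \<le> real (card (starts V E a b))" "\<delta> * real (card V) ^ 2 \<le> real (card (starts V E d c))"
        using good by (simp_all add: good_def starts_def)
      obtain l1 where l1: "l1 \<le> M0" "9/10 * n ^ 2 \<le> real (card (?r1 l1))"
        using reach[OF fin Vne dense starts_subset Tc(1)] by (auto simp: n_def)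
      obtain l2 where l2: "l2 \<le> M0" "9/10 * n ^ 2 \<le> real (card (?r2 l2))"
        using reach[OF fin Vne dense starts_subset Tc(2)] by (auto simp: n_def)
      define R where "R = {(y, z) \<in> V \<times> V. (z, y) \<in> ?r2 l2}"
      have RV: "R \<subseteq> V \<times> V" by (auto simp: R_def)
      have "{(y, z) \<in> V \<times> V. (y, z) \<in> ?r2 l2} = ?r2 l2"
        using reach_subset[OF starts_subset[of V E d c], of \<theta>0 E l2] by auto
      then have Rc: "9/10 * n ^ 2 \<le> real (card R)"
        unfolding R_def card_pairs_swap[of V "\<lambda>y z. (y, z) \<in> ?r2 l2"] using l2(2) by simp
      have Sc: "7/10 * real (card V) ^ 2 \<le> real (card (?r1 l1 \<inter> R))"
        by (rule card_Int_dense_pairs[OF fin reach_subset[OF starts_subset] RV l1(2)[unfolded n_def] Rc[unfolded n_def]]) simp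
      have "\<theta> * n \<le> 1/20 * n" using \<theta>(2) n by (intro mult_right_mono) auto
      then have "real (card F) \<le> 1/20 * real (card V) + 2" using F(2) by (simp add: n_def)
      moreover have "?r1 l1 \<inter> R \<subseteq> V \<times> V" using RV by auto
      ultimately obtain y z where yz: "(y, z) \<in> ?r1 l1 \<inter> R" "y \<noteq> z" "y \<notin> F" "z \<notin> F"
        using dense_pair_avoiding[OF fin F(1) _ Sc] n unfolding n_def by metis
      have yz1: "(y, z) \<in> ?r1 l1" and zy2: "(z, y) \<in> ?r2 l2" using yz(1) by (auto simp: R_def)
      have "real (card F + l1 + 2) \<le> \<theta>0 * real (card V)"
        using room F(2) l1(1) unfolding n_def by simp
      from reach_starts_imp_tight_walk[OF yz1 yz(2,3,4) F(1) this]
      obtain ys where ys: "length ys = l1" "tight_walk E ([a, b] @ ys @ [y, z])" "distinct (ys @ [y, z])"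
        "set (ys @ [y, z]) \<subseteq> V - F" by (elim exE conjE) (rule that)
      \<comment> \<open>The second half must avoid the first; \<open>slack\<close> has left room for
        these vertices.\<close>
      have "card (F \<union> set ys) \<le> card F + l1"
        using card_Un_le[of F "set ys"] card_length[of ys] ys(1) by linarith
      then have "real (card (F \<union> set ys) + l2 + 2) \<le> \<theta>0 * real (card V)"
        using room F(2) l1(1) l2(1) unfolding n_def by simp
      moreover have "z \<noteq> y" "z \<notin> F \<union> set ys" "y \<notin> F \<union> set ys" "finite (F \<union> set ys)"
        using yz F ys(3) by auto
      ultimately have "\<exists>zs. length zs = l2 \<and> tight_walk E ([d, c] @ zs @ [z, y]) \<and> distinct (zs @ [z, y]) \<and>
        set (zs @ [z, y]) \<subseteq> V - (F \<union> set ys)"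
        by (intro reach_starts_imp_tight_walk[OF zy2])
      then obtain zs where zs: "length zs = l2" "tight_walk E ([d, c] @ zs @ [z, y])" "distinct (zs @ [z, y])"
        "set (zs @ [z, y]) \<subseteq> V - (F \<union> set ys)" by (elim exE conjE) (rule that)
      have "tight_walk E (rev ([d, c] @ zs @ [z, y]))" using zs(2) by (simp only: tight_walk_rev)
      then have w2: "tight_walk E (y # z # rev zs @ [c, d])" by simp
      have "tight_walk E ((a # b # ys) @ y # z # rev zs @ [c, d])"
        using ys(2) w2 by (subst tight_walk_append) simp
      then have "tight_walk E ([a, b] @ (ys @ [y, z] @ rev zs) @ [c, d])" by simp
      moreover have "distinct (ys @ [y, z] @ rev zs)" using ys(3) zs(3,4) by auto
      moreover have "set (ys @ [y, z] @ rev zs) \<subseteq> V - F" using ys(4) zs(4) by auto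
      moreover have "length (ys @ [y, z] @ rev zs) \<le> 2 * M0 + 2" using ys(1) zs(1) l1(1) l2(1) by simp
      ultimately show "\<exists>m. tight_walk E ([a, b] @ m @ [c, d]) \<and> distinct m \<and> set m \<subseteq> V - F \<and> length m \<le> 2 * M0 + 2"
        by (intro exI conjI)
    qed
  qed
qed

text \<open>The end pair lies in \<open>reach l\<close> and in \<open>reach (Suc l)\<close>, and the
  longer walk is built to avoid the shorter one. \<open>R\<close> leaves room for a demand on the
  end pair, which the applications take to be goodness.\<close>

lemma two_walks:
  fixes \<epsilon> \<delta> :: real
  assumes eps: "0 < \<epsilon>" "\<epsilon> \<le> 1" and \<delta>: "0 < \<delta>"
  obtains \<rho> \<theta> M n0 where "0 < \<rho>" and "0 < \<theta>" and "\<And>(V::'a set) E F R a b.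
    finite V \<Longrightarrow> n0 \<le> card V \<Longrightarrow> vertex_pair_dense \<rho> (1/4 + \<epsilon>) V E \<Longrightarrow> good \<delta> V E a b \<Longrightarrow>
    R \<subseteq> V \<times> V \<Longrightarrow> 9/10 * real (card V) ^ 2 \<le> real (card R) \<Longrightarrow>
    finite F \<Longrightarrow> real (card F) \<le> \<theta> * real (card V) \<Longrightarrow>
    \<exists>S T c d. (c, d) \<in> R \<and> tight_walk E ([a, b] @ S @ [c, d]) \<and> tight_walk E ([a, b] @ T @ [c, d]) \<and>
      length T = Suc (length S) \<and> length S \<le> M \<and> distinct ([c, d] @ S @ T) \<and> set ([c, d] @ S @ T) \<subseteq> V - F"
proof -
  show thesis
  proof (rule reach_nearly_everything[OF eps \<delta>, of "1/10", where 'a = 'a], simp, goal_cases)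
    case (1 \<rho> \<theta>0 M0)
    note \<rho> = 1(1) and \<theta>0 = 1(2) and reach = 1(3)
    obtain \<theta> n0 where \<theta>: "0 < \<theta>" "\<theta> \<le> 1/20"
      and room: "\<And>n. real n0 \<le> n \<Longrightarrow> 50 \<le> n \<and> \<theta> * n + real (2 * M0 + 3) \<le> \<theta>0 * n"
      using slack[OF \<theta>0] by metis
    show thesis
    proof (rule that[OF \<rho> \<theta>(1)])
      fix V F :: "'a set" and E R a b
      assume fin: "finite V" and n0: "n0 \<le> card V" and dense: "vertex_pair_dense \<rho> (1/4 + \<epsilon>) V E"
        and good: "good \<delta> V E a b" and R: "R \<subseteq> V \<times> V" "9/10 * real (card V) ^ 2 \<le> real (card R)"
        and F: "finite F" "real (card F) \<le> \<theta> * real (card V)"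
      define n where "n = real (card V)"
      have n: "50 \<le> n" and room: "\<theta> * n + real (2 * M0 + 3) \<le> \<theta>0 * n"
        using room[of n] n0 by (auto simp: n_def)
      then have Vne: "V \<noteq> {}" by (auto simp: n_def)
      let ?r = "reach \<theta>0 V E (starts V E a b)"
      have Tc: "\<delta> * real (card V) ^ 2 \<le> real (card (starts V E a b))"
        using good by (simp add: good_def starts_def)
      obtain l where l: "l \<le> M0" "9/10 * real (card V) ^ 2 \<le> real (card (?r l))"
        "9/10 * real (card V) ^ 2 \<le> real (card (?r (Suc l)))"
        using reach[OF fin Vne dense starts_subset Tc] by auto
      have rV: "?r i \<subseteq> V \<times> V" for i by (rule reach_subset[OF starts_subset])
      have rl: "?r l \<inter> ?r (Suc l) \<subseteq> V \<times> V" "?r l \<inter> ?r (Suc l) \<inter> R \<subseteq> V \<times> V" using rV[of l] by auto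
      have "7/10 * real (card V) ^ 2 \<le> real (card (?r l \<inter> ?r (Suc l) \<inter> R))"
        by (rule card_Int_dense_pairs[OF fin rl(1) R(1) card_Int_dense_pairs[OF fin rV rV l(2,3) order_refl] R(2)]) simp
      moreover have "\<theta> * n \<le> 1/20 * n" using \<theta>(2) n by (intro mult_right_mono) auto
      then have "real (card F) \<le> 1/20 * real (card V) + 2" using F(2) by (simp add: n_def)
      ultimately obtain c d where cd: "(c, d) \<in> ?r l \<inter> ?r (Suc l) \<inter> R" "c \<noteq> d" "c \<notin> F" "d \<notin> F"
        using dense_pair_avoiding[OF fin F(1) rl(2)] n unfolding n_def by metis
      have cd1: "(c, d) \<in> ?r l" "(c, d) \<in> ?r (Suc l)" "(c, d) \<in> R" using cd(1) by (auto simp del: reach.simps)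
      have "real (card F + l + 2) \<le> \<theta>0 * real (card V)"
        using room F(2) l(1) unfolding n_def by simp
      from reach_starts_imp_tight_walk[OF cd1(1) cd(2,3,4) F(1) this]
      obtain S where S: "length S = l" "tight_walk E ([a, b] @ S @ [c, d])" "distinct (S @ [c, d])"
        "set (S @ [c, d]) \<subseteq> V - F" by (elim exE conjE) (rule that)
      have "card (F \<union> set S) \<le> card F + l"
        using card_Un_le[of F "set S"] card_length[of S] S(1) by linarith
      then have "real (card (F \<union> set S) + Suc l + 2) \<le> \<theta>0 * real (card V)"
        using room F(2) l(1) unfolding n_def by simp
      moreover have "c \<notin> F \<union> set S" "d \<notin> F \<union> set S" "finite (F \<union> set S)" using cd F S(3) by auto
      ultimately have "\<exists>T. length T = Suc l \<and> tight_walk E ([a, b] @ T @ [c, d]) \<and> distinct (T @ [c, d]) \<and>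
        set (T @ [c, d]) \<subseteq> V - (F \<union> set S)"
        by (intro reach_starts_imp_tight_walk[OF cd1(2) cd(2)])
      then obtain T where T: "length T = Suc l" "tight_walk E ([a, b] @ T @ [c, d])" "distinct (T @ [c, d])"
        "set (T @ [c, d]) \<subseteq> V - (F \<union> set S)" by (elim exE conjE) (rule that)
      have "distinct ([c, d] @ S @ T)" "set ([c, d] @ S @ T) \<subseteq> V - F" using S(3,4) T(3,4) by auto
      moreover have "length T = Suc (length S)" "length S \<le> M0" using S(1) T(1) l(1) by simp_all
      ultimately show "\<exists>S T c d. (c, d) \<in> R \<and> tight_walk E ([a, b] @ S @ [c, d]) \<and> tight_walk E ([a, b] @ T @ [c, d]) \<and>
        length T = Suc (length S) \<and> length S \<le> M0 \<and> distinct ([c, d] @ S @ T) \<and> set ([c, d] @ S @ T) \<subseteq> V - F"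
        using cd1(3) S(2) T(2) by (intro exI conjI)
    qed
  qed
qed

text \<open>\<open>1/720 = (1/10) / 72\<close>, with the 72 of \<open>few_not_good\<close>.\<close>

lemma nine_tenths_good:
  assumes "finite V" "vertex_pair_dense \<rho> d V E" "1/4 \<le> d" "\<rho> \<le> 1/720"
  shows "9/10 * real (card V) ^ 2 \<le> real (card {(a, b) \<in> V \<times> V. good (1/64) V E a b})"
proof -
  have "9/10 * real (card V) ^ 2 \<le> (1 - 72 * \<rho>) * real (card V) ^ 2"
    using assms(4) by (intro mult_right_mono) auto
  then show ?thesis using card_good_ge[OF assms(1-3)] by linarith
qed

text \<open>The shorter of two walks is kept. Its end is good with the absolute constant 1/64,
  however small \<open>\<delta>\<close> was, so extensions can be repeated without loss.\<close>

lemma extending: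
  fixes \<epsilon> \<delta> :: real
  assumes eps: "0 < \<epsilon>" "\<epsilon> \<le> 1" and \<delta>: "0 < \<delta>"
  obtains \<rho> \<theta> M n0 where "0 < \<rho>" and "0 < \<theta>" and "\<And>(V::'a set) E F a b.
    finite V \<Longrightarrow> n0 \<le> card V \<Longrightarrow> vertex_pair_dense \<rho> (1/4 + \<epsilon>) V E \<Longrightarrow>
    good \<delta> V E a b \<Longrightarrow> finite F \<Longrightarrow> real (card F) \<le> \<theta> * real (card V) \<Longrightarrow>
    \<exists>m c d. tight_walk E ([a, b] @ m @ [c, d]) \<and> distinct (m @ [c, d]) \<and> set (m @ [c, d]) \<subseteq> V - F \<and>
      length m \<le> M \<and> good (1/64) V E c d"
proof -
  show thesis
  proof (rule two_walks[OF eps \<delta>, where 'a = 'a], goal_cases)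
    case (1 \<rho> \<theta> M n0)
    show thesis
    proof (rule that)
      show "0 < min \<rho> (1/720)" "0 < \<theta>" using 1(1,2) by auto
      fix V F :: "'a set" and E a b
      assume H: "finite V" "n0 \<le> card V" and dense: "vertex_pair_dense (min \<rho> (1/720)) (1/4 + \<epsilon>) V E"
        and good: "good \<delta> V E a b" and F: "finite F" "real (card F) \<le> \<theta> * real (card V)"
      let ?R = "{(y, z) \<in> V \<times> V. good (1/64) V E y z}"
      have d1: "vertex_pair_dense \<rho> (1/4 + \<epsilon>) V E" by (rule dense_mono[OF dense]) auto
      have R: "?R \<subseteq> V \<times> V" by auto
      have Rc: "9/10 * real (card V) ^ 2 \<le> real (card ?R)"
        by (rule nine_tenths_good[OF H(1) dense]) (use eps in auto)
      from 1(3)[OF H d1 good R Rc F]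
      obtain S T c d where S: "(c, d) \<in> ?R" "tight_walk E ([a, b] @ S @ [c, d])" "length S \<le> M"
        "distinct ([c, d] @ S @ T)" "set ([c, d] @ S @ T) \<subseteq> V - F"
        by (elim exE conjE) (rule that)
      have "good (1/64) V E c d" "distinct (S @ [c, d])" "set (S @ [c, d]) \<subseteq> V - F" using S(1,4,5) by auto
      then show "\<exists>m c d. tight_walk E ([a, b] @ m @ [c, d]) \<and> distinct (m @ [c, d]) \<and> set (m @ [c, d]) \<subseteq> V - F \<and>
        length m \<le> M \<and> good (1/64) V E c d"
        using S(2,3) by (intro exI conjI)
    qed
  qed
qed

text \<open>The first pair is good read backwards and the last read forwards, so both sides can be
  connected further.\<close>

definition consecutive_walks :: "'a set \<Rightarrow> 'a set set \<Rightarrow> ('a \<Rightarrow> 'a \<Rightarrow> bool) \<Rightarrow> nat \<Rightarrow> 'a set \<Rightarrow> bool" where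
  "consecutive_walks V E G M F \<longleftrightarrow>
    (\<exists>a b c d S T. tight_walk E ([a, b] @ S @ [c, d]) \<and> tight_walk E ([a, b] @ T @ [c, d]) \<and>
      length T = Suc (length S) \<and> distinct ([a, b, c, d] @ S @ T) \<and> set ([a, b, c, d] @ S @ T) \<subseteq> V - F \<and>
      length S \<le> M \<and> G b a \<and> G c d)"

lemma consecutive_walks_mono:
  assumes "consecutive_walks V E G M F" "M \<le> M'"
  shows "consecutive_walks V E G M' F"
proof -
  obtain a b c d S T where S: "tight_walk E ([a, b] @ S @ [c, d])" "tight_walk E ([a, b] @ T @ [c, d])"
    "length T = Suc (length S)" "distinct ([a, b, c, d] @ S @ T)" "set ([a, b, c, d] @ S @ T) \<subseteq> V - F"
    "length S \<le> M" "G b a" "G c d"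
    using assms(1) unfolding consecutive_walks_def by (elim exE conjE) (rule that)
  have "length S \<le> M'" using S(6) assms(2) by simp
  then show ?thesis unfolding consecutive_walks_def using S(1-5,7,8) by (intro exI conjI)
qed

text \<open>The first pair is taken good in both directions: forwards as the start of the two walks,
  backwards for a later connection.\<close>

lemma walks_of_consecutive_lengths:
  fixes \<epsilon> :: real
  assumes eps: "0 < \<epsilon>" "\<epsilon> \<le> 1"
  obtains \<rho> \<theta> M n0 where "0 < \<rho>" and "0 < \<theta>" and "\<And>(V::'a set) E F.
    finite V \<Longrightarrow> n0 \<le> card V \<Longrightarrow> vertex_pair_dense \<rho> (1/4 + \<epsilon>) V E \<Longrightarrow>
    finite F \<Longrightarrow> real (card F) \<le> \<theta> * real (card V) \<Longrightarrow> consecutive_walks V E (good (1/64) V E) M F"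
proof -
  have d64: "0 < (1/64 :: real)" by simp
  show thesis
  proof (rule two_walks[OF eps d64, where 'a = 'a], goal_cases)
    case (1 \<rho> \<theta>0 M n1)
    obtain \<theta> n2 where \<theta>: "0 < \<theta>" "\<theta> \<le> 1/20" and room: "\<And>n. real n2 \<le> n \<Longrightarrow> 50 \<le> n \<and> \<theta> * n + 2 \<le> \<theta>0 * n"
      using slack[OF 1(2)] by metis
    show thesis
    proof (rule that[OF _ \<theta>(1)])
      show "0 < min \<rho> (1/720)" using 1(1) by auto
      fix V F :: "'a set" and E
      assume fin: "finite V" and n12: "max n1 n2 \<le> card V"
        and dense: "vertex_pair_dense (min \<rho> (1/720)) (1/4 + \<epsilon>) V E"
        and F: "finite F" "real (card F) \<le> \<theta> * real (card V)"
      have n: "50 \<le> real (card V)" and rm: "\<theta> * real (card V) + 2 \<le> \<theta>0 * real (card V)"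
        using room[of "real (card V)"] n12 by auto
      let ?g = "good (1/64) V E"
      define R R' where "R = {(y, z) \<in> V \<times> V. ?g y z}" and "R' = {(y, z) \<in> V \<times> V. ?g z y}"
      have RV: "R \<subseteq> V \<times> V" "R' \<subseteq> V \<times> V" "R \<inter> R' \<subseteq> V \<times> V" by (auto simp: R_def R'_def)
      have Rc: "9/10 * real (card V) ^ 2 \<le> real (card R)"
        unfolding R_def by (rule nine_tenths_good[OF fin dense]) (use eps in auto)
      moreover have "card R' = card R" unfolding R_def R'_def by (rule card_pairs_swap)
      ultimately have "9/10 * real (card V) ^ 2 \<le> real (card R')" by simp
      then have RRc: "7/10 * real (card V) ^ 2 \<le> real (card (R \<inter> R'))"
        by (rule card_Int_dense_pairs[OF fin RV(1,2) Rc]) simp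
      have "\<theta> * real (card V) \<le> 1/20 * real (card V)" using \<theta>(2) by (intro mult_right_mono) auto
      then have "real (card F) \<le> 1/20 * real (card V) + 2" using F(2) by simp
      then obtain a b where ab: "(a, b) \<in> R \<inter> R'" "a \<noteq> b" "a \<notin> F" "b \<notin> F"
        using dense_pair_avoiding[OF fin F(1) RV(3) RRc n] by metis
      have gab: "?g a b" "?g b a" "a \<in> V" "b \<in> V" using ab(1) by (auto simp: R_def R'_def)
      have F': "finite (insert a (insert b F))" "card (insert a (insert b F)) \<le> card F + 2"
        using F by (auto simp: card_insert_if)
      have F'c: "real (card (insert a (insert b F))) \<le> \<theta>0 * real (card V)" using F'(2) F(2) rm by linarith
      have n1: "n1 \<le> card V" using n12 by simp
      have "vertex_pair_dense \<rho> (1/4 + \<epsilon>) V E" by (rule dense_mono[OF dense]) auto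
      from 1(3)[OF fin n1 this gab(1) RV(1) Rc F'(1) F'c]
      obtain S T c d where S: "(c, d) \<in> R" "tight_walk E ([a, b] @ S @ [c, d])" "tight_walk E ([a, b] @ T @ [c, d])"
        "length T = Suc (length S)" "length S \<le> M" "distinct ([c, d] @ S @ T)"
        "set ([c, d] @ S @ T) \<subseteq> V - insert a (insert b F)"
        by (elim exE conjE) (rule that)
      have "distinct ([a, b, c, d] @ S @ T)" "set ([a, b, c, d] @ S @ T) \<subseteq> V - F" "?g c d"
        using S(1,6,7) ab gab by (auto simp: R_def)
      then show "consecutive_walks V E ?g M F"
        unfolding consecutive_walks_def using S(2-5) gab(2) by (intro exI conjI)
    qed
  qed
qed

section \<open>Links and gadgets\<close>

definition link :: "'a set \<Rightarrow> 'a set set \<Rightarrow> 'a \<Rightarrow> ('a \<times> 'a) set" where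
  "link V E v = {(y, z) \<in> V \<times> V. {v, y, z} \<in> E}"

text \<open>\<open>p q r w\<close> is a walk in the link graph of \<open>v\<close>, so
  \<open>v\<close> can be the middle vertex of \<open>p q v r w\<close>. Vertices that fit the same
  \<open>p q r w\<close> can replace each other without a change at the ends.\<close>

definition fits :: "'a set set \<Rightarrow> 'a \<Rightarrow> 'a \<Rightarrow> 'a \<Rightarrow> 'a \<Rightarrow> 'a \<Rightarrow> bool" where
  "fits E v p q r w \<longleftrightarrow> {v, p, q} \<in> E \<and> {v, q, r} \<in> E \<and> {v, r, w} \<in> E"

lemma fits_tight_walk: "fits E v p q r w \<Longrightarrow> tight_walk E [p, q, v, r, w]"
  by (simp add: fits_def insert_commute)

lemma degree_le_card_link:
  assumes "uniform3_hypergraph V E"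
  shows "vertex_degree E v \<le> card (link V E v)"
proof -
  have fin: "finite (link V E v)"
    by (rule finite_subset[of _ "V \<times> V"]) (use assms in \<open>auto simp: link_def uniform3_hypergraph_def\<close>)
  have "{e \<in> E. v \<in> e} \<subseteq> (\<lambda>(y, z). {v, y, z}) ` link V E v"
  proof
    fix e assume "e \<in> {e \<in> E. v \<in> e}"
    then have e: "e \<in> E" "v \<in> e" "e \<subseteq> V" "card e = 3" using assms by (auto simp: uniform3_hypergraph_def)
    then have "card (e - {v}) = 2" by simp
    then obtain y z where yz: "e - {v} = {y, z}" by (meson card_2_iff)
    then have "e = {v, y, z}" using e(2) by blast
    moreover have "y \<in> V" "z \<in> V" using yz e(3) by auto
    ultimately show "e \<in> (\<lambda>(y, z). {v, y, z}) ` link V E v"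
      using e(1) by (auto simp: link_def intro!: image_eqI[of _ _ "(y, z)"])
  qed
  then have "card {e \<in> E. v \<in> e} \<le> card (link V E v)"
    by (rule surj_card_le[OF fin])
  then show ?thesis by (simp add: vertex_degree_def)
qed

text \<open>Density is applied to \<open>L\<close> and the exceptional vertices: on average a link
  contains almost a quarter of \<open>L\<close> or more, so few links contain less than an eighth of
  the guaranteed size. Hence a dense link meets almost every other link in many pairs.\<close>

lemma few_small_common_links:
  assumes fin: "finite V" "V \<noteq> {}" and dense: "vertex_pair_dense \<rho> d V E" "1/4 \<le> d"
    and L: "L \<subseteq> V \<times> V" "g * real (card V) ^ 2 \<le> real (card L)" "0 < g"
  shows "real (card {u \<in> V. real (card (L \<inter> link V E u)) < g / 8 * real (card V) ^ 2}) \<le> 8 * \<rho> / g * real (card V)"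
proof -
  define n where "n = real (card V)"
  have n: "n > 0" using fin by (simp add: n_def card_gt_0_iff)
  define X where "X = {u \<in> V. real (card (L \<inter> link V E u)) < g / 8 * n ^ 2}"
  have X: "X \<subseteq> V" "finite X" using fin by (auto simp: X_def)
  have finL: "finite L" by (rule finite_subset[OF L(1)]) (use fin in simp)
  have eq: "{p \<in> L. {x, fst p, snd p} \<in> E} = L \<inter> link V E x" for x
    using L(1) by (auto simp: link_def)
  have "card {(x, p). x \<in> X \<and> p \<in> L \<and> {x, fst p, snd p} \<in> E} = (\<Sum>x\<in>X. card (L \<inter> link V E x))"
    unfolding card_relation_by_fst[OF X(2) finL, of "\<lambda>x p. {x, fst p, snd p} \<in> E"] eq ..
  then have "d * real (card X) * real (card L) - \<rho> * n ^ 3 \<le> (\<Sum>x\<in>X. real (card (L \<inter> link V E x)))"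
    using dense_sum[OF dense(1) fin(1) X(1) L(1)] by (simp add: n_def)
  also have "\<dots> \<le> (\<Sum>x\<in>X. g / 8 * n ^ 2)" by (intro sum_mono) (auto simp: X_def)
  also have "\<dots> = real (card X) * (g / 8 * n ^ 2)" by simp
  finally have 1: "d * real (card X) * real (card L) - \<rho> * n ^ 3 \<le> real (card X) * (g / 8 * n ^ 2)" .
  have "1/4 * (real (card X) * (g * n ^ 2)) \<le> d * (real (card X) * real (card L))"
    using dense(2) L by (intro mult_mono) (auto simp: n_def)
  then have "g * n ^ 2 / 8 * real (card X) \<le> g * n ^ 2 / 8 * (8 * \<rho> / g * n)"
    using 1 L(3) by (simp add: algebra_simps power2_eq_square power3_eq_cube)
  moreover have "0 < g * n ^ 2 / 8" using n L(3) by simp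
  ultimately show ?thesis by (simp only: mult_le_cancel_left_pos X_def n_def)
qed

text \<open>In the graph with arcs \<open>G\<close>, deleting the vertices of degree below
  \<open>h / 4 * n\<close> destroys at most half of the guaranteed arcs. A surviving arc becomes the
  middle edge, and both of its ends have many neighbours;
  \<open>h ^ 3 / 128 = h / 2 * (h / 8)^2\<close>.\<close>

lemma card_three_edge_paths:
  fixes h :: real
  assumes fin: "finite V" and G: "G \<subseteq> V \<times> V" "\<And>x y. (x, y) \<in> G \<Longrightarrow> (y, x) \<in> G" "\<And>x. (x, x) \<notin> G"
    and h: "h * real (card V) ^ 2 \<le> real (card G)" "0 < h" "16 \<le> h * real (card V)"
  shows "h ^ 3 / 128 * real (card V) ^ 4
    \<le> real (card {(p, q, r, w). (p, q) \<in> G \<and> (q, r) \<in> G \<and> (r, w) \<in> G \<and> distinct [p, q, r, w]})"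
proof -
  define n where "n = real (card V)"
  have hn: "16 \<le> h * n" using h(3) by (simp add: n_def)
  have n: "0 < n" using hn h(2) zero_less_mult_pos[of h n] by linarith
  have finG: "finite G" by (rule finite_subset[OF G(1)]) (use fin in simp)
  define N where "N = (\<lambda>q. {p. (q, p) \<in> G})"
  have NV: "N q \<subseteq> V" "finite (N q)" for q
    using G(1) fin by (auto simp: N_def intro: finite_subset[of _ V])
  define Low where "Low = {q \<in> V. real (card (N q)) < h / 4 * n}"
  define G' where "G' = {(q, r) \<in> G. q \<notin> Low \<and> r \<notin> Low}"
  have finG': "finite G'" by (rule finite_subset[OF _ finG]) (auto simp: G'_def)
  define B where "B = (SIGMA q:Low. N q)"
  have finB: "finite B" "finite Low" using fin NV by (auto simp: B_def Low_def)
  have "real (card B) = (\<Sum>q\<in>Low. real (card (N q)))" using finB NV by (simp add: B_def)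
  also have "\<dots> \<le> (\<Sum>q\<in>Low. h / 4 * n)" by (intro sum_mono) (auto simp: Low_def)
  also have "\<dots> = real (card Low) * (h / 4 * n)" by simp
  also have "\<dots> \<le> n * (h / 4 * n)"
    using n h(2) fin by (intro mult_right_mono) (auto simp: n_def Low_def intro!: card_mono)
  finally have Bc: "real (card B) \<le> h / 4 * n ^ 2" by (simp add: power2_eq_square mult.left_commute)
  have "G \<subseteq> G' \<union> B \<union> prod.swap ` B"
    using G by (force simp: G'_def B_def N_def)
  then have "card G \<le> card (G' \<union> B \<union> prod.swap ` B)"
    using finB finG' by (intro card_mono) auto
  also have "\<dots> \<le> card (G' \<union> B) + card (prod.swap ` B)" by (rule card_Un_le)
  also have "card (G' \<union> B) \<le> card G' + card B" by (rule card_Un_le)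
  also have "card (prod.swap ` B) \<le> card B" by (rule card_image_le[OF finB(1)])
  finally have "card G \<le> card G' + card B + card B" by simp
  then have G'c: "h / 2 * n ^ 2 \<le> real (card G')" using Bc h(1) by (simp add: n_def)
  define W where "W = (SIGMA e:G'. SIGMA p:N (fst e) - {snd e}. N (snd e) - {fst e, p})"
  \<comment> \<open>\<open>16 \<le> h * n\<close> makes the two excluded vertices cost at most half
    of the degree \<open>h / 4 * n\<close>.\<close>
  have hi: "h / 8 * n \<le> real (card (N q - {a, b}))" if "q \<notin> Low" "q \<in> V" for q a b
  proof -
    have "card (N q) - card {a, b} \<le> card (N q - {a, b})"
      by (rule diff_card_le_card_Diff) simp
    moreover have "card {a, b} \<le> 2" by (simp add: card_insert_if)
    ultimately have "real (card (N q)) - 2 \<le> real (card (N q - {a, b}))" by linarith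
    moreover have "h / 4 * n \<le> real (card (N q))" using that by (auto simp: Low_def)
    ultimately show ?thesis using hn by linarith
  qed
  have "h ^ 3 / 128 * n ^ 4 = h / 2 * n ^ 2 * ((h / 8 * n) * (h / 8 * n))"
    by (simp add: power2_eq_square power3_eq_cube power4_eq_xxxx)
  also have "\<dots> \<le> real (card G') * ((h / 8 * n) * (h / 8 * n))"
    using G'c by (intro mult_right_mono) auto
  also have "\<dots> = (\<Sum>e\<in>G'. (h / 8 * n) * (h / 8 * n))" by simp
  also have "\<dots> \<le> (\<Sum>e\<in>G'. real (card (SIGMA p:N (fst e) - {snd e}. N (snd e) - {fst e, p})))"
  proof (rule sum_mono)
    fix e assume e: "e \<in> G'"
    then have e': "fst e \<notin> Low" "snd e \<notin> Low" "fst e \<in> V" "snd e \<in> V" using G(1) by (auto simp: G'_def)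
    have "(h / 8 * n) * (h / 8 * n) \<le> real (card (N (fst e) - {snd e})) * (h / 8 * n)"
      using hi[OF e'(1,3), of "snd e" "snd e"] h(2) n by (intro mult_right_mono) auto
    also have "\<dots> = (\<Sum>p\<in>N (fst e) - {snd e}. h / 8 * n)" by simp
    also have "\<dots> \<le> (\<Sum>p\<in>N (fst e) - {snd e}. real (card (N (snd e) - {fst e, p})))"
      by (intro sum_mono hi e')
    also have "\<dots> = real (card (SIGMA p:N (fst e) - {snd e}. N (snd e) - {fst e, p}))"
      using NV by simp
    finally show "(h / 8 * n) * (h / 8 * n) \<le> real (card (SIGMA p:N (fst e) - {snd e}. N (snd e) - {fst e, p}))" .
  qed
  also have "\<dots> = real (card W)"
    unfolding W_def using finG' NV by (subst card_SigmaI) auto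
  also have "card W \<le> card {(p, q, r, w). (p, q) \<in> G \<and> (q, r) \<in> G \<and> (r, w) \<in> G \<and> distinct [p, q, r, w]}"
  proof (rule card_inj_on_le[where f = "\<lambda>((q, r), (p, w)). (p, q, r, w)"])
    show "inj_on (\<lambda>((q, r), (p, w)). (p, q, r, w)) W" by (auto simp: inj_on_def)
    show "(\<lambda>((q, r), (p, w)). (p, q, r, w)) ` W \<subseteq> {(p, q, r, w). (p, q) \<in> G \<and> (q, r) \<in> G \<and> (r, w) \<in> G \<and> distinct [p, q, r, w]}"
      using G(2,3) by (auto simp: W_def G'_def N_def)
    show "finite {(p, q, r, w). (p, q) \<in> G \<and> (q, r) \<in> G \<and> (r, w) \<in> G \<and> distinct [p, q, r, w]}"
      by (rule finite_subset[of _ "V \<times> V \<times> V \<times> V"]) (use G(1) fin in auto)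
  qed
  finally show ?thesis by (simp add: n_def)
qed

text \<open>From the common link, pairs that meet \<open>F\<close> and pairs that are not good in
  some direction are removed, each at most \<open>h / 4 * n^2\<close> in number. A symmetric graph
  of density \<open>h / 2\<close> remains, and the end pairs of its paths are good outwards.\<close>

lemma card_common_fitting_paths:
  assumes fin: "finite V" and dense: "vertex_pair_dense \<rho> d V E" "1/4 \<le> d"
    and E3: "\<forall>e\<in>E. card e = 3"
    and h: "h * real (card V) ^ 2 \<le> real (card (link V E s \<inter> link V E y))" "0 < h" "32 \<le> h * real (card V)"
    and F: "finite F" "real (card F) \<le> h / 8 * real (card V)" and \<rho>: "144 * \<rho> \<le> h / 4"
  shows "h ^ 3 / 1024 * real (card V) ^ 4 \<le> real (card {(p, q, r, w). fits E s p q r w \<and> fits E y p q r w \<and>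
      good (1/64) V E q p \<and> good (1/64) V E r w \<and> distinct [p, q, r, w] \<and> set [p, q, r, w] \<subseteq> V - F})"
proof -
  define n where "n = real (card V)"
  let ?g = "good (1/64) V E"
  let ?L = "link V E s \<inter> link V E y"
  define G where "G = {(p, q) \<in> ?L. p \<notin> F \<and> q \<notin> F \<and> ?g p q \<and> ?g q p}"
  have LV: "?L \<subseteq> V \<times> V" by (auto simp: link_def)
  have finL: "finite ?L" by (rule finite_subset[OF LV]) (use fin in simp)
  have GL: "G \<subseteq> ?L" by (auto simp: G_def)
  have GV: "G \<subseteq> V \<times> V" using GL LV by blast
  define B where "B = {(a, b) \<in> V \<times> V. \<not> ?g a b}"
  define B' where "B' = {(a, b) \<in> V \<times> V. \<not> ?g b a}"
  define C where "C = {(y, z) \<in> V \<times> V. y \<in> F \<or> z \<in> F}"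
  have finBC: "finite B" "finite B'" "finite C"
    using fin by (auto simp: B_def B'_def C_def intro: finite_subset[of _ "V \<times> V"])
  have Bc: "real (card B) \<le> 72 * \<rho> * n ^ 2"
    unfolding B_def n_def by (rule few_not_good[OF fin dense])
  have B'c: "card B' = card B" unfolding B_def B'_def by (rule card_pairs_swap)
  have Cc: "real (card C) \<le> 2 * real (card F) * n"
    unfolding C_def n_def by (rule card_pairs_touching[OF fin F(1)])
  have "?L \<subseteq> G \<union> B \<union> B' \<union> C" using LV by (auto simp: G_def B_def B'_def C_def)
  then have "card ?L \<le> card (G \<union> B \<union> B' \<union> C)"
    using finBC finite_subset[OF GL finL] by (intro card_mono) auto
  then have "card ?L \<le> card G + card B + card B' + card C"
    using card_Un_le[of "G \<union> B \<union> B'" C] card_Un_le[of "G \<union> B" B'] card_Un_le[of G B] by linarith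
  moreover have "2 * real (card F) * n \<le> h / 4 * n ^ 2"
    using mult_right_mono[OF F(2), of n] by (simp add: n_def power2_eq_square)
  moreover have "144 * \<rho> * n ^ 2 \<le> h / 4 * n ^ 2" using \<rho> by (intro mult_right_mono) auto
  ultimately have Gc: "h / 2 * n ^ 2 \<le> real (card G)"
    using Bc B'c Cc h(1) unfolding n_def[symmetric] by linarith
  have Gsym: "(y, x) \<in> G" if "(x, y) \<in> G" for x y
    using that by (auto simp: G_def link_def insert_commute)
  have Girr: "(x, x) \<notin> G" for x
  proof
    assume "(x, x) \<in> G"
    then have "{s, x, x} \<in> E" by (auto simp: G_def link_def)
    then have "card {s, x, x} = 3" using E3 by blast
    moreover have "card {s, x, x} \<le> 2" by (simp add: card_insert_if)
    ultimately show False by simp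
  qed
  let ?W = "{(p, q, r, w). (p, q) \<in> G \<and> (q, r) \<in> G \<and> (r, w) \<in> G \<and> distinct [p, q, r, w]}"
  let ?T = "{(p, q, r, w). fits E s p q r w \<and> fits E y p q r w \<and>
      ?g q p \<and> ?g r w \<and> distinct [p, q, r, w] \<and> set [p, q, r, w] \<subseteq> V - F}"
  have "(h / 2) ^ 3 / 128 * real (card V) ^ 4 \<le> real (card ?W)"
    by (rule card_three_edge_paths[OF fin GV Gsym Girr]) (use Gc h in \<open>auto simp: n_def\<close>)
  also have "card ?W \<le> card ?T"
  proof (rule card_mono)
    show "finite ?T" by (rule finite_subset[of _ "V \<times> V \<times> V \<times> V"]) (use fin in auto)
    show "?W \<subseteq> ?T" using LV by (auto simp: G_def fits_def link_def)
  qed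
  finally show ?thesis by (simp add: power_divide)
qed

lemma card_ge_imp_nonempty: "0 < c \<Longrightarrow> c \<le> real (card S) \<Longrightarrow> \<exists>x. x \<in> S"
  by (metis card.empty equals0I not_le of_nat_0)

text \<open>With \<open>y\<close> on the first path and \<open>t\<close> on the second, or
  \<open>s\<close> on the first and \<open>y\<close> on the second, the same vertices are covered,
  except that \<open>s\<close> replaces \<open>t\<close>.\<close>

definition exchange_paths ::
  "'a set \<Rightarrow> 'a set set \<Rightarrow> ('a \<Rightarrow> 'a \<Rightarrow> bool) \<Rightarrow> 'a set \<Rightarrow> 'a \<Rightarrow> 'a \<Rightarrow> bool" where
  "exchange_paths V E G F s t \<longleftrightarrow> (\<exists>y p q r w p' q' r' w'. distinct [y, p, q, r, w, p', q', r', w'] \<and>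
    set [y, p, q, r, w, p', q', r', w'] \<subseteq> V - F \<and>
    fits E s p q r w \<and> fits E y p q r w \<and> fits E t p' q' r' w' \<and> fits E y p' q' r' w' \<and>
    G q p \<and> G r w \<and> G q' p' \<and> G r' w')"

text \<open>At most a quarter of the vertices have a small common link with \<open>s\<close>, at
  most a quarter with \<open>t\<close>, and at most a quarter lie in \<open>F\<close>, so some
  \<open>y\<close> is left. The 640 makes room for the at most five vertices added to
  \<open>F\<close>; \<open>4608 = 144 * 32\<close> comes from the path count with
  \<open>h = g / 8\<close>.\<close>

lemma exchanging:
  assumes fin: "finite V" and dense: "vertex_pair_dense \<rho> d V E" "1/4 \<le> d"
    and E3: "\<forall>e\<in>E. card e = 3" and g: "0 < g" "g \<le> 1"
    and links: "g * real (card V) ^ 2 \<le> real (card (link V E s))" "g * real (card V) ^ 2 \<le> real (card (link V E t))"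
    and F: "finite F" "real (card F) \<le> g / 128 * real (card V)"
    and \<rho>: "\<rho> \<le> g / 4608" and n: "640 \<le> g * real (card V)"
  shows "exchange_paths V E (good (1/64) V E) F s t"
proof -
  define n where "n = real (card V)"
  have gn: "640 \<le> g * n" using n by (simp add: n_def)
  have n0: "0 < n" using gn g(1) zero_less_mult_pos[of g n] by linarith
  have Vne: "V \<noteq> {}" using n0 by (auto simp: n_def)
  let ?small = "\<lambda>x. {u \<in> V. real (card (link V E x \<inter> link V E u)) < g / 8 * real (card V) ^ 2}"
  have lV: "link V E x \<subseteq> V \<times> V" for x by (auto simp: link_def)
  have "8 * \<rho> / g * n \<le> 1/4 * n"
    using \<rho> g n0 by (intro mult_right_mono) (auto simp: field_simps)
  then have sm: "real (card (?small s)) \<le> 1/4 * n" "real (card (?small t)) \<le> 1/4 * n"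
    using few_small_common_links[OF fin Vne dense lV links(1) g(1)]
      few_small_common_links[OF fin Vne dense lV links(2) g(1)] by (auto simp: n_def)
  have "g / 128 * n \<le> 1/4 * n" using g n0 by (intro mult_right_mono) auto
  then have Fc: "real (card F) \<le> 1/4 * n" using F(2) by (simp add: n_def)
  have "card (?small s \<union> ?small t \<union> F) \<le> card (?small s) + card (?small t) + card F"
    using card_Un_le[of "?small s \<union> ?small t" F] card_Un_le[of "?small s" "?small t"] by linarith
  then have "real (card (?small s \<union> ?small t \<union> F)) < real (card V)"
    using sm Fc n0 unfolding n_def by linarith
  then have "\<not> V \<subseteq> ?small s \<union> ?small t \<union> F"
    using card_mono[of "?small s \<union> ?small t \<union> F" V] fin F(1) by auto
  then obtain y where "y \<in> V" "y \<notin> ?small s \<union> ?small t \<union> F" by blast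
  then have y: "y \<in> V" "y \<notin> F"
    "g / 8 * real (card V) ^ 2 \<le> real (card (link V E s \<inter> link V E y))"
    "g / 8 * real (card V) ^ 2 \<le> real (card (link V E t \<inter> link V E y))"
    by (auto simp: not_less)
  have pos: "0 < (g / 8) ^ 3 / 1024 * real (card V) ^ 4" using g(1) n0 by (simp add: n_def)
  have h: "0 < g / 8" "32 \<le> g / 8 * real (card V)" "144 * \<rho> \<le> g / 8 / 4" using g gn \<rho> by (auto simp: n_def)
  have sizes: "real (card F') \<le> g / 8 / 8 * real (card V)" if "card F' \<le> card F + 5" for F' :: "'a set"
    using that F(2) gn unfolding n_def by simp
  have F1: "finite (insert y F)" "card (insert y F) \<le> card F + 5" using F(1) by (auto simp: card_insert_if)
  obtain p q r w where 1: "fits E s p q r w" "fits E y p q r w" "good (1/64) V E q p" "good (1/64) V E r w"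
    "distinct [p, q, r, w]" "set [p, q, r, w] \<subseteq> V - insert y F"
    using card_ge_imp_nonempty[OF pos card_common_fitting_paths[OF fin dense E3 y(3) h(1,2) F1(1) sizes[OF F1(2)] h(3)]]
    by (elim exE) (auto intro!: that)
  have F2: "finite (F \<union> {y, p, q, r, w})" "card (F \<union> {y, p, q, r, w}) \<le> card F + 5"
    using F(1) card_Un_le[of F "{y, p, q, r, w}"] card_length[of "[y, p, q, r, w]"] by auto
  obtain p' q' r' w' where 2: "fits E t p' q' r' w'" "fits E y p' q' r' w'" "good (1/64) V E q' p'" "good (1/64) V E r' w'"
    "distinct [p', q', r', w']" "set [p', q', r', w'] \<subseteq> V - (F \<union> {y, p, q, r, w})"
    using card_ge_imp_nonempty[OF pos card_common_fitting_paths[OF fin dense E3 y(4) h(1,2) F2(1) sizes[OF F2(2)] h(3)]]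
    by (elim exE) (auto intro!: that)
  have "distinct [y, p, q, r, w, p', q', r', w']"
    using 1(5,6) 2(5,6) by auto
  moreover have "set [y, p, q, r, w, p', q', r', w'] \<subseteq> V - F"
    using 1(6) 2(6) y(1,2) by auto
  ultimately show ?thesis
    unfolding exchange_paths_def using 1(1-4) 2(1-4) by (intro exI conjI)
qed

text \<open>Walks \<open>p q u r w\<close> with a replaceable centre \<open>u\<close>. They do not
  refer to the vertex to be absorbed, so one family can serve all vertices.\<close>

definition gadgets :: "'a set \<Rightarrow> 'a set set \<Rightarrow> ('a \<times> 'a \<times> 'a \<times> 'a \<times> 'a) set" where
  "gadgets V E = {(u, p, q, r, w). fits E u p q r w \<and> good (1/64) V E q p \<and> good (1/64) V E r w \<and>
     distinct [u, p, q, r, w] \<and> set [u, p, q, r, w] \<subseteq> V}"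

definition fits_gadget :: "'a set set \<Rightarrow> 'a \<Rightarrow> 'a \<times> 'a \<times> 'a \<times> 'a \<times> 'a \<Rightarrow> bool" where
  "fits_gadget E v = (\<lambda>(u, p, q, r, w). fits E v p q r w)"

lemma fits_distinct:
  assumes "fits E v p q r w" "\<forall>e\<in>E. card e = 3"
  shows "v \<notin> {p, q, r, w}"
proof -
  have "card {v, p, q} = 3" "card {v, q, r} = 3" "card {v, r, w} = 3" using assms by (auto simp: fits_def)
  then show ?thesis by (auto simp: card_insert_if split: if_splits)
qed

text \<open>At least half of all vertices \<open>u\<close> have a dense common link with
  \<open>v\<close>, and each path counted there gives a gadget with centre \<open>u\<close>.\<close>

lemma card_fitting_gadgets:
  assumes fin: "finite V" and dense: "vertex_pair_dense \<rho> d V E" "1/4 \<le> d"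
    and E3: "\<forall>e\<in>E. card e = 3" and g: "0 < g" "g \<le> 1"
    and link: "g * real (card V) ^ 2 \<le> real (card (link V E v))"
    and \<rho>: "\<rho> \<le> g / 4608" and n: "640 \<le> g * real (card V)"
  shows "(g / 8) ^ 3 / 2048 * real (card V) ^ 5 \<le> real (card {x \<in> gadgets V E. fits_gadget E v x})"
proof -
  define n where "n = real (card V)"
  have gn: "640 \<le> g * n" using n by (simp add: n_def)
  have n0: "0 < n" using gn g(1) zero_less_mult_pos[of g n] by linarith
  have Vne: "V \<noteq> {}" using n0 by (auto simp: n_def)
  define X where "X = {u \<in> V. real (card (link V E v \<inter> link V E u)) < g / 8 * real (card V) ^ 2}"
  have lV: "link V E x \<subseteq> V \<times> V" for x by (auto simp: link_def)
  have "8 * \<rho> / g * n \<le> 1/2 * n"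
    using \<rho> g n0 by (intro mult_right_mono) (auto simp: field_simps)
  then have Xc: "real (card X) \<le> 1/2 * n"
    using few_small_common_links[OF fin Vne dense lV link g(1)] by (auto simp: n_def X_def)
  have XV: "X \<subseteq> V" "finite X" using fin by (auto simp: X_def)
  have "real (card (V - X)) = n - real (card X)"
    using XV fin by (simp add: card_Diff_subset of_nat_diff card_mono n_def)
  then have VX: "1/2 * n \<le> real (card (V - X))" using Xc by simp
  define T where "T = (\<lambda>u. {(p, q, r, w). fits E v p q r w \<and> fits E u p q r w \<and>
      good (1/64) V E q p \<and> good (1/64) V E r w \<and> distinct [p, q, r, w] \<and> set [p, q, r, w] \<subseteq> V - {}})"
  have finT: "finite (T u)" for u
    by (rule finite_subset[of _ "V \<times> V \<times> V \<times> V"]) (use fin in \<open>auto simp: T_def\<close>)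
  have Tc: "(g / 8) ^ 3 / 1024 * n ^ 4 \<le> real (card (T u))" if "u \<in> V - X" for u
    unfolding T_def n_def
    by (rule card_common_fitting_paths[OF fin dense E3]) (use that g gn \<rho> in \<open>auto simp: X_def n_def not_less\<close>)
  have "(g / 8) ^ 3 / 2048 * n ^ 5 = (1/2 * n) * ((g / 8) ^ 3 / 1024 * n ^ 4)"
    by (simp add: power_numeral_reduce)
  also have "\<dots> \<le> real (card (V - X)) * ((g / 8) ^ 3 / 1024 * n ^ 4)"
    using VX g n0 by (intro mult_right_mono) auto
  also have "\<dots> = (\<Sum>u\<in>V - X. (g / 8) ^ 3 / 1024 * n ^ 4)" by simp
  also have "\<dots> \<le> (\<Sum>u\<in>V - X. real (card (T u)))" by (intro sum_mono Tc)
  also have "\<dots> = real (card (SIGMA u:V - X. T u))" using fin finT by simp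
  also have "card (SIGMA u:V - X. T u) \<le> card {x \<in> gadgets V E. fits_gadget E v x}"
  proof (rule card_mono)
    show "finite {x \<in> gadgets V E. fits_gadget E v x}"
      by (rule finite_subset[of _ "V \<times> V \<times> V \<times> V \<times> V"]) (use fin in \<open>auto simp: gadgets_def\<close>)
    show "(SIGMA u:V - X. T u) \<subseteq> {x \<in> gadgets V E. fits_gadget E v x}"
    proof
      fix x assume "x \<in> (SIGMA u:V - X. T u)"
      then obtain u p q r w where x: "x = (u, p, q, r, w)" "u \<in> V" "(p, q, r, w) \<in> T u" by (cases x) auto
      then have "u \<notin> {p, q, r, w}" using fits_distinct[OF _ E3, of u p q r w] by (simp add: T_def)
      then show "x \<in> {x \<in> gadgets V E. fits_gadget E v x}"
        using x by (simp add: T_def gadgets_def fits_gadget_def)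
    qed
  qed
  finally show ?thesis by (simp add: n_def)
qed

section \<open>Absorbers\<close>

lemma tight_walk_overlap:
  "tight_walk E (xs @ [a, b]) \<Longrightarrow> tight_walk E ([a, b] @ ys) \<Longrightarrow> tight_walk E (xs @ [a, b] @ ys)"
  using tight_walk_append[of E xs a b ys] by simp

fun gadget_vertices :: "'a \<times> 'a \<times> 'a \<times> 'a \<times> 'a \<Rightarrow> 'a list" where
  "gadget_vertices (u, p, q, r, w) = [u, p, q, r, w]"

text \<open>\<open>K\<close> is the number of vertices that can be avoided and \<open>M\<close>
  bounds the length of a connection. All real estimates stay outside; inside, only sizes of
  forbidden sets are added up.\<close>

locale robustly_connected =
  fixes V :: "'a set" and E :: "'a set set" and G :: "'a \<Rightarrow> 'a \<Rightarrow> bool" and K M :: nat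
  assumes connect: "\<And>F a b c d. G a b \<Longrightarrow> G d c \<Longrightarrow> finite F \<Longrightarrow> card F \<le> K \<Longrightarrow>
      \<exists>m. tight_walk E ([a, b] @ m @ [c, d]) \<and> distinct m \<and> set m \<subseteq> V - F \<and> length m \<le> M"
    and exchange: "\<And>F s t. s \<in> V \<Longrightarrow> t \<in> V \<Longrightarrow> finite F \<Longrightarrow> card F \<le> K \<Longrightarrow> exchange_paths V E G F s t"
    and consecutive: "\<And>F. finite F \<Longrightarrow> card F \<le> K \<Longrightarrow> consecutive_walks V E G M F"
begin

text \<open>Each \<open>t\<close> is exchanged for the corresponding \<open>s\<close> via an intermediate vertex \<open>y\<close>, because the
  links of \<open>s\<close> and \<open>t\<close> may be disjoint.\<close>

lemma exchange_chain:
  assumes "length ss = length ts" "set ss \<subseteq> V" "set ts \<subseteq> V" "G a b" "finite F"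
    and "set ss \<union> set ts \<union> {a, b} \<subseteq> F" "card F + (2 * M + 9) * (length ss + 1) \<le> K"
  shows "\<exists>X X' N Y Y' c d. tight_walk E ([a, b] @ X) \<and> tight_walk E ([a, b] @ X') \<and>
    [a, b] @ X = Y @ [c, d] \<and> [a, b] @ X' = Y' @ [c, d] \<and> G c d \<and>
    mset X = mset N + mset ts \<and> mset X' = mset N + mset ss \<and>
    distinct N \<and> set N \<subseteq> V - F \<and> length N \<le> (2 * M + 9) * length ss"
  using assms
proof (induction ss ts arbitrary: a b F rule: list_induct2)
  case Nil
  then show ?case by (intro exI[of _ "[]"] exI[of _ a] exI[of _ b]) simp
next
  case (Cons s ss t ts)
  have st: "s \<in> V" "t \<in> V" using Cons.prems by auto
  have K0: "card F + (2 * M + 9) + (2 * M + 9) * (length ss + 1) \<le> K" using Cons.prems(6) by simp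
  have "exchange_paths V E G F s t" by (rule exchange[OF st \<open>finite F\<close>]) (use K0 in simp)
  then obtain y p q r w p' q' r' w' where ex: "distinct [y, p, q, r, w, p', q', r', w']"
    "set [y, p, q, r, w, p', q', r', w'] \<subseteq> V - F"
    "fits E s p q r w" "fits E y p q r w" "fits E t p' q' r' w'" "fits E y p' q' r' w'"
    "G q p" "G r w" "G q' p'" "G r' w'"
    unfolding exchange_paths_def by (elim exE conjE) (rule that)
  define F1 where "F1 = F \<union> set [y, p, q, r, w, p', q', r', w']"
  have F1: "finite F1" "card F1 \<le> card F + 9"
    using Cons.prems(4) card_Un_le[of F "set [y, p, q, r, w, p', q', r', w']"]
      card_length[of "[y, p, q, r, w, p', q', r', w']"] by (auto simp: F1_def)
  have "card F1 \<le> K" using F1(2) K0 by simp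
  then obtain m where m: "tight_walk E ([a, b] @ m @ [p, q])" "distinct m" "set m \<subseteq> V - F1" "length m \<le> M"
    using connect[OF Cons.prems(3) ex(7) F1(1)] by blast
  define F2 where "F2 = F1 \<union> set m"
  have F2: "finite F2" "card F2 \<le> card F + 9 + M"
    using F1 card_Un_le[of F1 "set m"] card_length[of m] m(4) by (auto simp: F2_def)
  have "card F2 \<le> K" using F2(2) K0 by simp
  then obtain m' where m': "tight_walk E ([r, w] @ m' @ [p', q'])" "distinct m'" "set m' \<subseteq> V - F2" "length m' \<le> M"
    using connect[OF ex(8,9) F2(1)] by blast
  \<comment> \<open>\<open>y\<close> occurs in both versions and so counts as common; with eight
    path vertices and two connections this makes \<open>2 * M + 9\<close>.\<close>
  define N1 where "N1 = m @ [p, q, y, r, w] @ m' @ [p', q', r', w']"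
  have N1: "distinct N1" "set N1 \<subseteq> V - F" "length N1 \<le> 2 * M + 9"
    using ex(1,2) m(2-4) m'(2-4) by (auto simp: N1_def F1_def F2_def)
  define F3 where "F3 = F \<union> set N1"
  have F3: "finite F3" "card F3 \<le> card F + (2 * M + 9)"
    using Cons.prems(4) card_Un_le[of F "set N1"] card_length[of N1] N1(3) by (auto simp: F3_def)
  have IH: "\<exists>X X' N Y Y' c d. tight_walk E ([r', w'] @ X) \<and> tight_walk E ([r', w'] @ X') \<and>
    [r', w'] @ X = Y @ [c, d] \<and> [r', w'] @ X' = Y' @ [c, d] \<and> G c d \<and>
    mset X = mset N + mset ts \<and> mset X' = mset N + mset ss \<and>
    distinct N \<and> set N \<subseteq> V - F3 \<and> length N \<le> (2 * M + 9) * length ss"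
  proof (rule Cons.IH)
    show "set ss \<union> set ts \<union> {r', w'} \<subseteq> F3" using Cons.prems(5) by (auto simp: F3_def N1_def)
    show "card F3 + (2 * M + 9) * (length ss + 1) \<le> K" using F3(2) K0 by simp
  qed (use Cons.prems ex F3 in auto)
  then obtain X X' N Y Y' c d where X: "tight_walk E ([r', w'] @ X)" "tight_walk E ([r', w'] @ X')"
    "[r', w'] @ X = Y @ [c, d]" "[r', w'] @ X' = Y' @ [c, d]" "G c d"
    "mset X = mset N + mset ts" "mset X' = mset N + mset ss"
    "distinct N" "set N \<subseteq> V - F3" "length N \<le> (2 * M + 9) * length ss"
    by (elim exE conjE) (rule that)
  have walk: "tight_walk E ([a, b] @ m @ [p, q, e, r, w] @ m' @ [p', q', f, r', w'] @ Z)"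
    if "fits E e p q r w" "fits E f p' q' r' w'" "tight_walk E ([r', w'] @ Z)" for e f Z
  proof -
    have "tight_walk E ([p', q', f] @ [r', w'] @ Z)"
      by (rule tight_walk_overlap) (use fits_tight_walk[OF that(2)] that(3) in auto)
    then have "tight_walk E (([r, w] @ m') @ [p', q'] @ [f, r', w'] @ Z)"
      by (intro tight_walk_overlap) (use m'(1) in auto)
    then have "tight_walk E ([p, q, e] @ [r, w] @ m' @ [p', q', f, r', w'] @ Z)"
      by (intro tight_walk_overlap) (use fits_tight_walk[OF that(1)] in auto)
    then have "tight_walk E (([a, b] @ m) @ [p, q] @ [e, r, w] @ m' @ [p', q', f, r', w'] @ Z)"
      by (intro tight_walk_overlap) (use m(1) in auto)
    then show ?thesis by simp
  qed
  \<comment> \<open>\<open>X\<close> hosts the list \<open>ts\<close>, \<open>X'\<close> the list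
    \<open>ss\<close>: \<open>y\<close> moves from the path of \<open>s\<close> to the path of
    \<open>t\<close>.\<close>
  let ?X = "m @ [p, q, y, r, w] @ m' @ [p', q', t, r', w'] @ X"
  let ?X' = "m @ [p, q, s, r, w] @ m' @ [p', q', y, r', w'] @ X'"
  let ?Y = "[a, b] @ m @ [p, q, y, r, w] @ m' @ [p', q', t] @ Y"
  let ?Y' = "[a, b] @ m @ [p, q, s, r, w] @ m' @ [p', q', y] @ Y'"
  have "tight_walk E ([a, b] @ ?X)" "tight_walk E ([a, b] @ ?X')"
    using walk[OF ex(4,5) X(1)] walk[OF ex(3,6) X(2)] by auto
  moreover have "[a, b] @ ?X = ?Y @ [c, d]" "[a, b] @ ?X' = ?Y' @ [c, d]"
    using X(3,4) by auto
  moreover have "mset ?X = mset (N1 @ N) + mset (t # ts)" "mset ?X' = mset (N1 @ N) + mset (s # ss)"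
    using X(6,7) by (auto simp: N1_def)
  moreover have "distinct (N1 @ N)" "set (N1 @ N) \<subseteq> V - F"
    using N1 X(8,9) by (auto simp: F3_def)
  moreover have "length (N1 @ N) \<le> (2 * M + 9) * length (s # ss)" using N1(3) X(10) by simp
  ultimately show ?case using X(5) by (intro exI conjI)
qed

text \<open>\<open>2 * M + 9\<close> for each of at most \<open>M + 1\<close> exchanges, plus the
  two base walks and their end pairs, rounded up to a product that also bounds the room needed in
  \<open>K\<close>.\<close>

definition absorber_length :: nat where
  "absorber_length = (2 * M + 12) * (M + 3)"

text \<open>The walks \<open>S\<close> and \<open>T\<close> of consecutive lengths leave room for exactly one more vertex: free the
  vertices of \<open>T\<close> by putting \<open>u\<close> and the vertices of \<open>S\<close> in their places.\<close>

lemma absorber: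
  assumes u: "u \<in> V" and F: "finite F" "card F + absorber_length \<le> K"
  shows "\<exists>a b c d N N'. tight_walk E ([a, b] @ N @ [c, d]) \<and> tight_walk E ([a, b] @ N' @ [c, d]) \<and>
    mset N' = mset N + {#u#} \<and> distinct ([a, b] @ N @ [c, d]) \<and> set ([a, b] @ N @ [c, d]) \<subseteq> V - insert u F \<and>
    G b a \<and> G c d \<and> length N \<le> absorber_length"
proof -
  have K: "card F + (2 * M + 12) * (M + 3) \<le> K" using F(2) by (simp add: absorber_length_def)
  have F0: "finite (insert u F)" "card (insert u F) \<le> card F + 1" using F(1) by (auto simp: card_insert_if)
  have "1 \<le> (2 * M + 12) * (M + 3)" by (simp add: algebra_simps)
  then have "card (insert u F) \<le> K" using F0(2) K by linarith
  then have "consecutive_walks V E G M (insert u F)" by (rule consecutive[OF F0(1)])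
  then obtain a b c d S T where base: "tight_walk E ([a, b] @ S @ [c, d])" "tight_walk E ([a, b] @ T @ [c, d])"
    "length T = Suc (length S)" "distinct ([a, b, c, d] @ S @ T)" "set ([a, b, c, d] @ S @ T) \<subseteq> V - insert u F"
    "length S \<le> M" "G b a" "G c d"
    unfolding consecutive_walks_def by (elim exE conjE) (rule that)
  define F1 where "F1 = insert u F \<union> set ([a, b, c, d] @ S @ T)"
  have "card F1 \<le> card F + 1 + (4 + (M + (M + 1)))"
    using F0(2) card_Un_le[of "insert u F" "set ([a, b, c, d] @ S @ T)"] card_length[of "[a, b, c, d] @ S @ T"] base(3,6)
    by (simp add: F1_def)
  moreover have "(2 * M + 9) * (length (u # S) + 1) \<le> (2 * M + 9) * (M + 2)" using base(6) by (intro mult_le_mono2) simp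
  ultimately have F1K: "card F1 + (2 * M + 9) * (length (u # S) + 1) \<le> K" using K by (simp add: algebra_simps)
  have "finite F1" using F(1) by (simp add: F1_def)
  \<comment> \<open>\<open>u # S\<close> and \<open>T\<close> have equal length. The walk through
    \<open>S\<close> continues with \<open>X\<close>, which hosts \<open>T\<close>; the walk through
    \<open>T\<close> continues with \<open>X'\<close>, which hosts \<open>u\<close> and
    \<open>S\<close>.\<close>
  have "\<exists>X X' N Y Y' c' d'. tight_walk E ([c, d] @ X) \<and> tight_walk E ([c, d] @ X') \<and>
    [c, d] @ X = Y @ [c', d'] \<and> [c, d] @ X' = Y' @ [c', d'] \<and> G c' d' \<and>
    mset X = mset N + mset T \<and> mset X' = mset N + mset (u # S) \<and>
    distinct N \<and> set N \<subseteq> V - F1 \<and> length N \<le> (2 * M + 9) * length (u # S)"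
    by (rule exchange_chain[OF _ _ _ base(8) \<open>finite F1\<close> _ F1K]) (use base(3,5) u in \<open>auto simp: F1_def\<close>)
  then obtain X X' N Y Y' c' d' where X: "tight_walk E ([c, d] @ X)" "tight_walk E ([c, d] @ X')"
    "[c, d] @ X = Y @ [c', d']" "[c, d] @ X' = Y' @ [c', d']" "G c' d'"
    "mset X = mset N + mset T" "mset X' = mset N + mset (u # S)"
    "distinct N" "set N \<subseteq> V - F1" "length N \<le> (2 * M + 9) * length (u # S)"
    by (elim exE conjE) (rule that)
  have "tight_walk E (([a, b] @ S) @ [c, d] @ X)" "tight_walk E (([a, b] @ T) @ [c, d] @ X')"
    by (rule tight_walk_overlap; use base X in simp)+
  then have w: "tight_walk E ([a, b] @ (S @ Y) @ [c', d'])" "tight_walk E ([a, b] @ (T @ Y') @ [c', d'])"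
    using X(3,4) by simp_all
  \<comment> \<open>\<open>Y\<close> is the continued walk without its last two vertices,
    \<open>X\<close> the same walk without its first two; multisets absorb the shift.\<close>
  have mY: "mset Y + {#c', d'#} = {#c, d#} + mset X" "mset Y' + {#c', d'#} = {#c, d#} + mset X'"
    using arg_cong[OF X(3), of mset] arg_cong[OF X(4), of mset] by (simp_all add: add_mset_commute)
  have "mset (T @ Y') + {#c', d'#} = mset T + ({#c, d#} + mset X')"
    using mY(2) by (simp only: mset_append add.assoc)
  also have "\<dots> = mset S + ({#c, d#} + mset X) + {#u#}"
    unfolding X(6,7) by simp
  also have "\<dots> = mset (S @ Y) + {#u#} + {#c', d'#}"
    unfolding mY(1)[symmetric] by simp
  finally have "mset (T @ Y') + {#c', d'#} = mset (S @ Y) + {#u#} + {#c', d'#}" .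
  then have mm: "mset (T @ Y') = mset (S @ Y) + {#u#}" by simp
  have ms: "mset ([a, b] @ (S @ Y) @ [c', d']) = mset ([a, b, c, d] @ S @ T @ N)"
    using mY(1) X(6) by (simp add: ac_simps)
  have "distinct ([a, b, c, d] @ S @ T @ N)" using base(4) X(8,9) by (auto simp: F1_def)
  then have dist: "distinct ([a, b] @ (S @ Y) @ [c', d'])"
    using mset_eq_imp_distinct_iff[OF ms] by blast
  have "set ([a, b] @ (S @ Y) @ [c', d']) = set ([a, b, c, d] @ S @ T @ N)" by (rule mset_eq_setD[OF ms])
  then have sub: "set ([a, b] @ (S @ Y) @ [c', d']) \<subseteq> V - insert u F"
    using base(5) X(9) unfolding F1_def by auto
  have "length N \<le> (2 * M + 9) * (M + 1)"
    by (rule order.trans[OF X(10) mult_le_mono2]) (use base(6) in simp)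
  moreover have "length ([a, b] @ (S @ Y) @ [c', d']) = length ([a, b, c, d] @ S @ T @ N)"
    by (rule mset_eq_length[OF ms])
  ultimately have "length (S @ Y) \<le> absorber_length"
    using base(3,6) by (simp add: absorber_length_def algebra_simps)
  then show ?thesis using w mm dist sub base(7) X(5) by (intro exI conjI)
qed

text \<open>Five gadget vertices, the absorber of the centre with its four end vertices, and two
  connections.\<close>

definition item_length :: nat where
  "item_length = absorber_length + 2 * M + 9"

text \<open>Each gadget is followed by an absorber for its centre \<open>u\<close>: if
  \<open>v\<close> replaces \<open>u\<close>, the absorber switches to the version that covers
  \<open>u\<close>. Choices at different gadgets do not interact; \<open>None\<close> means no
  replacement. The rest of the walk is built with the current gadget already forbidden, so no
  connection meets a gadget. Multisets leave the distinctness of the enlarged walk to the place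
  where the absorbed vertices are known to be new.\<close>

lemma absorbing_walk:
  assumes "set gs \<subseteq> gadgets V E" "distinct (concat (map gadget_vertices gs))"
    and G_eq: "G = good (1/64) V E"
    and "finite F" "F \<inter> set (concat (map gadget_vertices gs)) = {}"
    and "card F + item_length * (2 * length gs + 2) \<le> K"
  shows "\<exists>a b c d N. tight_walk E ([a, b] @ N @ [c, d]) \<and> distinct ([a, b] @ N @ [c, d]) \<and>
    set ([a, b] @ N @ [c, d]) \<subseteq> V - F \<and> G b a \<and> G c d \<and> length N + 4 \<le> item_length * (length gs + 1) \<and>
    (\<forall>os. list_all2 (\<lambda>g o'. \<forall>v. o' = Some v \<longrightarrow> fits_gadget E v g) gs os \<longrightarrow>
      (\<exists>N'. tight_walk E ([a, b] @ N' @ [c, d]) \<and> mset N' = mset N + mset (List.map_filter id os)))"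
  using assms(1,2,4-)
proof (induction gs arbitrary: F)
  case Nil
  \<comment> \<open>The shorter of the two walks serves as the last piece of the
    construction.\<close>
  then have "consecutive_walks V E G M F" by (intro consecutive) auto
  then obtain a b c d S T where base: "tight_walk E ([a, b] @ S @ [c, d])" "tight_walk E ([a, b] @ T @ [c, d])"
    "length T = Suc (length S)" "distinct ([a, b, c, d] @ S @ T)" "set ([a, b, c, d] @ S @ T) \<subseteq> V - F"
    "length S \<le> M" "G b a" "G c d"
    unfolding consecutive_walks_def by (elim exE conjE) (rule that)
  have "length S + 4 \<le> item_length" using base(6) by (simp add: item_length_def)
  then have "length S + 4 \<le> item_length * (length ([] :: ('a \<times> 'a \<times> 'a \<times> 'a \<times> 'a) list) + 1)" by simp
  moreover have "\<forall>os. list_all2 (\<lambda>g o'. \<forall>v. o' = Some v \<longrightarrow> fits_gadget E v g) [] os \<longrightarrow>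
      (\<exists>N'. tight_walk E ([a, b] @ N' @ [c, d]) \<and> mset N' = mset S + mset (List.map_filter id os))"
    using base(1) by (intro allI impI exI[of _ S]) (simp add: map_filter_simps)
  moreover have "distinct ([a, b] @ S @ [c, d])" "set ([a, b] @ S @ [c, d]) \<subseteq> V - F"
    using base(4,5) by auto
  ultimately show ?case using base(1,7,8) by (intro exI conjI)
next
  case (Cons g gs)
  obtain u p q r w where g: "g = (u, p, q, r, w)" by (cases g) auto
  have gad: "fits E u p q r w" "G q p" "G r w" "distinct [u, p, q, r, w]" "set [u, p, q, r, w] \<subseteq> V"
    using Cons.prems(1) by (auto simp: g gadgets_def G_eq)
  \<comment> \<open>The room grows by \<open>2 * item_length\<close> per gadget: its vertices are
    forbidden to the rest of the walk, and that rest is forbidden to the new item.\<close>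
  have K0: "card F + item_length * (2 * length gs + 2) + 2 * item_length \<le> K" using Cons.prems(5) by simp
  have big: "absorber_length + 2 * M + 9 = item_length" by (simp add: item_length_def)
  define F1 where "F1 = F \<union> set [u, p, q, r, w]"
  have F1: "finite F1" "card F1 \<le> card F + 5"
    using Cons.prems(3) card_Un_le[of F "set [u, p, q, r, w]"] card_length[of "[u, p, q, r, w]"]
    by (auto simp: F1_def)
  have "\<exists>a b c d N. tight_walk E ([a, b] @ N @ [c, d]) \<and> distinct ([a, b] @ N @ [c, d]) \<and>
    set ([a, b] @ N @ [c, d]) \<subseteq> V - F1 \<and> G b a \<and> G c d \<and> length N + 4 \<le> item_length * (length gs + 1) \<and>
    (\<forall>os. list_all2 (\<lambda>g o'. \<forall>v. o' = Some v \<longrightarrow> fits_gadget E v g) gs os \<longrightarrow>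
      (\<exists>N'. tight_walk E ([a, b] @ N' @ [c, d]) \<and> mset N' = mset N + mset (List.map_filter id os)))"
  proof (rule Cons.IH)
    show "F1 \<inter> set (concat (map gadget_vertices gs)) = {}"
      using Cons.prems(2,4) by (auto simp: F1_def g)
    show "card F1 + item_length * (2 * length gs + 2) \<le> K" using F1(2) K0 big by simp
  qed (use Cons.prems F1 in auto)
  then obtain a b c d N where A: "tight_walk E ([a, b] @ N @ [c, d])" "distinct ([a, b] @ N @ [c, d])"
    "set ([a, b] @ N @ [c, d]) \<subseteq> V - F1" "G b a" "G c d" "length N + 4 \<le> item_length * (length gs + 1)"
    "\<forall>os. list_all2 (\<lambda>g o'. \<forall>v. o' = Some v \<longrightarrow> fits_gadget E v g) gs os \<longrightarrow>
      (\<exists>N'. tight_walk E ([a, b] @ N' @ [c, d]) \<and> mset N' = mset N + mset (List.map_filter id os))"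
    by (elim exE conjE) (rule that)
  define F2 where "F2 = F1 \<union> set ([a, b] @ N @ [c, d])"
  have F2: "finite F2" "card F2 \<le> card F + 5 + item_length * (length gs + 1)"
    using F1 card_Un_le[of F1 "set ([a, b] @ N @ [c, d])"] card_length[of "[a, b] @ N @ [c, d]"] A(6)
    by (auto simp: F2_def)
  have K2: "card F2 + (absorber_length + 2 * M + 4) \<le> K" using F2(2) K0 big by simp
  have "u \<in> V" using gad(5) by simp
  have "card F2 + absorber_length \<le> K" using K2 by simp
  then obtain a1 b1 c1 d1 N1 N1' where Q: "tight_walk E ([a1, b1] @ N1 @ [c1, d1])" "tight_walk E ([a1, b1] @ N1' @ [c1, d1])"
    "mset N1' = mset N1 + {#u#}" "distinct ([a1, b1] @ N1 @ [c1, d1])" "set ([a1, b1] @ N1 @ [c1, d1]) \<subseteq> V - insert u F2"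
    "G b1 a1" "G c1 d1" "length N1 \<le> absorber_length"
    by (elim absorber[OF \<open>u \<in> V\<close> F2(1), elim_format] exE conjE) (rule that)
  define F3 where "F3 = F2 \<union> set ([a1, b1] @ N1 @ [c1, d1])"
  have F3: "finite F3" "card F3 \<le> card F2 + (absorber_length + 4)"
    using F2 card_Un_le[of F2 "set ([a1, b1] @ N1 @ [c1, d1])"] card_length[of "[a1, b1] @ N1 @ [c1, d1]"] Q(8)
    by (auto simp: F3_def)
  have "card F3 \<le> K" using F3(2) K2 by simp
  then obtain m where m: "tight_walk E ([r, w] @ m @ [a1, b1])" "distinct m" "set m \<subseteq> V - F3" "length m \<le> M"
    using connect[OF gad(3) Q(6) F3(1)] by blast
  define F4 where "F4 = F3 \<union> set m"
  have F4: "finite F4" "card F4 \<le> card F3 + M"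
    using F3 card_Un_le[of F3 "set m"] card_length[of m] m(4) by (auto simp: F4_def)
  have "card F4 \<le> K" using F4(2) F3(2) K2 by simp
  then obtain m2 where m2: "tight_walk E ([c1, d1] @ m2 @ [a, b])" "distinct m2" "set m2 \<subseteq> V - F4" "length m2 \<le> M"
    using connect[OF Q(7) A(4) F4(1)] by blast
  have walk: "tight_walk E ([p, q] @ ([e, r, w] @ m @ [a1, b1] @ J @ [c1, d1] @ m2 @ [a, b] @ L) @ [c, d])"
    if "fits E e p q r w" "tight_walk E ([a1, b1] @ J @ [c1, d1])" "tight_walk E ([a, b] @ L @ [c, d])" for e J L
  proof -
    have "tight_walk E (([c1, d1] @ m2) @ [a, b] @ L @ [c, d])"
      by (rule tight_walk_overlap) (use m2(1) that(3) in auto)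
    then have "tight_walk E (([a1, b1] @ J) @ [c1, d1] @ m2 @ [a, b] @ L @ [c, d])"
      by (intro tight_walk_overlap) (use that(2) in auto)
    then have "tight_walk E (([r, w] @ m) @ [a1, b1] @ J @ [c1, d1] @ m2 @ [a, b] @ L @ [c, d])"
      by (intro tight_walk_overlap) (use m(1) in auto)
    then have "tight_walk E ([p, q, e] @ [r, w] @ m @ [a1, b1] @ J @ [c1, d1] @ m2 @ [a, b] @ L @ [c, d])"
      by (intro tight_walk_overlap) (use fits_tight_walk[OF that(1)] in auto)
    then show ?thesis by simp
  qed
  let ?N = "[u, r, w] @ m @ [a1, b1] @ N1 @ [c1, d1] @ m2 @ [a, b] @ N"
  have "tight_walk E ([p, q] @ ?N @ [c, d])" by (rule walk[OF gad(1) Q(1) A(1)])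
  moreover have "distinct ([p, q] @ ?N @ [c, d])"
    using gad(4) A(2,3) Q(4,5) m(2,3) m2(2,3) by (auto simp: F1_def F2_def F3_def F4_def)
  moreover have "set ([p, q] @ ?N @ [c, d]) \<subseteq> V - F"
    using gad(5) A(3) Q(5) m(3) m2(3) Cons.prems(4) by (auto simp: F1_def F2_def F3_def F4_def g)
  moreover have "length ?N + 4 \<le> item_length * (length (g # gs) + 1)"
    using A(6) Q(8) m(4) m2(4) big by simp
  moreover have "\<forall>os. list_all2 (\<lambda>g o'. \<forall>v. o' = Some v \<longrightarrow> fits_gadget E v g) (g # gs) os \<longrightarrow>
      (\<exists>N'. tight_walk E ([p, q] @ N' @ [c, d]) \<and> mset N' = mset ?N + mset (List.map_filter id os))"
  proof (intro allI impI)
    fix os assume os: "list_all2 (\<lambda>g o'. \<forall>v. o' = Some v \<longrightarrow> fits_gadget E v g) (g # gs) os"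
    obtain o' os' where o: "os = o' # os'" "\<forall>v. o' = Some v \<longrightarrow> fits_gadget E v g"
      "list_all2 (\<lambda>g o'. \<forall>v. o' = Some v \<longrightarrow> fits_gadget E v g) gs os'"
      using os by (auto simp: list_all2_Cons1)
    obtain N' where N': "tight_walk E ([a, b] @ N' @ [c, d])" "mset N' = mset N + mset (List.map_filter id os')"
      using A(7)[rule_format, OF o(3)] by blast
    show "\<exists>N'. tight_walk E ([p, q] @ N' @ [c, d]) \<and> mset N' = mset ?N + mset (List.map_filter id os)"
    proof (cases o')
      case None
      show ?thesis
        using walk[OF gad(1) Q(1) N'(1)] N'(2) None o(1)
        by (intro exI[of _ "[u, r, w] @ m @ [a1, b1] @ N1 @ [c1, d1] @ m2 @ [a, b] @ N'"])
          (simp add: map_filter_simps)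
    next
      case (Some v)
      then have "fits E v p q r w" using o(2) by (simp add: g fits_gadget_def)
      from walk[OF this Q(2) N'(1)] show ?thesis
        using N'(2) Q(3) Some o(1)
        by (intro exI[of _ "[v, r, w] @ m @ [a1, b1] @ N1' @ [c1, d1] @ m2 @ [a, b] @ N'"])
          (simp add: map_filter_simps)
    qed
  qed
  ultimately show ?case using gad(2) A(5) by (intro exI conjI)
qed

end

section \<open>The absorbing path\<close>

lemma exists_le_average:
  fixes f :: "'a \<Rightarrow> real"
  assumes "finite A" "A \<noteq> {}" "(\<Sum>x\<in>A. f x) \<le> real (card A) * c"
  shows "\<exists>x\<in>A. f x \<le> c"
proof (rule ccontr)
  assume "\<not> ?thesis"
  then have "(\<Sum>x\<in>A. c) < (\<Sum>x\<in>A. f x)"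
    using assms(1,2) by (intro sum_strict_mono) (auto simp: not_le)
  then show False using assms(3) by simp
qed

text \<open>The method of conditional expectations: choosing the members of the family one at a time, the
  potential \<open>\<Sum>v. 2 ^ - (number of chosen members fitting v)\<close> can be made to
  decrease geometrically.\<close>

lemma fitting_family:
  fixes verts :: "'g \<Rightarrow> 'a list" and \<beta> :: real
  assumes fin: "finite V" "V \<noteq> {}" "finite \<G>" and \<beta>: "0 < \<beta>" "\<beta> \<le> 1"
    and len: "\<And>g. g \<in> \<G> \<Longrightarrow> length (verts g) = 5 \<and> distinct (verts g) \<and> set (verts g) \<subseteq> V"
    and cG: "real (card \<G>) \<le> real (card V) ^ 5"
    and through: "\<And>x. x \<in> V \<Longrightarrow> real (card {g \<in> \<G>. x \<in> set (verts g)}) \<le> 5 * real (card V) ^ 4"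
    and many: "\<And>v. v \<in> V \<Longrightarrow> \<beta> * real (card V) ^ 5 \<le> real (card {g \<in> \<G>. fit v g})"
    and k: "25 * real k \<le> \<beta> / 2 * real (card V)"
  shows "\<exists>gs. length gs = k \<and> set gs \<subseteq> \<G> \<and> distinct (concat (map verts gs)) \<and>
    (\<Sum>v\<in>V. (1/2) ^ length (filter (fit v) gs)) \<le> real (card V) * (1 - \<beta> / 4) ^ k"
  using k
proof (induction k)
  case 0
  then show ?case by (intro exI[of _ "[]"]) simp
next
  case (Suc k)
  define n where "n = real (card V)"
  have n: "n > 0" using fin by (simp add: n_def card_gt_0_iff)
  have kn: "25 * real k \<le> \<beta> / 2 * n" using Suc.prems by (simp add: n_def)
  then obtain gs where gs: "length gs = k" "set gs \<subseteq> \<G>" "distinct (concat (map verts gs))"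
    "(\<Sum>v\<in>V. (1/2) ^ length (filter (fit v) gs)) \<le> n * (1 - \<beta> / 4) ^ k"
    using Suc.IH by (auto simp: n_def)
  define used where "used = set (concat (map verts gs))"
  define wt where "wt = (\<lambda>v. (1/2 :: real) ^ length (filter (fit v) gs))"
  have wt0: "0 \<le> wt v" for v by (simp add: wt_def)
  have usedV: "used \<subseteq> V" "finite used" using gs(2) len by (auto simp: used_def)
  have "length (concat (map verts xs)) = 5 * length xs" if "set xs \<subseteq> \<G>" for xs
    using that len by (induction xs) auto
  then have "length (concat (map verts gs)) = 5 * k" using gs(1,2) by simp
  then have cu: "card used \<le> 5 * k" unfolding used_def using card_length[of "concat (map verts gs)"] by simp
  \<comment> \<open>At most \<open>5 * k\<close> vertices are used, with at most
    \<open>5 * n^4\<close> candidates through each. The bound on \<open>25 * k\<close> leaves at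
    least half of the \<open>\<beta> * n^5\<close> fitting candidates guaranteed for each
    vertex.\<close>
  define Bad where "Bad = {g \<in> \<G>. set (verts g) \<inter> used \<noteq> {}}"
  define Av where "Av = \<G> - Bad"
  have finB: "finite Bad" "finite Av" using fin by (auto simp: Bad_def Av_def)
  have "Bad = (\<Union>x\<in>used. {g \<in> \<G>. x \<in> set (verts g)})" by (auto simp: Bad_def)
  then have "card Bad \<le> (\<Sum>x\<in>used. card {g \<in> \<G>. x \<in> set (verts g)})"
    using card_UN_le[OF usedV(2)] by simp
  then have "real (card Bad) \<le> (\<Sum>x\<in>used. real (card {g \<in> \<G>. x \<in> set (verts g)}))"
    unfolding of_nat_sum[symmetric] of_nat_le_iff .
  also have "\<dots> \<le> (\<Sum>x\<in>used. 5 * n ^ 4)"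
    unfolding n_def using usedV by (intro sum_mono through) auto
  also have "\<dots> = real (card used) * (5 * n ^ 4)" by simp
  also have "\<dots> \<le> (5 * real k) * (5 * n ^ 4)"
    using cu n by (intro mult_right_mono) (auto simp flip: of_nat_mult)
  also have "\<dots> = (25 * real k) * n ^ 4" by simp
  also have "\<dots> \<le> (\<beta> / 2 * n) * n ^ 4" using kn n by (intro mult_right_mono) auto
  finally have Bc: "real (card Bad) \<le> \<beta> / 2 * n ^ 5" by (simp add: power_numeral_reduce)
  have Avfit: "\<beta> / 2 * n ^ 5 \<le> real (card {g \<in> Av. fit v g})" if v: "v \<in> V" for v
  proof -
    have "{g \<in> \<G>. fit v g} \<subseteq> {g \<in> Av. fit v g} \<union> Bad" by (auto simp: Av_def)
    then have "card {g \<in> \<G>. fit v g} \<le> card ({g \<in> Av. fit v g} \<union> Bad)"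
      using finB by (intro card_mono) auto
    then have "card {g \<in> \<G>. fit v g} \<le> card {g \<in> Av. fit v g} + card Bad"
      using card_Un_le[of "{g \<in> Av. fit v g}" Bad] by linarith
    then show ?thesis using many[OF v] Bc unfolding n_def[symmetric] by linarith
  qed
  obtain v0 where v0: "v0 \<in> V" using fin(2) by auto
  have "0 < \<beta> / 2 * n ^ 5" using \<beta> n by simp
  then have "0 < real (card {g \<in> Av. fit v0 g})" using Avfit[OF v0] by linarith
  then have "{g \<in> Av. fit v0 g} \<noteq> {}" by (metis card.empty less_irrefl of_nat_0)
  then have Avne: "Av \<noteq> {}" by auto
  have "card Av \<le> card \<G>" using fin by (intro card_mono) (auto simp: Av_def)
  then have Avc: "real (card Av) \<le> n ^ 5" using cG by (simp add: n_def)
  define \<Phi> where "\<Phi> = (\<Sum>v\<in>V. wt v)"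
  \<comment> \<open>For each vertex at least \<open>\<beta> / 2 * n^5\<close> of at most
    \<open>n^5\<close> candidates halve its weight, so on average the weight shrinks by the factor
    \<open>1 - \<beta> / 4\<close>.\<close>
  have "(\<Sum>g\<in>Av. \<Sum>v\<in>V. wt v * (if fit v g then 1/2 else 1))
      = (\<Sum>v\<in>V. \<Sum>g\<in>Av. wt v * (if fit v g then 1/2 else 1))" by (rule sum.swap)
  also have "\<dots> \<le> (\<Sum>v\<in>V. wt v * (real (card Av) * (1 - \<beta> / 4)))"
  proof (rule sum_mono)
    fix v assume v: "v \<in> V"
    have "(\<Sum>g\<in>Av. (if fit v g then 1/2 else 1 :: real)) = (\<Sum>g\<in>Av. 1 - 1/2 * (if fit v g then 1 else 0))"
      by (intro sum.cong) auto
    also have "\<dots> = real (card Av) - 1/2 * real (card {g \<in> Av. fit v g})"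
    proof -
      have "(\<Sum>g\<in>Av. (if fit v g then 1 else 0 :: real)) = real (card {g \<in> Av. fit v g})"
        using finB by (simp add: sum.If_cases Int_def)
      then show ?thesis by (simp only: sum_subtractf sum_distrib_left[symmetric]) simp
    qed
    also have "\<dots> \<le> real (card Av) - \<beta> / 4 * n ^ 5" using Avfit[OF v] by linarith
    also have "\<dots> \<le> real (card Av) - \<beta> / 4 * real (card Av)"
      using mult_left_mono[OF Avc, of "\<beta> / 4"] \<beta> by simp
    also have "\<dots> = real (card Av) * (1 - \<beta> / 4)" by (simp add: algebra_simps)
    finally have "wt v * (\<Sum>g\<in>Av. (if fit v g then 1/2 else 1 :: real)) \<le> wt v * (real (card Av) * (1 - \<beta> / 4))"
      using wt0 by (rule mult_left_mono)
    then show "(\<Sum>g\<in>Av. wt v * (if fit v g then 1/2 else 1)) \<le> wt v * (real (card Av) * (1 - \<beta> / 4))"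
      by (simp only: sum_distrib_left)
  qed
  also have "\<dots> = real (card Av) * ((1 - \<beta> / 4) * \<Phi>)"
    unfolding \<Phi>_def sum_distrib_right[symmetric] by simp
  finally have avg: "(\<Sum>g\<in>Av. \<Sum>v\<in>V. wt v * (if fit v g then 1/2 else 1)) \<le> real (card Av) * ((1 - \<beta> / 4) * \<Phi>)" .
  obtain g where g: "g \<in> Av" "(\<Sum>v\<in>V. wt v * (if fit v g then 1/2 else 1)) \<le> (1 - \<beta> / 4) * \<Phi>"
    using exists_le_average[OF finB(2) Avne avg] by (elim bexE) (rule that)
  have "(\<Sum>v\<in>V. (1/2) ^ length (filter (fit v) (g # gs))) = (\<Sum>v\<in>V. wt v * (if fit v g then 1/2 else 1))"
    by (intro sum.cong) (auto simp: wt_def)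
  also have "\<dots> \<le> (1 - \<beta> / 4) * (n * (1 - \<beta> / 4) ^ k)"
    using g(2) mult_left_mono[OF gs(4), of "1 - \<beta> / 4"] \<beta> unfolding \<Phi>_def wt_def by linarith
  finally have pot: "(\<Sum>v\<in>V. (1/2) ^ length (filter (fit v) (g # gs))) \<le> n * (1 - \<beta> / 4) ^ Suc k"
    by (simp add: mult.left_commute)
  have gG: "g \<in> \<G>" "set (verts g) \<inter> used = {}" using g(1) by (auto simp: Av_def Bad_def)
  then have "distinct (concat (map verts (g # gs)))" using gs(3) len[OF gG(1)] by (simp add: used_def)
  moreover have "length (g # gs) = Suc k" "set (g # gs) \<subseteq> \<G>" using gs(1,2) gG(1) by auto
  ultimately show ?case using pot unfolding n_def by (intro exI conjI)
qed

section \<open>Counting gadgets\<close>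

lemma finite_gadgets: "finite V \<Longrightarrow> finite (gadgets V E)"
  by (rule finite_subset[of _ "V \<times> V \<times> V \<times> V \<times> V"]) (auto simp: gadgets_def)

lemma card_gadgets_le:
  assumes "finite V"
  shows "real (card (gadgets V E)) \<le> real (card V) ^ 5"
proof -
  have "card (gadgets V E) \<le> card (V \<times> V \<times> V \<times> V \<times> V)"
    using assms by (intro card_mono) (auto simp: gadgets_def)
  then have "real (card (gadgets V E)) \<le> real (card (V \<times> V \<times> V \<times> V \<times> V))" by (simp only: of_nat_le_iff)
  then show ?thesis by (simp add: card_cartesian_product power_numeral_reduce)
qed

lemma card_gadgets_through_le:
  assumes "finite V"
  shows "real (card {g \<in> gadgets V E. x \<in> set (gadget_vertices g)}) \<le> 5 * real (card V) ^ 4"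
proof -
  let ?X = "{x}"
  let ?A = "?X \<times> V \<times> V \<times> V \<times> V" and ?B = "V \<times> ?X \<times> V \<times> V \<times> V" and ?C = "V \<times> V \<times> ?X \<times> V \<times> V"
    and ?D = "V \<times> V \<times> V \<times> ?X \<times> V" and ?F = "V \<times> V \<times> V \<times> V \<times> ?X"
  have "{g \<in> gadgets V E. x \<in> set (gadget_vertices g)} \<subseteq> ?A \<union> ?B \<union> ?C \<union> ?D \<union> ?F"
    by (auto simp: gadgets_def)
  then have "card {g \<in> gadgets V E. x \<in> set (gadget_vertices g)} \<le> card (?A \<union> ?B \<union> ?C \<union> ?D \<union> ?F)"
    using assms by (intro card_mono) auto
  also have "\<dots> \<le> card ?A + card ?B + card ?C + card ?D + card ?F"
    using card_Un_le[of "?A \<union> ?B \<union> ?C \<union> ?D" ?F] card_Un_le[of "?A \<union> ?B \<union> ?C" ?D]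
      card_Un_le[of "?A \<union> ?B" ?C] card_Un_le[of ?A ?B] by linarith
  also have "\<dots> = 5 * card V ^ 4" by (simp add: card_cartesian_product power_numeral_reduce)
  finally have "real (card {g \<in> gadgets V E. x \<in> set (gadget_vertices g)}) \<le> real (5 * card V ^ 4)"
    by (simp only: of_nat_le_iff)
  then show ?thesis by simp
qed

text \<open>Greedy: when \<open>v\<close> joins \<open>W\<close>, the \<open>card W\<close> occupied
  positions cannot exhaust those fitting \<open>v\<close>. Positions of the list are counted, as
  each of them can take one vertex.\<close>

lemma assignment:
  fixes W :: "'b set"
  assumes "finite W" "\<And>v. v \<in> W \<Longrightarrow> card W \<le> length (filter (P v) gs)"
  shows "\<exists>os. list_all2 (\<lambda>g o'. \<forall>v. o' = Some v \<longrightarrow> P v g) gs os \<and> mset (List.map_filter id os) = mset_set W"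
  using assms
proof (induction W)
  case empty
  have "list_all2 (\<lambda>g o'. \<forall>v. o' = Some v \<longrightarrow> P v g) gs (replicate (length gs) None)"
    by (simp add: list_all2_conv_all_nth)
  moreover have "List.map_filter id (replicate k None) = []" for k
    by (induction k) (auto simp: map_filter_simps)
  ultimately show ?case by (intro exI[of _ "replicate (length gs) None"]) (simp add: id_def)
next
  case (insert v W)
  have "card W \<le> length (filter (P v') gs)" if "v' \<in> W" for v'
    using insert.prems[of v'] insert.hyps that by simp
  then have "\<exists>os. list_all2 (\<lambda>g o'. \<forall>v. o' = Some v \<longrightarrow> P v g) gs os \<and> mset (List.map_filter id os) = mset_set W"
    by (rule insert.IH)
  then obtain os where os: "list_all2 (\<lambda>g o'. \<forall>v. o' = Some v \<longrightarrow> P v g) gs os"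
    "mset (List.map_filter id os) = mset_set W"
    by (elim exE conjE) (rule that)
  have len: "length os = length gs" using os(1) by (simp add: list_all2_lengthD)
  have "length (List.map_filter id os) = card W"
    using arg_cong[OF os(2), of size] by simp
  then have used: "card {i. i < length os \<and> os ! i \<noteq> None} = card W"
    by (simp add: List.map_filter_def length_filter_conv_card)
  have "card W < card {i. i < length gs \<and> P v (gs ! i)}"
    using insert.prems[of v] insert.hyps by (simp add: length_filter_conv_card)
  then have "\<not> {i. i < length gs \<and> P v (gs ! i)} \<subseteq> {i. i < length os \<and> os ! i \<noteq> None}"
    using card_mono[of "{i. i < length os \<and> os ! i \<noteq> None}" "{i. i < length gs \<and> P v (gs ! i)}"] used by auto
  then obtain i where i: "i < length gs" "P v (gs ! i)" "os ! i = None" using len by auto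
  have "list_all2 (\<lambda>g o'. \<forall>v. o' = Some v \<longrightarrow> P v g) gs (os[i := Some v])"
    using os(1) i len by (auto simp: list_all2_conv_all_nth nth_list_update)
  moreover have "mset (List.map_filter id (os[i := Some v])) = mset_set (insert v W)"
  proof -
    have split: "os = take i os @ None # drop (Suc i) os" using i len id_take_nth_drop[of i os] by simp
    have app: "List.map_filter id (xs @ ys) = List.map_filter id xs @ List.map_filter id ys" for xs ys :: "'b option list"
      by (simp add: List.map_filter_def)
    have "List.map_filter id os = List.map_filter id (take i os) @ List.map_filter id (drop (Suc i) os)"
      by (subst split) (simp add: app map_filter_simps)
    moreover have "List.map_filter id (os[i := Some v])
        = List.map_filter id (take i os) @ v # List.map_filter id (drop (Suc i) os)"
      using i len by (simp add: upd_conv_take_nth_drop app map_filter_simps)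
    ultimately show ?thesis using os(2) insert.hyps by simp
  qed
  ultimately show ?case by blast
qed

text \<open>A single weight \<open>(1/2) ^ s\<close> is at most the whole potential. Taking
  logarithms, \<open>s\<close> is at least \<open>k * \<beta> / 4 - ln n\<close>, whose linear term
  wins; \<open>ln n \<le> 2 * sqrt n - 2\<close> makes the threshold for \<open>n\<close>
  explicit.\<close>

lemma potential_small:
  fixes \<beta> \<kappa> n :: real
  assumes \<beta>: "0 < \<beta>" "\<beta> \<le> 1" and \<kappa>: "0 < \<kappa>" and k: "\<kappa> * n - 1 \<le> real k"
    and n: "1 \<le> n" "(16 / (\<beta> * \<kappa>))\<^sup>2 \<le> n" and s: "(1/2) ^ s \<le> n * (1 - \<beta> / 4) ^ k"
  shows "\<beta> * \<kappa> / 16 * n \<le> real s"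
proof -
  have ln2: "0 < ln (2::real)" "ln (2::real) \<le> 1" using ln_2_less_1 by auto
  have pos: "0 < 1 - \<beta> / 4" using \<beta> by simp
  have "ln ((1/2::real) ^ s) \<le> ln (n * (1 - \<beta> / 4) ^ k)"
    using s n pos by (subst ln_le_cancel_iff) auto
  then have 1: "- (real s * ln 2) \<le> ln n + real k * ln (1 - \<beta> / 4)"
    using n pos by (simp add: ln_mult ln_realpow ln_div)
  have "ln (1 - \<beta> / 4) \<le> - (\<beta> / 4)" using ln_le_minus_one[OF pos] by simp
  then have "real k * ln (1 - \<beta> / 4) \<le> real k * - (\<beta> / 4)" by (intro mult_left_mono) auto
  moreover have "real s * ln 2 \<le> real s * 1" using ln2 by (intro mult_left_mono) auto
  moreover have "(\<kappa> * n - 1) * (\<beta> / 4) \<le> real k * (\<beta> / 4)" using k \<beta> by (intro mult_right_mono) auto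
  ultimately have 2: "(\<kappa> * n - 1) * (\<beta> / 4) - ln n \<le> real s" using 1 by simp
  define r where "r = sqrt n"
  have r: "r * r = n" "1 \<le> r" using n by (auto simp: r_def)
  have "16 / (\<beta> * \<kappa>) \<le> r" unfolding r_def using n(2) by (rule real_le_rsqrt)
  then have "16 \<le> \<beta> * \<kappa> * r" using \<beta> \<kappa> by (simp add: pos_divide_le_eq mult.commute)
  then have "16 * r \<le> \<beta> * \<kappa> * r * r" using r by (intro mult_right_mono) auto
  then have 3: "16 * r \<le> \<beta> * \<kappa> * n" using r(1) by (simp add: mult.assoc)
  have "ln n = 2 * ln r" unfolding r_def using n by (simp add: ln_sqrt)
  moreover have "ln r \<le> r - 1" using r by (intro ln_le_minus_one) auto
  ultimately have "ln n \<le> 2 * r - 2" by simp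
  then show ?thesis using 2 3 \<beta> r by (simp add: algebra_simps)
qed

text \<open>\<open>\<alpha>\<close> prescribes the length and \<open>\<gamma>\<close> is the
  resulting capacity: every vertex fits at least \<open>\<gamma> * n\<close> of the chosen gadgets,
  so that many vertices can be assigned to different gadgets.\<close>

lemma absorbing_path:
  fixes \<epsilon> \<alpha> :: real
  assumes eps: "0 < \<epsilon>" "\<epsilon> \<le> 1" and \<alpha>: "0 < \<alpha>"
  obtains \<rho> \<gamma> n0 where "0 < \<rho>" and "0 < \<gamma>" and "\<And>(V::'a set) E.
    uniform3_hypergraph V E \<Longrightarrow> n0 \<le> card V \<Longrightarrow> vertex_pair_dense \<rho> (1/4 + \<epsilon>) V E \<Longrightarrow>
    \<epsilon> * real (card V choose 2) \<le> real (min_vertex_degree V E) \<Longrightarrow>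
    \<exists>a b c d N. tight_walk E ([a, b] @ N @ [c, d]) \<and> distinct ([a, b] @ N @ [c, d]) \<and>
      set ([a, b] @ N @ [c, d]) \<subseteq> V \<and> good (1/64) V E b a \<and> good (1/64) V E c d \<and>
      real (length N + 4) \<le> \<alpha> * real (card V) \<and>
      (\<forall>W. W \<subseteq> V \<longrightarrow> real (card W) \<le> \<gamma> * real (card V) \<longrightarrow>
        (\<exists>N'. tight_walk E ([a, b] @ N' @ [c, d]) \<and> mset N' = mset N + mset_set W))"
proof -
  have d64: "0 < (1/64 :: real)" by simp
  show thesis
  proof (rule connecting[OF eps d64, where 'a = 'a], goal_cases)
    case (1 \<rho>1 \<theta>1 M1 n1)
    note c1 = 1
    show thesis
    proof (rule walks_of_consecutive_lengths[OF eps, where 'a = 'a], goal_cases)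
      case (1 \<rho>2 \<theta>2 M2 n2)
      note c2 = 1
      \<comment> \<open>The binomial coefficient is at least \<open>n^2 / 4\<close> once
        \<open>n \<ge> 2\<close>.\<close>
      define g where "g = \<epsilon> / 4"
      have g: "0 < g" "g \<le> 1" using eps by (auto simp: g_def)
      define \<rho> where "\<rho> = min (min \<rho>1 \<rho>2) (g / 4608)"
      define \<theta> where "\<theta> = min (min \<theta>1 \<theta>2) (g / 128)"
      define M where "M = max M1 M2"
      define L where "L = robustly_connected.item_length M"
      define \<beta> where "\<beta> = (g / 8) ^ 3 / 2048"
      have \<rho>: "0 < \<rho>" "\<rho> \<le> \<rho>1" "\<rho> \<le> \<rho>2" "\<rho> \<le> g / 4608" using c1(1) c2(1) g by (auto simp: \<rho>_def)
      have \<theta>: "0 < \<theta>" "\<theta> \<le> \<theta>1" "\<theta> \<le> \<theta>2" "\<theta> \<le> g / 128" using c1(2) c2(2) g by (auto simp: \<theta>_def)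
      have g8: "(g / 8) ^ 3 \<le> 1" using g by (intro power_le_one) auto
      have \<beta>: "0 < \<beta>" "\<beta> \<le> 1" using g g8 by (auto simp: \<beta>_def)
      define Lr where "Lr = real L + 1"
      have Lr: "1 \<le> Lr" by (simp add: Lr_def)
      \<comment> \<open>The number of gadgets relative to \<open>n\<close>. Its bounds serve the
        disjoint selection, the number of vertices to avoid, and the length of the path.\<close>
      define \<kappa> where "\<kappa> = min (\<beta> / 50) (min (\<theta> / (8 * Lr)) (\<alpha> / (8 * Lr)))"
      have \<kappa>: "0 < \<kappa>" "\<kappa> \<le> \<beta> / 50" "\<kappa> \<le> \<theta> / (8 * Lr)" "\<kappa> \<le> \<alpha> / (8 * Lr)"
        using \<beta> \<theta> \<alpha> Lr by (auto simp: \<kappa>_def)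
      define \<gamma> where "\<gamma> = \<beta> * \<kappa> / 16"
      have \<gamma>: "0 < \<gamma>" using \<beta> \<kappa> by (simp add: \<gamma>_def)
      obtain n3 :: nat where n3: "(16 / (\<beta> * \<kappa>))\<^sup>2 + 640 / g + 8 * Lr / \<theta> + 8 * Lr / \<alpha> + 2 < real n3"
        using reals_Archimedean2 by blast
      show thesis
      proof (rule that[OF \<rho>(1) \<gamma>])
        fix V :: "'a set" and E
        assume H: "uniform3_hypergraph V E" and n0: "max n3 (max n1 n2) \<le> card V"
          and dense: "vertex_pair_dense \<rho> (1/4 + \<epsilon>) V E"
          and deg: "\<epsilon> * real (card V choose 2) \<le> real (min_vertex_degree V E)"
        have fin: "finite V" and E3: "\<forall>e\<in>E. card e = 3" using H by (auto simp: uniform3_hypergraph_def)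
        define n where "n = real (card V)"
        have "real n3 \<le> n" using n0 by (simp add: n_def)
        then have nbig: "(16 / (\<beta> * \<kappa>))\<^sup>2 + 640 / g + 8 * Lr / \<theta> + 8 * Lr / \<alpha> + 2 \<le> n" using n3 by linarith
        have parts: "0 \<le> (16 / (\<beta> * \<kappa>))\<^sup>2" "0 \<le> 640 / g" "0 \<le> 8 * Lr / \<theta>" "0 \<le> 8 * Lr / \<alpha>"
          using g \<theta> \<alpha> Lr by auto
        have n2: "2 \<le> n" "(16 / (\<beta> * \<kappa>))\<^sup>2 \<le> n" "640 / g \<le> n" "8 * Lr / \<theta> \<le> n" "8 * Lr / \<alpha> \<le> n"
          using nbig parts by linarith+
        have n640: "640 \<le> g * n" and nL: "8 * Lr \<le> \<theta> * n" "8 * Lr \<le> \<alpha> * n"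
          using n2 g \<theta> \<alpha> by (auto simp: pos_divide_le_eq mult.commute)
        have Vne: "V \<noteq> {}" using n2(1) by (auto simp: n_def)
        have d4: "1/4 \<le> 1/4 + \<epsilon>" using eps by simp
        have dense1: "vertex_pair_dense \<rho>1 (1/4 + \<epsilon>) V E" "vertex_pair_dense \<rho>2 (1/4 + \<epsilon>) V E"
          using dense_mono[OF dense _ order_refl] \<rho> by auto
        have links: "g * real (card V) ^ 2 \<le> real (card (link V E v))" if v: "v \<in> V" for v
        proof -
          have "min_vertex_degree V E \<le> vertex_degree E v"
            unfolding min_vertex_degree_def using fin v by (intro Min_le) auto
          then have "\<epsilon> * real (card V choose 2) \<le> real (card (link V E v))"
            using deg degree_le_card_link[OF H, of v] by linarith
          moreover have "real (card V choose 2) = n * (n - 1) / 2"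
            using n2(1) by (simp add: choose_two n_def real_of_nat_div of_nat_diff)
          moreover have "n ^ 2 / 4 \<le> n * (n - 1) / 2"
          proof -
            have "n * 2 \<le> n * n" using n2(1) by (intro mult_left_mono) auto
            moreover have "n * (n - 1) = n * n - n" by (simp add: algebra_simps)
            ultimately show ?thesis unfolding power2_eq_square by linarith
          qed
          then have "\<epsilon> * (n ^ 2 / 4) \<le> \<epsilon> * (n * (n - 1) / 2)"
            using eps by (intro mult_left_mono) auto
          ultimately have "\<epsilon> * (n ^ 2 / 4) \<le> real (card (link V E v))" by simp
          then show ?thesis by (simp add: g_def n_def)
        qed
        define K where "K = nat \<lfloor>\<theta> * n\<rfloor>"
        have K: "real K \<le> \<theta> * n" "\<theta> * n - 1 \<le> real K"
          using \<theta> n2(1) by (auto simp: K_def)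
        have FK: "real (card F) \<le> t * real (card V)" if "card F \<le> K" "\<theta> \<le> t" for F :: "'a set" and t
        proof -
          have "real (card F) \<le> real K" using that(1) by simp
          also have "\<dots> \<le> \<theta> * n" by (rule K(1))
          also have "\<dots> \<le> t * n" using that(2) n2(1) by (intro mult_right_mono) auto
          finally show ?thesis by (simp add: n_def)
        qed
        interpret robustly_connected V E "good (1/64) V E" K M
        proof
          fix F :: "'a set" and a b c d
          assume *: "good (1/64) V E a b" "good (1/64) V E d c" "finite F" "card F \<le> K"
          have "n1 \<le> card V" using n0 by simp
          from c1(3)[OF fin this dense1(1) *(1,2,3) FK[OF *(4) \<theta>(2)]]
          show "\<exists>m. tight_walk E ([a, b] @ m @ [c, d]) \<and> distinct m \<and> set m \<subseteq> V - F \<and> length m \<le> M"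
            by (elim exE conjE, intro exI conjI) (auto simp: M_def)
        next
          fix F :: "'a set" and s t
          assume *: "s \<in> V" "t \<in> V" "finite F" "card F \<le> K"
          show "exchange_paths V E (good (1/64) V E) F s t"
            by (rule exchanging[OF fin dense d4 E3 g links[OF *(1)] links[OF *(2)] *(3) FK[OF *(4) \<theta>(4)] \<rho>(4)
                n640[unfolded n_def]])
        next
          fix F :: "'a set"
          assume *: "finite F" "card F \<le> K"
          have "n2 \<le> card V" using n0 by simp
          from c2(3)[OF fin this dense1(2) *(1) FK[OF *(2) \<theta>(3)]]
          show "consecutive_walks V E (good (1/64) V E) M F"
            by (rule consecutive_walks_mono) (simp add: M_def)
        qed
        have Litem: "item_length = L" by (simp add: L_def)
        define k where "k = nat \<lfloor>\<kappa> * n\<rfloor>"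
        have k: "real k \<le> \<kappa> * n" "\<kappa> * n - 1 \<le> real k"
          using \<kappa> n2(1) by (auto simp: k_def)
        have "\<kappa> * n \<le> \<beta> / 50 * n" using \<kappa>(2) n2(1) by (intro mult_right_mono) auto
        then have k25: "25 * real k \<le> \<beta> / 2 * real (card V)" using k(1) by (simp add: n_def)
        have lenk: "8 * Lr * real k \<le> t * n" if "\<kappa> \<le> t / (8 * Lr)" for t
        proof -
          have "\<kappa> * n \<le> t / (8 * Lr) * n" using that n2(1) by (intro mult_right_mono) auto
          then have "real k \<le> t * n / (8 * Lr)" using k(1) by simp
          then show ?thesis using Lr by (simp add: pos_le_divide_eq mult.commute)
        qed
        have many: "\<beta> * real (card V) ^ 5 \<le> real (card {x \<in> gadgets V E. fits_gadget E v x})" if "v \<in> V" for v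
          unfolding \<beta>_def by (rule card_fitting_gadgets[OF fin dense d4 E3 g links[OF that] \<rho>(4) n640[unfolded n_def]])
        have len5: "length (gadget_vertices x) = 5 \<and> distinct (gadget_vertices x) \<and> set (gadget_vertices x) \<subseteq> V"
          if "x \<in> gadgets V E" for x
          using that by (auto simp: gadgets_def)
        have "\<exists>gs. length gs = k \<and> set gs \<subseteq> gadgets V E \<and> distinct (concat (map gadget_vertices gs)) \<and>
          (\<Sum>v\<in>V. (1/2) ^ length (filter (fits_gadget E v) gs)) \<le> real (card V) * (1 - \<beta> / 4) ^ k"
          by (rule fitting_family[OF fin Vne finite_gadgets[OF fin] \<beta> len5 card_gadgets_le[OF fin]
              card_gadgets_through_le[OF fin] many k25])
        then obtain gs where gs: "length gs = k" "set gs \<subseteq> gadgets V E" "distinct (concat (map gadget_vertices gs))"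
          "(\<Sum>v\<in>V. (1/2) ^ length (filter (fits_gadget E v) gs)) \<le> real (card V) * (1 - \<beta> / 4) ^ k"
          by (elim exE conjE) (rule that)
        have cnt: "\<gamma> * n \<le> real (length (filter (fits_gadget E v) gs))" if v: "v \<in> V" for v
        proof -
          have "(1/2) ^ length (filter (fits_gadget E v) gs) \<le> (\<Sum>v\<in>V. (1/2 :: real) ^ length (filter (fits_gadget E v) gs))"
            by (rule member_le_sum[OF v _ fin]) auto
          then have "(1/2) ^ length (filter (fits_gadget E v) gs) \<le> n * (1 - \<beta> / 4) ^ k"
            using gs(4) by (simp add: n_def)
          then show ?thesis
            unfolding \<gamma>_def using potential_small[OF \<beta> \<kappa>(1) k(2) _ n2(2)] n2(1) by simp
        qed
        have "real (card ({} :: 'a set) + item_length * (2 * length gs + 2)) \<le> real K"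
        proof -
          have "real (card ({} :: 'a set) + item_length * (2 * length gs + 2)) \<le> Lr * (2 * real k + 2)"
            unfolding Litem gs(1) Lr_def by (simp add: algebra_simps)
          also have "\<dots> = 2 * (Lr * real k) + 2 * Lr" by (simp add: algebra_simps)
          also have "\<dots> \<le> \<theta> * n - 1" using lenk[OF \<kappa>(3)] nL(1) Lr by linarith
          finally show ?thesis using K(2) by linarith
        qed
        then have Kb: "card ({} :: 'a set) + item_length * (2 * length gs + 2) \<le> K" by (simp only: of_nat_le_iff)
        obtain a b c d N where A: "tight_walk E ([a, b] @ N @ [c, d])" "distinct ([a, b] @ N @ [c, d])"
          "set ([a, b] @ N @ [c, d]) \<subseteq> V - {}" "good (1/64) V E b a" "good (1/64) V E c d"
          "length N + 4 \<le> item_length * (length gs + 1)"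
          "\<forall>os. list_all2 (\<lambda>g o'. \<forall>v. o' = Some v \<longrightarrow> fits_gadget E v g) gs os \<longrightarrow>
            (\<exists>N'. tight_walk E ([a, b] @ N' @ [c, d]) \<and> mset N' = mset N + mset (List.map_filter id os))"
          using absorbing_walk[OF gs(2,3) refl finite.emptyI Int_empty_left Kb] by (elim exE conjE) (rule that)
        have "real (length N + 4) \<le> real (item_length * (length gs + 1))" using A(6) by (simp only: of_nat_le_iff)
        also have "\<dots> \<le> Lr * real k + Lr" unfolding Litem gs(1) Lr_def by (simp add: algebra_simps)
        also have "\<dots> \<le> \<alpha> * n" using lenk[OF \<kappa>(4)] nL(2) Lr by linarith
        finally have lenN: "real (length N + 4) \<le> \<alpha> * real (card V)" by (simp add: n_def)
        have absorb: "\<forall>W. W \<subseteq> V \<longrightarrow> real (card W) \<le> \<gamma> * real (card V) \<longrightarrow>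
          (\<exists>N'. tight_walk E ([a, b] @ N' @ [c, d]) \<and> mset N' = mset N + mset_set W)"
        proof (intro allI impI)
          fix W assume W: "W \<subseteq> V" "real (card W) \<le> \<gamma> * real (card V)"
          have "card W \<le> length (filter (fits_gadget E v) gs)" if "v \<in> W" for v
          proof -
            have "real (card W) \<le> real (length (filter (fits_gadget E v) gs))"
              using cnt[of v] W that by (auto simp: n_def)
            then show ?thesis by (simp only: of_nat_le_iff)
          qed
          then have "\<exists>os. list_all2 (\<lambda>g o'. \<forall>v. o' = Some v \<longrightarrow> fits_gadget E v g) gs os \<and>
            mset (List.map_filter id os) = mset_set W"
            by (rule assignment[OF finite_subset[OF W(1) fin]])
          then obtain os where os: "list_all2 (\<lambda>g o'. \<forall>v. o' = Some v \<longrightarrow> fits_gadget E v g) gs os"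
            "mset (List.map_filter id os) = mset_set W"
            by (elim exE conjE) (rule that)
          show "\<exists>N'. tight_walk E ([a, b] @ N' @ [c, d]) \<and> mset N' = mset N + mset_set W"
            using A(7)[rule_format, OF os(1)] os(2) by simp
        qed
        have "set ([a, b] @ N @ [c, d]) \<subseteq> V" using A(3) by simp
        then show "\<exists>a b c d N. tight_walk E ([a, b] @ N @ [c, d]) \<and> distinct ([a, b] @ N @ [c, d]) \<and>
          set ([a, b] @ N @ [c, d]) \<subseteq> V \<and> good (1/64) V E b a \<and> good (1/64) V E c d \<and>
          real (length N + 4) \<le> \<alpha> * real (card V) \<and>
          (\<forall>W. W \<subseteq> V \<longrightarrow> real (card W) \<le> \<gamma> * real (card V) \<longrightarrow>
            (\<exists>N'. tight_walk E ([a, b] @ N' @ [c, d]) \<and> mset N' = mset N + mset_set W))"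
          using A(1,2,4,5) lenN absorb by (intro exI conjI)
      qed
    qed
  qed
qed

section \<open>Tight Hamilton cycles\<close>

text \<open>Each removed vertex destroys at most \<open>2 * card U\<close> continuations. Ends of
  the path are judged by continuations among uncovered vertices, a set that shrinks.\<close>

lemma good_remove:
  assumes fin: "finite U" and good: "good \<delta> U E a b" and U': "U' \<subseteq> U" and d': "0 \<le> \<delta>'"
    and r: "2 * real (card (U - U')) \<le> (\<delta> - \<delta>') * real (card U)"
  shows "good \<delta>' U' E a b"
proof -
  let ?T = "\<lambda>U. {(y, z) \<in> U \<times> U. {a, b, y} \<in> E \<and> {b, y, z} \<in> E}"
  let ?B = "{(y, z) \<in> U \<times> U. y \<in> U - U' \<or> z \<in> U - U'}"
  have finT: "finite (?T U')" "finite ?B"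
    by (rule finite_subset[of _ "U \<times> U"]; use U' fin in auto)+
  have "?T U \<subseteq> ?T U' \<union> ?B" by auto
  then have "card (?T U) \<le> card (?T U' \<union> ?B)" using finT by (intro card_mono) auto
  then have "real (card (?T U)) \<le> real (card (?T U')) + real (card ?B)"
    using card_Un_le[of "?T U'" ?B] by linarith
  moreover have "real (card ?B) \<le> 2 * real (card (U - U')) * real (card U)"
    by (rule card_pairs_touching) (use fin in auto)
  moreover have "2 * real (card (U - U')) * real (card U) \<le> (\<delta> - \<delta>') * real (card U) * real (card U)"
    using r by (intro mult_right_mono) auto
  moreover have "\<delta> * real (card U) ^ 2 \<le> real (card (?T U))" using good by (simp add: good_def)
  ultimately have "\<delta>' * real (card U) ^ 2 \<le> real (card (?T U'))"
    by (simp add: power2_eq_square algebra_simps)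
  moreover have "\<delta>' * real (card U') ^ 2 \<le> \<delta>' * real (card U) ^ 2"
    using d' U' fin by (intro mult_left_mono power_mono) (auto intro: card_mono)
  ultimately show ?thesis unfolding good_def by linarith
qed

text \<open>Exchanging the middle of the absorbing path keeps its end pairs, hence the closed walk.
  \<open>take 2 (l @ [a, b])\<close> is the start of the cycle, written so that \<open>l\<close> may
  have fewer than two vertices.\<close>

lemma tight_Hamilton_cycle_close:
  assumes w: "tight_walk E (l @ [a, b] @ N @ [c, d] @ r @ m @ take 2 (l @ [a, b]))"
    and A: "tight_walk E ([a, b] @ N' @ [c, d])" "mset N' = mset N + mset_set W"
    and dist: "distinct (l @ [a, b] @ N @ [c, d] @ r @ m)" and W: "finite W"
    and V: "V = set (l @ [a, b] @ N @ [c, d] @ r @ m) \<union> W" "set (l @ [a, b] @ N @ [c, d] @ r @ m) \<inter> W = {}"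
  shows "tight_Hamilton_cycle V E (l @ [a, b] @ N' @ [c, d] @ r @ m)"
proof -
  let ?vs = "l @ [a, b] @ N' @ [c, d] @ r @ m"
  obtain ws where ws: "set ws = W" "distinct ws" using finite_distinct_list[OF W] by blast
  have ms: "mset ?vs = mset (l @ [a, b] @ N @ [c, d] @ r @ m @ ws)"
    using A(2) ws by (simp add: mset_set_set[symmetric])
  have "distinct (l @ [a, b] @ N @ [c, d] @ r @ m @ ws)"
    using dist V(2) ws by auto
  then have 1: "distinct ?vs" using mset_eq_imp_distinct_iff[OF ms] by blast
  have "set ?vs = set (l @ [a, b] @ N @ [c, d] @ r @ m @ ws)" by (rule mset_eq_setD[OF ms])
  then have 2: "set ?vs = V" using V(1) ws(1) by auto
  have "take 2 ?vs = take 2 (l @ [a, b])" by (cases l rule: list.exhaust[case_names Nil Cons]) (auto simp: take_Cons' split: if_splits)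
  then have 3: "tight_walk E (?vs @ take 2 ?vs)"
    using tight_walk_exchange[of E l a b N c d "r @ m @ take 2 (l @ [a, b])" N'] w A(1) by simp
  have "tight_cycle V E ?vs"
  proof (rule tight_cycle_if_closed_walk[OF 1 _ _ 3])
    show "set ?vs \<subseteq> V" using 2 by (rule equalityD1)
  qed simp
  then show ?thesis using 2 unfolding tight_Hamilton_cycle_def by (rule conjI)
qed

text \<open>Among the extensions with good ends and at least \<open>\<gamma> / 2 * n\<close>
  uncovered vertices, one with the fewest uncovered vertices is taken. Minimality brings their
  number below \<open>\<gamma> * n\<close>, within the capacity, while the lower bound preserves
  density for the closing connection.\<close>

lemma tight_Hamilton_cycle_small_eps:
  fixes \<epsilon> :: real
  assumes eps: "0 < \<epsilon>" "\<epsilon> \<le> 1"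
  obtains \<rho> n0 where "0 < \<rho>" and "\<And>(V::'a set) E.
    uniform3_hypergraph V E \<Longrightarrow> n0 \<le> card V \<Longrightarrow> vertex_pair_dense \<rho> (1/4 + \<epsilon>) V E \<Longrightarrow>
    \<epsilon> * real (card V choose 2) \<le> real (min_vertex_degree V E) \<Longrightarrow> \<exists>vs. tight_Hamilton_cycle V E vs"
proof -
  \<comment> \<open>A path on at most \<open>n / 512\<close> vertices costs at most
    \<open>2/512 \<le> 1/64 - 1/128\<close> of the goodness; 1/128 is the level kept at the
    ends.\<close>
  have c0: "0 < (1/512 :: real)" "0 < (1/128 :: real)" by simp_all
  show thesis
  proof (rule absorbing_path[OF eps c0(1), where 'a = 'a], goal_cases)
    case (1 \<rho>1 \<gamma>0 n1)
    note abs = 1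
    show thesis
    proof (rule extending[OF eps c0(2), where 'a = 'a], goal_cases)
      case (1 \<rho>2 \<theta>2 M2 n2)
      note ext = 1
      show thesis
      proof (rule connecting[OF eps c0(2), where 'a = 'a], goal_cases)
        case (1 \<rho>3 \<theta>3 M3 n3)
        note con = 1
        define \<gamma> where "\<gamma> = min \<gamma>0 (1/4)"
        have \<gamma>: "0 < \<gamma>" "\<gamma> \<le> \<gamma>0" "\<gamma> \<le> 1/4" using abs(2) by (auto simp: \<gamma>_def)
        \<comment> \<open>\<open>\<gamma> / 2\<close> is the smallest share of uncovered vertices
          that occurs; its cube is the price of \<open>dense_subset\<close>.\<close>
        define \<rho> where "\<rho> = min \<rho>1 (min \<rho>2 \<rho>3 * (\<gamma> / 2) ^ 3)"
        have \<rho>: "0 < \<rho>" "\<rho> \<le> \<rho>1" "\<rho> \<le> min \<rho>2 \<rho>3 * (\<gamma> / 2) ^ 3"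
          using abs(1) ext(1) con(1) \<gamma> by (auto simp: \<rho>_def)
        \<comment> \<open>The size demanded of the uncovered set: thresholds for extending and
          connecting, 256 times the vertices added in a round, and room for one new end piece to be
          avoided.\<close>
        define C where "C = real n2 + real n3 + 256 * (2 * real M2 + 4) + (real M2 + 2) / \<theta>2"
        obtain n4 :: nat where n4: "2 * C / \<gamma> < real n4" using reals_Archimedean2 by blast
        show thesis
        proof (rule that[OF \<rho>(1)])
          fix V :: "'a set" and E
          assume H: "uniform3_hypergraph V E" and n0: "max n1 n4 \<le> card V"
            and dense: "vertex_pair_dense \<rho> (1/4 + \<epsilon>) V E"
            and deg: "\<epsilon> * real (card V choose 2) \<le> real (min_vertex_degree V E)"
          have fin: "finite V" using H by (simp add: uniform3_hypergraph_def)
          define n where "n = real (card V)"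
          have "real n4 \<le> n" using n0 by (simp add: n_def)
          then have "2 * C / \<gamma> \<le> n" using n4 by linarith
          then have Cn: "C \<le> \<gamma> / 2 * n" using \<gamma> by (simp add: pos_divide_le_eq algebra_simps)
          have Cparts: "0 \<le> (real M2 + 2) / \<theta>2" using ext(2) by simp
          have C: "real n2 \<le> C" "real n3 \<le> C" "256 * (2 * real M2 + 4) \<le> C" "(real M2 + 2) / \<theta>2 \<le> C"
            using Cparts by (auto simp: C_def)
          have npos: "0 < n"
          proof -
            have "0 < 256 * (2 * real M2 + 4)" by simp
            then have "0 < \<gamma> / 2 * n" using C(3) Cn by linarith
            then show ?thesis using \<gamma> by (simp add: zero_less_mult_iff)
          qed
          have n1: "n1 \<le> card V" using n0 by simp
          from abs(3)[OF H n1 dense_mono[OF dense \<rho>(2) order_refl] deg]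
          obtain a0 b0 c0 d0 N0 where A: "tight_walk E ([a0, b0] @ N0 @ [c0, d0])" "distinct ([a0, b0] @ N0 @ [c0, d0])"
            "set ([a0, b0] @ N0 @ [c0, d0]) \<subseteq> V" "good (1/64) V E b0 a0" "good (1/64) V E c0 d0"
            "real (length N0 + 4) \<le> 1/512 * real (card V)"
            "\<forall>W. W \<subseteq> V \<longrightarrow> real (card W) \<le> \<gamma>0 * real (card V) \<longrightarrow>
              (\<exists>N'. tight_walk E ([a0, b0] @ N' @ [c0, d0]) \<and> mset N' = mset N0 + mset_set W)"
            by (elim exE conjE) (rule that)
          define P where "P = (\<lambda>(l, r). \<exists>a b c d N. l @ ([a0, b0] @ N0 @ [c0, d0]) @ r = [a, b] @ N @ [c, d] \<and>
            tight_walk E ([a, b] @ N @ [c, d]) \<and> distinct ([a, b] @ N @ [c, d]) \<and> set ([a, b] @ N @ [c, d]) \<subseteq> V \<and>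
            \<gamma> / 2 * n \<le> real (card (V - set ([a, b] @ N @ [c, d]))) \<and>
            good (1/128) (V - set ([a, b] @ N @ [c, d])) E b a \<and> good (1/128) (V - set ([a, b] @ N @ [c, d])) E c d)"
          define size where "size = (\<lambda>(l, r). card (V - set (l @ ([a0, b0] @ N0 @ [c0, d0]) @ r)))"
          have "P ([], [])"
          proof -
            let ?U = "V - set ([a0, b0] @ N0 @ [c0, d0])"
            have "V - ?U = set ([a0, b0] @ N0 @ [c0, d0])" using A(3) by auto
            then have "card (V - ?U) \<le> length N0 + 4"
              using card_length[of "[a0, b0] @ N0 @ [c0, d0]"] by simp
            then have VU: "real (card (V - ?U)) \<le> 1/512 * n" using A(6) unfolding n_def by linarith
            have gU: "good (1/128) ?U E b0 a0" "good (1/128) ?U E c0 d0"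
              by (rule good_remove[OF fin A(4)] good_remove[OF fin A(5)]; use VU npos in \<open>auto simp: n_def\<close>)+
            have "card V = card (V - ?U) + card ?U"
              using fin by (subst card_Un_disjoint[symmetric]) (auto intro: arg_cong[where f = card])
            then have "n = real (card (V - ?U)) + real (card ?U)" by (simp add: n_def)
            then have "511/512 * n \<le> real (card ?U)" using VU by linarith
            moreover have "\<gamma> / 2 * n \<le> 1/8 * n" using \<gamma> npos by (intro mult_right_mono) auto
            ultimately have "\<gamma> / 2 * n \<le> real (card ?U)" using npos by linarith
            moreover have "[] @ ([a0, b0] @ N0 @ [c0, d0]) @ [] = [a0, b0] @ N0 @ [c0, d0]" by simp
            ultimately show ?thesis unfolding P_def prod.case using A(1,2,3) gU by (intro exI conjI)
          qed
          then have "\<exists>lr. P lr \<and> (\<forall>lr'. P lr' \<longrightarrow> size lr \<le> size lr')" by (rule ex_has_least_nat)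
          then obtain lr where lr: "P lr" "\<forall>lr'. P lr' \<longrightarrow> size lr \<le> size lr'" by (elim exE conjE) (rule that)
          obtain l r where lreq: "lr = (l, r)" by (cases lr)
          from lr(1) obtain a b c d N where S: "l @ ([a0, b0] @ N0 @ [c0, d0]) @ r = [a, b] @ N @ [c, d]"
            "tight_walk E ([a, b] @ N @ [c, d])" "distinct ([a, b] @ N @ [c, d])" "set ([a, b] @ N @ [c, d]) \<subseteq> V"
            "\<gamma> / 2 * n \<le> real (card (V - set ([a, b] @ N @ [c, d])))"
            "good (1/128) (V - set ([a, b] @ N @ [c, d])) E b a" "good (1/128) (V - set ([a, b] @ N @ [c, d])) E c d"
            unfolding lreq P_def prod.case by (elim exE conjE) (rule that)
          define U where "U = V - set ([a, b] @ N @ [c, d])"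
          have U: "U \<subseteq> V" "finite U" "\<gamma> / 2 * n \<le> real (card U)" "good (1/128) U E b a" "good (1/128) U E c d"
            using S fin by (auto simp: U_def)
          have CU: "C \<le> real (card U)" using Cn U(3) by linarith
          then have n23: "n2 \<le> card U" "n3 \<le> card U" using C by linarith+
          have "0 < \<gamma> / 2" using \<gamma> by simp
          then have denseU: "vertex_pair_dense (min \<rho>2 \<rho>3) (1/4 + \<epsilon>) U E"
            by (rule dense_subset[OF dense U(1)]) (use U(3) \<rho>(3) ext(1) con(1) in \<open>auto simp: n_def\<close>)
          have dU2: "vertex_pair_dense \<rho>2 (1/4 + \<epsilon>) U E" and dU3: "vertex_pair_dense \<rho>3 (1/4 + \<epsilon>) U E"
            using dense_mono[OF denseU _ order_refl] by auto
          have Usmall: "real (card U) < \<gamma> * n"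
          proof (rule ccontr)
            assume "\<not> ?thesis"
            then have Ubig: "\<gamma> * n \<le> real (card U)" by simp
            have "real (card ({} :: 'a set)) \<le> \<theta>2 * real (card U)" using ext(2) by simp
            from ext(3)[OF U(2) n23(1) dU2 U(5) finite.emptyI this]
            obtain m c' d' where m: "tight_walk E ([c, d] @ m @ [c', d'])" "distinct (m @ [c', d'])"
              "set (m @ [c', d']) \<subseteq> U - {}" "length m \<le> M2" "good (1/64) U E c' d'"
              by (elim exE conjE) (rule that)
            have "card (set (m @ [c', d'])) \<le> M2 + 2" using card_length[of "m @ [c', d']"] m(4) by simp
            then have "real (card (set (m @ [c', d']))) \<le> real M2 + 2" by linarith
            also have "\<dots> \<le> \<theta>2 * C" using C(4) ext(2) by (simp add: pos_divide_le_eq mult.commute)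
            also have "\<dots> \<le> \<theta>2 * real (card U)" using CU ext(2) by (intro mult_left_mono) auto
            finally have F: "real (card (set (m @ [c', d']))) \<le> \<theta>2 * real (card U)" .
            \<comment> \<open>Both ends are extended in every round. An end left in place could lose
              goodness again and again as the uncovered set shrinks, whereas a new end starts at
              1/64.\<close>
            from ext(3)[OF U(2) n23(1) dU2 U(4) finite_set F]
            obtain m2 e f where m2: "tight_walk E ([b, a] @ m2 @ [e, f])" "distinct (m2 @ [e, f])"
              "set (m2 @ [e, f]) \<subseteq> U - set (m @ [c', d'])" "length m2 \<le> M2" "good (1/64) U E e f"
              by (elim exE conjE) (rule that)
            define N2 where "N2 = rev m2 @ [a, b] @ N @ [c, d] @ m"
            let ?new = "[f, e] @ N2 @ [c', d']"
            have eqnew: "([f, e] @ rev m2 @ l) @ ([a0, b0] @ N0 @ [c0, d0]) @ (r @ m @ [c', d']) = ?new"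
              using S(1) unfolding N2_def by simp
            have "tight_walk E (rev ([b, a] @ m2 @ [e, f]))" using m2(1) by (simp only: tight_walk_rev)
            then have "tight_walk E (([f, e] @ rev m2) @ [a, b])" by simp
            moreover have "tight_walk E (([a, b] @ N) @ [c, d] @ m @ [c', d'])"
              by (rule tight_walk_overlap) (use S(2) m(1) in auto)
            then have "tight_walk E ([a, b] @ N @ [c, d] @ m @ [c', d'])" by simp
            ultimately have "tight_walk E (([f, e] @ rev m2) @ [a, b] @ N @ [c, d] @ m @ [c', d'])"
              by (rule tight_walk_overlap)
            then have w: "tight_walk E ?new" by (simp add: N2_def)
            have dn: "distinct ?new"
              using S(3) m(2,3) m2(2,3) by (auto simp: N2_def U_def)
            have sn: "set ?new \<subseteq> V" using S(4) m(3) m2(3) by (auto simp: N2_def U_def)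
            define U' where "U' = V - set ?new"
            have U'U: "U' \<subseteq> U" by (auto simp: U'_def U_def N2_def)
            have "U - U' \<subseteq> set (m @ [c', d'] @ m2 @ [e, f])" by (auto simp: U'_def U_def N2_def)
            then have "card (U - U') \<le> card (set (m @ [c', d'] @ m2 @ [e, f]))" by (intro card_mono) auto
            also have "\<dots> \<le> 2 * M2 + 4" using card_length[of "m @ [c', d'] @ m2 @ [e, f]"] m(4) m2(4) by simp
            finally have UU': "real (card (U - U')) \<le> 2 * real M2 + 4" by linarith
            have "2 * x \<le> z / 128" if "x \<le> y" "256 * y \<le> z" for x y z :: real using that by linarith
            from this[OF UU' order.trans[OF C(3) CU]]
            have rem: "2 * real (card (U - U')) \<le> (1/64 - 1/128) * real (card U)" by simp
            have gU': "good (1/128) U' E e f" "good (1/128) U' E c' d'"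
              by (rule good_remove[OF U(2) m2(5) U'U _ rem] good_remove[OF U(2) m(5) U'U _ rem]; simp)+
            have "card (U - U') + card U' = card U"
              using U'U U(2) by (metis card_Diff_subset card_mono finite_subset le_add_diff_inverse2)
            then have "real (card U) = real (card (U - U')) + real (card U')" by linarith
            moreover have "h \<le> u'" if "u = x + u'" "x \<le> y" "0 \<le> y" "256 * y \<le> z" "z \<le> h" "2 * h \<le> u"
              for u u' x y z h :: real using that by linarith
            ultimately have cU': "\<gamma> / 2 * n \<le> real (card U')"
              using UU' C(3) Cn Ubig by simp
            have "P ([f, e] @ rev m2 @ l, r @ m @ [c', d'])"
              unfolding P_def prod.case using eqnew w dn sn cU'[unfolded U'_def] gU'[unfolded U'_def] by (intro exI conjI)
            then have "size lr \<le> size ([f, e] @ rev m2 @ l, r @ m @ [c', d'])" by (rule lr(2)[rule_format])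
            then have "card U \<le> card U'"
              unfolding lreq size_def prod.case eqnew S(1) U_def U'_def .
            moreover have "card U' < card U"
            proof (rule psubset_card_mono[OF U(2)])
              have "c' \<in> U" using m(3) by auto
              moreover have "c' \<notin> U'" by (auto simp: U'_def)
              ultimately show "U' \<subset> U" using U'U by blast
            qed
            ultimately show False by simp
          qed
          have "real (card ({} :: 'a set)) \<le> \<theta>3 * real (card U)" using con(2) by simp
          from con(3)[OF U(2) n23(2) dU3 U(5,4) finite.emptyI this]
          obtain m where m: "tight_walk E ([c, d] @ m @ [a, b])" "distinct m" "set m \<subseteq> U - {}"
            by (elim exE conjE) (rule that)
          define W where "W = U - set m"
          have "real (card W) \<le> real (card U)" using U(2) by (auto simp: W_def intro!: card_mono)
          also have "\<dots> \<le> \<gamma>0 * real (card V)"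
          proof -
            have "\<gamma> * n \<le> \<gamma>0 * n" using \<gamma>(2) npos by (intro mult_right_mono) auto
            then show ?thesis using Usmall unfolding n_def by linarith
          qed
          finally have Wc: "real (card W) \<le> \<gamma>0 * real (card V)" .
          have WV: "W \<subseteq> V" using U(1) by (auto simp: W_def)
          obtain N' where N': "tight_walk E ([a0, b0] @ N' @ [c0, d0])" "mset N' = mset N0 + mset_set W"
            using A(7) WV Wc by blast
          have "tight_walk E (([a, b] @ N) @ [c, d] @ m @ [a, b])"
            by (rule tight_walk_overlap) (use S(2) m(1) in auto)
          then have "tight_walk E (([a, b] @ N @ [c, d]) @ m @ [a, b])" by simp
          then have w: "tight_walk E ((l @ ([a0, b0] @ N0 @ [c0, d0]) @ r) @ m @ [a, b])" unfolding S(1) .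
          have "take 2 (l @ ([a0, b0] @ N0 @ [c0, d0]) @ r) = [a, b]" unfolding S(1) by simp
          moreover have "take 2 (l @ ([a0, b0] @ N0 @ [c0, d0]) @ r) = take 2 (l @ [a0, b0])"
            by (cases l) (auto simp: take_Cons' split: if_splits)
          ultimately have ab: "take 2 (l @ [a0, b0]) = [a, b]" by simp
          have "distinct (([a, b] @ N @ [c, d]) @ m)" using S(3) m(2,3) by (auto simp: U_def)
          then have dist: "distinct ((l @ ([a0, b0] @ N0 @ [c0, d0]) @ r) @ m)" unfolding S(1) .
          have "V = set (([a, b] @ N @ [c, d]) @ m) \<union> W" "set (([a, b] @ N @ [c, d]) @ m) \<inter> W = {}"
            using S(4) m(3) by (auto simp: U_def W_def)
          then have VW: "V = set ((l @ ([a0, b0] @ N0 @ [c0, d0]) @ r) @ m) \<union> W"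
            "set ((l @ ([a0, b0] @ N0 @ [c0, d0]) @ r) @ m) \<inter> W = {}" unfolding S(1) .
          have finW: "finite W" using U(2) by (simp add: W_def)
          have "tight_Hamilton_cycle V E (l @ [a0, b0] @ N' @ [c0, d0] @ r @ m)"
            by (rule tight_Hamilton_cycle_close[OF _ N' _ finW]) (use w ab dist VW in \<open>simp_all del: set_append\<close>)
          then show "\<exists>vs. tight_Hamilton_cycle V E vs" by blast
        qed
      qed
    qed
  qed
qed

theorem theorem1p3:
  shows "\<forall>\<epsilon>::real. \<epsilon> > 0 \<longrightarrow>
    (\<exists>(\<rho>::real) (n\<^sub>0::nat). \<rho> > 0 \<and>
      (\<forall>(V :: 'a set) (E :: 'a set set).
         uniform3_hypergraph V E \<longrightarrow>
         card V \<ge> n\<^sub>0 \<longrightarrow>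
         vertex_pair_dense \<rho> (1/4 + \<epsilon>) V E \<longrightarrow>
         real (min_vertex_degree V E) \<ge> \<epsilon> * real (card V choose 2) \<longrightarrow>
         (\<exists>vs. tight_Hamilton_cycle V E vs)))"
proof (intro allI impI)
  fix \<epsilon> :: real assume "\<epsilon> > 0"
  \<comment> \<open>Both hypotheses become weaker for a smaller \<epsilon>, so it may be cut off at
    1, as the earlier estimates require.\<close>
  define \<epsilon>' where "\<epsilon>' = min \<epsilon> 1"
  have eps: "0 < \<epsilon>'" "\<epsilon>' \<le> 1" "\<epsilon>' \<le> \<epsilon>" using \<open>\<epsilon> > 0\<close> by (auto simp: \<epsilon>'_def)
  show "\<exists>(\<rho>::real) (n\<^sub>0::nat). \<rho> > 0 \<and>
      (\<forall>(V :: 'a set) (E :: 'a set set).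
         uniform3_hypergraph V E \<longrightarrow>
         card V \<ge> n\<^sub>0 \<longrightarrow>
         vertex_pair_dense \<rho> (1/4 + \<epsilon>) V E \<longrightarrow>
         real (min_vertex_degree V E) \<ge> \<epsilon> * real (card V choose 2) \<longrightarrow>
         (\<exists>vs. tight_Hamilton_cycle V E vs))"
  proof (rule tight_Hamilton_cycle_small_eps[OF eps(1,2), where 'a = 'a], goal_cases)
    case (1 \<rho> n0)
    show ?case
    proof (intro exI[of _ \<rho>] exI[of _ n0] conjI allI impI)
      fix V :: "'a set" and E
      assume H: "uniform3_hypergraph V E" "n0 \<le> card V" "vertex_pair_dense \<rho> (1/4 + \<epsilon>) V E"
        and deg: "\<epsilon> * real (card V choose 2) \<le> real (min_vertex_degree V E)"
      have "vertex_pair_dense \<rho> (1/4 + \<epsilon>') V E" by (rule dense_mono[OF H(3)]) (use eps in auto)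
      moreover have "\<epsilon>' * real (card V choose 2) \<le> real (min_vertex_degree V E)"
        by (rule order.trans[OF mult_right_mono[OF eps(3)] deg]) simp
      ultimately show "\<exists>vs. tight_Hamilton_cycle V E vs" using 1(2)[OF H(1,2)] by blast
    qed (rule 1(1))
  qed
qed

end
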